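(* Let $G$ and $G'$ be framed $4$-valent graphs, each with one unicursal component. If $G$ and $G'$ represent the same free knot, then $[G]=[G']$ in $\mathbb{Z}_2\mathfrak{G}$.
   Context: Graphs are finite, may have loops and multiple edges, and may contain free loops (closed circle components without vertices). A $4$-valent graph is *framed* if at every vertex the four emanating half-edges are split into two pairs of (formally) opposite half-edges. Framed graphs are considered up to isomorphism preserving the framing. $G_0$ denotes the graph consisting of a single free loop. A *unicursal component* is an equivalence class of edges under the equivalence relation generated by: two edges are equivalent if they have half-edges that are opposite at some vertex (a free loop is a unicursal component by itself). Framed $4$-valent graphs with one unicursal component are in one-to-one correspondence with (non-oriented) chord diagrams: a framed graph $G$ corresponds to the chord diagram $C(G)$ whose circle is the closed path traversing $G$ by passing from each half-edge to its opposite at every vertex, and whose chords correspond to the vertices, each chord joining the two points of the circle mapped to the same vertex. $G_0$ corresponds to the chord diagram without chords. Two chords $a,b$ are *linked* if, after removing the two ends of $a$ from the circle, the ends of $b$ lie in different components. Two distinct vertices $v_1,v_2$ of $G$ are *incident* if the corresponding chords of $C(G)$ are linked, and we put $\langle v_1,v_2\rangle=1\in\mathbb{Z}_2$ if they are incident and $0$ otherwise; a vertex is not incident to itself. A vertex is *even* if the number of vertices incident to it is even, and *odd* otherwise. Reidemeister moves, described on chord diagrams (two chord ends are *adjacent* if they are joined by an arc of the circle containing no other chord ends): (1) First move: addition/removal of a chord whose two ends are adjacent (on the graph: addition/removal of a loop at a vertex formed by two non-opposite half-edges). (2) Second move: addition/removal of two chords $a,b$ such that one end of $a$ is adjacent to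 one end of $b$ and the other end of $a$ is adjacent to the other end of $b$ along two disjoint arcs (on the graph: addition/removal of a bigon). (3) Third move: given three chords $a,b,c$ whose six ends are grouped by three disjoint arcs into adjacent pairs, one pair consisting of an end of $a$ and an end of $b$, one of an end of $b$ and an end of $c$, and one of an end of $a$ and an end of $c$, interchange the two ends within each of the three pairs. All three moves preserve the property of having one unicursal component. A *free knot* is an equivalence class of framed $4$-valent graphs with one unicursal component modulo these three moves and their inverses. *Smoothing.* Let $v$ be a vertex of a framed graph with half-edges $a,b,c,d$, where $a$ is opposite to $c$ and $b$ is opposite to $d$. A smoothing at $v$ is either of the two framed $4$-valent graphs obtained by removing $v$ and joining the half-edges as $a$–$b$, $c$–$d$, or as $a$–$d$, $b$–$c$; the rest of the graph and the framings at the other vertices are unchanged. One may smooth at several vertices. Let $\mathfrak{G}$ be the set of equivalence classes of framed $4$-valent graphs with one unicursal component modulo second Reidemeister moves only, and let $\mathbb{Z}_2\mathfrak{G}$ be the $\mathbb{Z}_2$-vector space with basis $\mathfrak{G}$. For a framed $4$-valent graph $G$ with one unicursal component define $$[G]=\sum_{s} G_s\in\mathbb{Z}_2\mathfrak{G},$$ where $s$ runs over all ways of choosing one of the two smoothings at every even vertex of $G$ (even with respect to $G$; odd vertices are left unsmoothed) for which the resulting graph $G_s$ has exactly one unicursal component, and $G_s$ is regarded as an element of $\mathfrak{G}$. *)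

theory Defs
  imports Main "HOL-Library.FuncSet" "HOL-Library.Poly_Mapping" "HOL-Library.Z2"
begin

text \<open>
  A framed 4-valent graph is encoded by its half-edges: \<open>mate h\<close> is the other half of the
  edge containing \<open>h\<close>, \<open>vert h\<close> is the vertex from which \<open>h\<close> emanates, and \<open>opp h\<close> is the
  half-edge opposite to \<open>h\<close> at that vertex. Free loops have no half-edges and are only counted.
  Since graphs are finite and matter only up to isomorphism, natural numbers suffice as names.
  The values of the functions outside the set of half-edges are irrelevant.
\<close>

record graph =
  halfs :: "nat set"
  vert :: "nat \<Rightarrow> nat"
  mate :: "nat \<Rightarrow> nat"
  opp :: "nat \<Rightarrow> nat"
  free_loops :: nat

definition framed_graph :: "graph \<Rightarrow> bool" where
  "framed_graph G \<longleftrightarrow>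
     finite (halfs G) \<and>
     (\<forall>h\<in>halfs G. mate G h \<in> halfs G \<and> mate G h \<noteq> h \<and> mate G (mate G h) = h) \<and>
     (\<forall>h\<in>halfs G. opp G h \<in> halfs G \<and> opp G h \<noteq> h \<and> opp G (opp G h) = h
                    \<and> vert G (opp G h) = vert G h) \<and>
     (\<forall>h\<in>halfs G. card {k \<in> halfs G. vert G k = vert G h} = 4)"

definition verts :: "graph \<Rightarrow> nat set" where
  "verts G = vert G ` halfs G"

definition edges :: "graph \<Rightarrow> nat set set" where
  "edges G = (\<lambda>h. {h, mate G h}) ` halfs G"

definition isomorphic :: "graph \<Rightarrow> graph \<Rightarrow> bool" where
  "isomorphic G H \<longleftrightarrow> free_loops G = free_loops H \<and>
     (\<exists>f. bij_betw f (halfs G) (halfs H) \<and>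
          (\<forall>h\<in>halfs G. f (mate G h) = mate H (f h) \<and> f (opp G h) = opp H (f h)) \<and>
          (\<forall>h\<in>halfs G. \<forall>k\<in>halfs G. vert G h = vert G k \<longleftrightarrow> vert H (f h) = vert H (f k)))"

definition G0 :: graph where
  "G0 = \<lparr>halfs = {}, vert = id, mate = id, opp = id, free_loops = 1\<rparr>"


subsection \<open>Unicursal components\<close>

text \<open>The relation is already symmetric, because \<open>opp\<close> is an involution.\<close>

definition opposite_edges :: "graph \<Rightarrow> (nat set \<times> nat set) set" where
  "opposite_edges G =
     {(d, e). d \<in> edges G \<and> e \<in> edges G \<and> (\<exists>h\<in>halfs G. h \<in> d \<and> opp G h \<in> e)}"

definition num_unicursal_components :: "graph \<Rightarrow> nat" where
  "num_unicursal_components G = card (edges G // (opposite_edges G)\<^sup>*) + free_loops G"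

definition unicursal_graph :: "graph \<Rightarrow> bool" where
  "unicursal_graph G \<longleftrightarrow> framed_graph G \<and> num_unicursal_components G = 1"


subsection \<open>Chord diagrams\<close>

text \<open>
  A chord diagram is represented by the words obtained by reading the names of the chords at the
  consecutive chord ends along the circle, starting anywhere and in either direction; so each
  chord occurs twice in a word. For a graph with one unicursal component the circle is traversed
  by a cyclic list of outgoing half-edges \<open>hs\<close>: after \<open>h\<close> the traversal reaches a vertex
  through \<open>mate h\<close> and leaves it through the half-edge opposite to \<open>mate h\<close>.
\<close>

definition traversal :: "graph \<Rightarrow> nat list \<Rightarrow> bool" where
  "traversal G hs \<longleftrightarrow>
     set hs \<union> mate G ` set hs = halfs G \<and> distinct (hs @ map (mate G) hs) \<and>
     (\<forall>i<length hs. hs ! (Suc i mod length hs) = opp G (mate G (hs ! i)))"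

definition chord_diagram :: "graph \<Rightarrow> nat list set" where
  "chord_diagram G = {map (vert G) hs |hs. traversal G hs}"

text \<open>Removing the two ends of \<open>a\<close> cuts the circle into the arcs \<open>v\<close> and \<open>w @ u\<close>.\<close>

definition linked :: "nat list \<Rightarrow> nat \<Rightarrow> nat \<Rightarrow> bool" where
  "linked D a b \<longleftrightarrow>
     (\<exists>u v w. D = u @ [a] @ v @ [a] @ w \<and> b \<in> set v \<and> b \<in> set (w @ u))"

definition incident :: "graph \<Rightarrow> nat \<Rightarrow> nat \<Rightarrow> bool" where
  "incident G v w \<longleftrightarrow> v \<noteq> w \<and> (\<exists>D\<in>chord_diagram G. linked D v w)"

definition even_verts :: "graph \<Rightarrow> nat set" where
  "even_verts G = {v \<in> verts G. even (card {w \<in> verts G. incident G v w})}"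


subsection \<open>Reidemeister moves and free knots\<close>

text \<open>
  The first two moves add chords and the third one is its own inverse. Adjacent chord ends are
  placed next to each other, and one pair of them at the beginning of the word, by choosing the
  starting point of the reading.
\<close>

inductive move1 :: "nat list \<Rightarrow> nat list \<Rightarrow> bool" where
  "move1 u ([a, a] @ u)"

inductive move2 :: "nat list \<Rightarrow> nat list \<Rightarrow> bool" where
  "a \<noteq> b \<Longrightarrow> {p1, p2} = {a, b} \<Longrightarrow> {q1, q2} = {a, b} \<Longrightarrow>
     move2 (u @ v) ([p1, p2] @ u @ [q1, q2] @ v)"

inductive move3 :: "nat list \<Rightarrow> nat list \<Rightarrow> bool" where
  "distinct [a, b, c] \<Longrightarrow> {p1, p2} = {a, b} \<Longrightarrow> {q1, q2} = {b, c} \<Longrightarrow> {r1, r2} = {a, c} \<Longrightarrow>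
     move3 ([p1, p2] @ u @ [q1, q2] @ v @ [r1, r2] @ w)
           ([p2, p1] @ u @ [q2, q1] @ v @ [r2, r1] @ w)"

definition related_by :: "(nat list \<Rightarrow> nat list \<Rightarrow> bool) \<Rightarrow> graph \<Rightarrow> graph \<Rightarrow> bool" where
  "related_by M G H \<longleftrightarrow> (\<exists>D\<in>chord_diagram G. \<exists>E\<in>chord_diagram H. M D E)"

definition knot_step :: "graph \<Rightarrow> graph \<Rightarrow> bool" where
  "knot_step G H \<longleftrightarrow> unicursal_graph G \<and> unicursal_graph H \<and>
     (isomorphic G H \<or> related_by move1 G H \<or> related_by move2 G H \<or> related_by move3 G H)"

definition move2_step :: "graph \<Rightarrow> graph \<Rightarrow> bool" where
  "move2_step G H \<longleftrightarrow> unicursal_graph G \<and> unicursal_graph H \<and>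
     (isomorphic G H \<or> related_by move2 G H)"

definition knot_equiv :: "graph \<Rightarrow> graph \<Rightarrow> bool" where
  "knot_equiv G H \<longleftrightarrow> unicursal_graph G \<and> unicursal_graph H \<and> equivclp knot_step G H"

definition move2_equiv :: "graph \<Rightarrow> graph \<Rightarrow> bool" where
  "move2_equiv G H \<longleftrightarrow> unicursal_graph G \<and> unicursal_graph H \<and> equivclp move2_step G H"

lemma unicursal_G0: "unicursal_graph G0"
  by (simp add: unicursal_graph_def framed_graph_def num_unicursal_components_def
      G0_def edges_def quotient_def)

quotient_type free_knot = graph / partial: knot_equiv
  morphisms free_knot_rep free_knot_of
proof (rule part_equivpI)
  show "\<exists>G. knot_equiv G G"
    using unicursal_G0 by (auto simp: knot_equiv_def)
  show "symp knot_equiv"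
    by (auto simp: symp_def knot_equiv_def intro: equivclp_sym)
  show "transp knot_equiv"
    by (auto simp: transp_def knot_equiv_def intro: equivclp_trans)
qed

quotient_type move2_class = graph / partial: move2_equiv
  morphisms move2_class_rep move2_class_of
proof (rule part_equivpI)
  show "\<exists>G. move2_equiv G G"
    using unicursal_G0 by (auto simp: move2_equiv_def)
  show "symp move2_equiv"
    by (auto simp: symp_def move2_equiv_def intro: equivclp_sym)
  show "transp move2_equiv"
    by (auto simp: transp_def move2_equiv_def intro: equivclp_trans)
qed


subsection \<open>Smoothings and the bracket\<close>

text \<open>
  A choice of a smoothing at every vertex of \<open>S\<close> is the involution \<open>j\<close> exchanging the two
  half-edges that are joined. It is the identity elsewhere, so that distinct functions are
  distinct choices.
\<close>

definition smoothings :: "graph \<Rightarrow> nat set \<Rightarrow> (nat \<Rightarrow> nat) set" where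
  "smoothings G S =
     {j. (\<forall>h. if h \<in> halfs G \<and> vert G h \<in> S
              then j h \<in> halfs G \<and> vert G (j h) = vert G h \<and> j h \<noteq> h \<and> j h \<noteq> opp G h
                   \<and> j (j h) = h
              else j h = h)}"

text \<open>
  Half-edges of \<open>G\<close> are glued along the edges of \<open>G\<close> and by \<open>j\<close>; the relation is symmetric. The
  connected pieces that reach a surviving vertex have exactly two surviving ends and form the
  edges of the new graph; the remaining ones are closed circles and become free loops.
\<close>

definition glued :: "graph \<Rightarrow> nat set \<Rightarrow> (nat \<Rightarrow> nat) \<Rightarrow> (nat \<times> nat) set" where
  "glued G S j = ({(h, mate G h) |h. h \<in> halfs G} \<union>
                  {(h, j h) |h. h \<in> halfs G \<and> vert G h \<in> S})\<^sup>*"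

definition smooth :: "graph \<Rightarrow> nat set \<Rightarrow> (nat \<Rightarrow> nat) \<Rightarrow> graph" where
  "smooth G S j =
     (let H = {h \<in> halfs G. vert G h \<notin> S} in
      \<lparr>halfs = H,
       vert = vert G,
       mate = (\<lambda>h. THE k. k \<in> H \<and> k \<noteq> h \<and> (h, k) \<in> glued G S j),
       opp = opp G,
       free_loops = free_loops G + card {C \<in> halfs G // glued G S j. C \<inter> H = {}}\<rparr>)"

lemma finite_smoothings:
  assumes "finite (halfs G)"
  shows "finite (smoothings G S)"
proof (rule finite_subset)
  show "smoothings G S \<subseteq>
      {j. \<forall>h. (h \<in> halfs G \<longrightarrow> j h \<in> halfs G) \<and> (h \<notin> halfs G \<longrightarrow> j h = h)}"
    by (auto simp: smoothings_def split: if_splits)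
  have "{j. \<forall>h. (h \<in> halfs G \<longrightarrow> j h \<in> halfs G) \<and> (h \<notin> halfs G \<longrightarrow> j h = h)}
      \<subseteq> (\<lambda>f h. if h \<in> halfs G then f h else h) ` (halfs G \<rightarrow>\<^sub>E halfs G)" (is "?A \<subseteq> ?B")
  proof
    fix j assume "j \<in> ?A"
    then show "j \<in> ?B"
      by (intro image_eqI[where x = "restrict j (halfs G)"]) (auto simp: fun_eq_iff)
  qed
  then show "finite {j. \<forall>h. (h \<in> halfs G \<longrightarrow> j h \<in> halfs G) \<and> (h \<notin> halfs G \<longrightarrow> j h = h)}"
    by (rule finite_subset) (simp add: assms finite_PiE)
qed

definition bracket :: "graph \<Rightarrow> move2_class \<Rightarrow>\<^sub>0 bit" where
  "bracket G =
     (\<Sum>j \<in> {j \<in> smoothings G (even_verts G).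
              num_unicursal_components (smooth G (even_verts G) j) = 1}.
        Poly_Mapping.single (move2_class_of (smooth G (even_verts G) j)) 1)"

end

theory Submission
  imports Defs
begin

text \<open>
  A choice of smoothings pairs the half-edges at every vertex: by \<open>j\<close> at the smoothed vertices
  and by \<open>opp\<close> at the others. Together with the pairing \<open>mate\<close> this makes the set of half-edges a
  disjoint union of circuits; the smoothed graph has one unicursal component iff there is only one
  circuit, and then its chord diagram is read along this circuit, ignoring the smoothed vertices.
  So the bracket is a state sum over the pairings, in which vertices can be smoothed one at a time.
  For such sums, two half-edges that form an edge between smoothed vertices can be contracted, and
  a closed piece that misses the rest makes the sum vanish.

  These rules imply, over the field with two elements, that the vertices of a loop or of a bigon
  may be smoothed straight through: of the four smoothings of a bigon one splits off a circle, two
  cancel, and the last one is the straight one; if both vertices are odd, a second move does the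
  same. For a third move, parity forces one of the three vertices, say \<open>a\<close>, to be even and the
  other two to have equal parity. One smoothing at \<open>a\<close> gives bigons on both sides, which reduce to
  the same state; the other one gives isomorphic graphs.
\<close>

section \<open>Closed traversals of two pairings\<close>

text \<open>Both sides of a move are compared on one set of half-edges. Erasing a chord is expressed
  by declaring its vertex resolved while \<open>p\<close> still runs straight through it, so that
  the first two moves only change the set of resolved vertices; a third move only changes vertex
  names and keeps all half-edges and both pairings. The actual graphs are recovered by a single
  construction that suppresses half-edges. The obstacle is that an unresolved vertex carries a
  label, and edges next to it cannot be contracted. Resolved vertices are invisible in the words,
  however, so a label may slide along an edge onto a neighbouring resolved passage. In the third
  move this produces the bigon for one smoothing and the isomorphism for the other. Vertex names of
  resolved half-edges are mere bookkeeping, and words count only up to starting point, direction and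
  renaming. State sums are therefore set up with exactly this freedom.\<close>

definition pairing :: "'a set \<Rightarrow> ('a \<Rightarrow> 'a) \<Rightarrow> bool" where
  "pairing X m \<longleftrightarrow> (\<forall>x\<in>X. m x \<in> X \<and> m x \<noteq> x \<and> m (m x) = x)"

lemma pairingD:
  assumes "pairing X m" "x \<in> X"
  shows "m x \<in> X" "m x \<noteq> x" "m (m x) = x"
  using assms by (auto simp: pairing_def)

lemma pairing_inj: "pairing X m \<Longrightarrow> x \<in> X \<Longrightarrow> y \<in> X \<Longrightarrow> m x = m y \<Longrightarrow> x = y"
  by (metis pairingD(3))

lemma pairing_eq_iff: "pairing X m \<Longrightarrow> x \<in> X \<Longrightarrow> y \<in> X \<Longrightarrow> m x = y \<longleftrightarrow> x = m y"
  by (metis pairingD(3))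

lemma pairing_closed_iff:
  "pairing X m \<Longrightarrow> m ` C \<subseteq> C \<Longrightarrow> x \<in> X \<Longrightarrow> m x \<in> C \<longleftrightarrow> x \<in> C"
  by (metis image_subset_iff pairingD(3))

text \<open>This is \<open>traversal\<close> with \<open>mate\<close> and \<open>opp\<close>
  replaced by arbitrary pairings, so that smoothed vertices can enter through \<open>p\<close>. The
  list holds the half-edges by which the circuit departs; their images under \<open>m\<close> are
  those through which it arrives.\<close>

definition circuit :: "'a set \<Rightarrow> ('a \<Rightarrow> 'a) \<Rightarrow> ('a \<Rightarrow> 'a) \<Rightarrow> 'a list \<Rightarrow> bool" where
  "circuit X m p hs \<longleftrightarrow>
     set hs \<union> m ` set hs = X \<and> distinct (hs @ map m hs) \<and>
     (\<forall>i<length hs. hs ! (Suc i mod length hs) = p (m (hs ! i)))"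

lemma traversal_circuit: "traversal G hs \<longleftrightarrow> circuit (halfs G) (mate G) (opp G) hs"
  by (simp add: traversal_def circuit_def)

text \<open>Connectedness is phrased through closed subsets rather than paths: in this form it
  passes to images and contracted sets by taking images or shrinking the subset. It holds for the
  empty set, in accordance with the empty circuit.\<close>

definition conn :: "'a set \<Rightarrow> ('a \<Rightarrow> 'a) \<Rightarrow> ('a \<Rightarrow> 'a) \<Rightarrow> bool" where
  "conn X m p \<longleftrightarrow> (\<forall>C\<subseteq>X. C \<noteq> {} \<longrightarrow> m ` C \<subseteq> C \<longrightarrow> p ` C \<subseteq> C \<longrightarrow> C = X)"

lemma connD: "conn X m p \<Longrightarrow> C \<subseteq> X \<Longrightarrow> C \<noteq> {} \<Longrightarrow> m ` C \<subseteq> C \<Longrightarrow> p ` C \<subseteq> C \<Longrightarrow> C = X"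
  by (simp add: conn_def)

text \<open>With the head repeated at the end, the cyclic index condition becomes a condition on
  neighbours, and cutting, rotating and reversing follow from the list laws of
  \<open>successively\<close>.\<close>

lemma cyclic_successively:
  assumes "hs \<noteq> []"
  shows "(\<forall>i<length hs. hs ! (Suc i mod length hs) = f (hs ! i)) \<longleftrightarrow>
    successively (\<lambda>x y. y = f x) (hs @ [hd hs])"
proof -
  have "(hs @ [hd hs]) ! Suc i = hs ! (Suc i mod length hs)" if "i < length hs" for i
    using that assms by (cases "Suc i = length hs") (auto simp: nth_append hd_conv_nth)
  moreover have "successively P xs \<longleftrightarrow> (\<forall>i. Suc i < length xs \<longrightarrow> P (xs ! i) (xs ! Suc i))"
    for P and xs :: "'a list"
  proof (induction P xs rule: successively.induct)
    case (3 P x y xs)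
    show ?case unfolding successively.simps 3 by (auto simp: nth_Cons split: nat.splits)
  qed auto
  ultimately show ?thesis by (auto simp: nth_append)
qed

lemma successively_closed:
  "ys \<noteq> [] \<Longrightarrow>
    successively P (h # ys @ [h]) \<longleftrightarrow> P h (hd ys) \<and> successively P ys \<and> P (last ys) h"
  by (cases ys) (auto simp: successively_Cons successively_append_iff)

lemma circuit_Cons:
  "circuit X m p (h # ys) \<longleftrightarrow>
     set (h # ys) \<union> m ` set (h # ys) = X \<and> distinct ((h # ys) @ map m (h # ys)) \<and>
     successively (\<lambda>x y. y = p (m x)) (h # ys @ [h])"
  unfolding circuit_def using cyclic_successively[of "h # ys" "\<lambda>x. p (m x)"] by simp

lemma circuit_Nil: "circuit X m p [] \<longleftrightarrow> X = {}"
  by (auto simp: circuit_def)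

lemma circuit_rotate1:
  assumes "circuit X m p hs"
  shows "circuit X m p (rotate1 hs)"
proof (cases hs)
  case (Cons h ys)
  show ?thesis
  proof (cases ys)
    case Nil
    then show ?thesis using assms Cons by simp
  next
    case (Cons k zs)
    let ?P = "\<lambda>x y. y = p (m x)"
    have t: "circuit X m p (h # k # zs)" using assms \<open>hs = h # ys\<close> Cons by simp
    then have "successively ?P (h # k # zs @ [h])"
      unfolding circuit_Cons by (simp only: append_Cons)
    then have "successively ?P (k # zs @ [h])" "?P h k"
      unfolding successively.simps(3) by (blast, blast)
    then have "successively ?P ((k # zs @ [h]) @ [k])"
      unfolding successively_append_iff by simp
    moreover have "set (k # zs @ [h]) \<union> m ` set (k # zs @ [h]) = X"
      "distinct ((k # zs @ [h]) @ map m (k # zs @ [h]))"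
      using t unfolding circuit_Cons by (force, auto)
    ultimately have "circuit X m p (k # zs @ [h])"
      unfolding circuit_Cons by simp
    then show ?thesis using \<open>hs = h # ys\<close> Cons by simp
  qed
qed (use assms in simp)

lemma circuit_rotate: "circuit X m p hs \<Longrightarrow> circuit X m p (rotate n hs)"
  by (induction n) (auto simp: circuit_rotate1)

lemma circuit_append_commute: "circuit X m p (as @ bs) \<Longrightarrow> circuit X m p (bs @ as)"
  using circuit_rotate[of X m p "as @ bs" "length as"] by (simp add: rotate_append)

text \<open>Run backwards, a circuit departs by the half-edges through which it used to arrive. A
  step \<open>y = p (m x)\<close> turns into \<open>m x = p (m (m y))\<close> because both pairings
  are involutions.\<close>

lemma circuit_rev:
  assumes "circuit X m p hs" "pairing X m" "pairing X p"
  shows "circuit X m p (rev (map m hs))"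
proof (cases hs)
  case Nil
  then show ?thesis using assms by simp
next
  case (Cons h ys)
  have X: "set hs \<subseteq> X" using assms(1) by (auto simp: circuit_def)
  have mm: "m (m x) = x" if "x \<in> set hs" for x using X that pairingD[OF assms(2)] by blast
  have "map m (map m hs) = hs" using mm by (simp add: map_idI)
  moreover have "m ` m ` set hs = set hs" using mm by force
  moreover have "successively (\<lambda>x y. y = p (m x)) (rev (map m hs) @ [hd (rev (map m hs))])"
  proof -
    have s: "successively (\<lambda>x y. y = p (m x)) (hs @ [hd hs])"
      using assms(1) Cons unfolding Cons circuit_Cons by simp
    have last: "hd hs = p (m (last hs))"
      using s Cons by (simp add: successively_append_iff del: append.simps)
    have "successively (\<lambda>x y. y = p (m x)) hs"
      using s by (simp add: successively_append_iff)
    then have "successively (\<lambda>x y. m x = p (m (m y))) hs"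
    proof (rule successively_mono)
      fix x y assume "x \<in> set hs" "y \<in> set hs" "y = p (m x)"
      then show "m x = p (m (m y))"
        using mm X pairingD(1)[OF assms(2), of x] pairingD(3)[OF assms(3), of "m x"] by auto
    qed
    then have "successively (\<lambda>x y. y = p (m x)) (rev (map m hs))"
      by (simp add: successively_map)
    moreover have "last (rev (map m hs)) = m (hd hs)" "hd (rev (map m hs)) = m (last hs)"
      using Cons by (auto simp: last_rev hd_rev hd_map last_map)
    moreover have "m (last hs) = p (m (m (hd hs)))"
    proof -
      have "m (last hs) \<in> X" "hd hs \<in> set hs"
        using X pairingD[OF assms(2)] Cons last_in_set[of hs] by auto
      then show ?thesis using last mm pairingD[OF assms(3)] by simp
    qed
    ultimately show ?thesis using Cons
      by (simp add: successively_append_iff del: map_append rev.simps)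
  qed
  moreover have ne: "rev (map m hs) \<noteq> []" using Cons by simp
  moreover have "set (rev (map m hs)) \<union> m ` set (rev (map m hs)) = X"
    "distinct (rev (map m hs) @ map m (rev (map m hs)))"
    using assms(1) calculation(1,2) by (auto simp: circuit_def rev_map[symmetric])
  ultimately show ?thesis
    unfolding circuit_def using cyclic_successively[OF ne, of "\<lambda>x. p (m x)"] by blast
qed

lemma circuit_nth:
  assumes "circuit X m p hs" "i < length hs"
  shows "hs ! i = ((p \<circ> m) ^^ i) (hd hs)"
  using assms(2)
proof (induction i)
  case 0
  then show ?case by (simp add: hd_conv_nth)
next
  case (Suc i)
  then show ?case using assms(1) by (auto simp: circuit_def dest: spec[of _ i])
qed

lemma circuit_card:
  assumes "circuit X m p hs"
  shows "card X = 2 * length hs" and "finite X"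
proof -
  have "X = set (hs @ map m hs)" "distinct (hs @ map m hs)" using assms by (auto simp: circuit_def)
  then show "card X = 2 * length hs" "finite X" using distinct_card[of "hs @ map m hs"] by auto
qed

text \<open>A circuit is the orbit of its head under \<open>p \<circ> m\<close>, and its length is
  half the number of half-edges. The head of \<open>ks\<close> occurs in \<open>hs\<close> or in the
  reversed circuit, and rotating the latter to start there gives \<open>ks\<close>.\<close>

lemma circuit_unique:
  assumes "circuit X m p hs" "circuit X m p ks" "pairing X m" "pairing X p"
  shows "(\<exists>as bs. hs = as @ bs \<and> ks = bs @ as) \<or>
    (\<exists>as bs. rev (map m hs) = as @ bs \<and> ks = bs @ as)"
proof (cases ks)
  case Nil
  then have "hs = []" using circuit_card(1)[OF assms(1)] circuit_card(1)[OF assms(2)] by simp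
  with Nil show ?thesis by simp
next
  case (Cons k ls)
  have *: "\<exists>as bs. xs = as @ bs \<and> ks = bs @ as" if t: "circuit X m p xs" and kxs: "k \<in> set xs"
    for xs
  proof -
    obtain as bs where xs: "xs = as @ k # bs" using split_list[OF kxs] by blast
    then have t': "circuit X m p (k # bs @ as)"
      using circuit_append_commute[of X m p as "k # bs"] t by simp
    have "ks = k # bs @ as"
    proof (rule nth_equalityI)
      show l: "length ks = length (k # bs @ as)"
        using circuit_card[OF assms(2)] circuit_card[OF t'] by simp
      show "ks ! i = (k # bs @ as) ! i" if "i < length ks" for i
        using circuit_nth[OF assms(2) that] circuit_nth[OF t', of i] that l Cons by simp
    qed
    then show ?thesis using xs by (intro exI[of _ as] exI[of _ "k # bs"]) simp
  qed
  have "k \<in> X" using assms(2) Cons by (auto simp: circuit_def)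
  then consider "k \<in> set hs" | "k \<in> set (rev (map m hs))" using assms(1) by (auto simp: circuit_def)
  then show ?thesis
    using *[OF assms(1)] *[OF circuit_rev[OF assms(1,3,4)]] by cases auto
qed

lemma circuit_conn:
  assumes "circuit X m p hs" "pairing X m"
  shows "conn X m p"
  unfolding conn_def
proof (intro allI impI)
  fix C assume C: "C \<subseteq> X" "C \<noteq> {}" "m ` C \<subseteq> C" "p ` C \<subseteq> C"
  have mC: "m x \<in> C \<longleftrightarrow> x \<in> C" if "x \<in> X" for x
    using C(1,3) pairingD[OF assms(2) that] by (metis image_subset_iff)
  have X: "X = set hs \<union> m ` set hs" using assms(1) by (auto simp: circuit_def)
  then obtain h where h: "h \<in> set hs" "h \<in> C" using C mC by blast
  then obtain as bs where hs: "hs = as @ h # bs" using split_list by metis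
  let ?ks = "h # bs @ as"
  have t: "circuit X m p ?ks" using circuit_append_commute[of X m p as "h # bs"] assms(1) hs by simp
  have "((p \<circ> m) ^^ i) h \<in> C" for i
    using C h by (induction i) auto
  then have "set ?ks \<subseteq> C" using circuit_nth[OF t] by (metis in_set_conv_nth list.sel(1) subsetI)
  moreover have "set ?ks = set hs" using hs by auto
  ultimately show "C = X" using C X by blast
qed

text \<open>The orbit of a half-edge under \<open>p \<circ> m\<close> up to its first return,
  together with its image under \<open>m\<close>, is closed under both pairings and hence
  everything. The point that needs care is that orbit and image are disjoint: no edge is run through
  in both directions.\<close>

lemma conn_circuit:
  assumes "conn X m p" "pairing X m" "pairing X p" "finite X"
  shows "\<exists>hs. circuit X m p hs"
proof (cases "X = {}")
  case True
  then show ?thesis using circuit_Nil by metis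
next
  case False
  then obtain h where h: "h \<in> X" by auto
  let ?s = "p \<circ> m"
  define f where "f i = (?s ^^ i) h" for i
  note M = pairingD[OF assms(2)] and P = pairingD[OF assms(3)]
  have fX: "f i \<in> X" for i using h M P by (induction i) (auto simp: f_def)
  have fS: "f (Suc i) = p (m (f i))" for i by (simp add: f_def)
  \<comment> \<open>\<open>p \<circ> m\<close> is injective, so any repetition can be pulled back to
    the start; the orbit returns to \<open>h\<close> itself.\<close>
  have inj: "f (i + d) = f i \<Longrightarrow> f d = h" for i d
  proof (induction i)
    case (Suc i)
    have "f (i + d) = f i" using Suc.prems fX pairing_inj[OF assms(2)] pairing_inj[OF assms(3)] M(1)
      by (metis add_Suc fS)
    then show ?case using Suc by simp
  qed (simp add: f_def)
  have "\<not> inj_on f UNIV" using fX assms(4)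
    by (metis finite_imageD finite_subset image_subsetI infinite_UNIV_nat)
  then obtain i j where "i < j" "f i = f j" by (metis linorder_inj_onI' UNIV_I)
  then have "f (j - i) = h" "0 < j - i" using inj[of i "j - i"] by auto
  define n where "n = (LEAST n. 0 < n \<and> f n = h)"
  have n: "0 < n" "f n = h"
    unfolding n_def using LeastI[of "\<lambda>n. 0 < n \<and> f n = h" "j - i"] \<open>f (j - i) = h\<close> \<open>0 < j - i\<close>
      by auto
  have least: "n \<le> k" if "0 < k" "f k = h" for k
    unfolding n_def using that by (auto intro: Least_le)
  define hs where "hs = map f [0..<n]"
  have dist: "distinct hs"
    unfolding hs_def distinct_map
  proof (intro conjI linorder_inj_onI')
    fix i j assume ij: "i \<in> set [0..<n]" "j \<in> set [0..<n]" "i < j"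
    show "f i \<noteq> f j"
      using inj[of i "j - i"] least[of "j - i"] ij by auto
  qed simp
  \<comment> \<open>\<open>m\<close> conjugates \<open>p \<circ> m\<close> to its inverse, so \<open>f (i + d) = m (f i)\<close> would yield a fixed point of
    \<open>m\<close> or \<open>p\<close> in the middle between \<open>i\<close> and \<open>i + d\<close>.\<close>
  have refl: "f (i + 2 * e) \<noteq> m (f i) \<and> f (i + 2 * e + 1) \<noteq> m (f i)" for i e
  proof (induction e arbitrary: i)
    case 0
    have "f (i + 0) \<noteq> m (f i)" using fX M by (metis add.right_neutral)
    moreover have "f (i + 1) \<noteq> m (f i)" using fS[of i] fX[of i] M(1)[of "f i"] P(2)[of "m (f i)"]
      by simp
    ultimately show ?case by simp
  next
    case (Suc e)
    have pred: "f k = m (f (Suc i))" if "f (Suc k) = m (f i)" for k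
    proof -
      have "p (m (f k)) = m (f i)" using that fS by simp
      then have "m (f k) = f (Suc i)" using P(3)[of "m (f k)"] M(1) fX fS by simp
      then show ?thesis using M(3)[of "f k"] fX by simp
    qed
    show ?case
      using Suc.IH[of "Suc i"] pred[of "Suc i + 2 * e"] pred[of "Suc i + 2 * e + 1"] by auto
  qed
  have refl': "f (i + d) \<noteq> m (f i)" for i d
    using refl[of i "d div 2"] by (cases "even d") (auto elim: oddE)
  have disj: "f i \<noteq> m (f j)" for i j
    using refl'[of i "j - i"] refl'[of j "i - j"] fX M
      by (cases i j rule: le_cases) (metis le_add_diff_inverse)+
  have next': "hs ! (Suc i mod length hs) = p (m (hs ! i))" if "i < length hs" for i
    using that fS[of i] n by (cases "Suc i = n") (auto simp: hs_def f_def)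
  have fhs: "f i \<in> set hs" for i
  proof (induction i)
    case 0
    then show ?case using n by (auto simp: hs_def)
  next
    case (Suc i)
    then obtain k where "k < length hs" "hs ! k = f i" by (metis in_set_conv_nth)
    then show ?case using next'[of k] fS n
      by (metis length_greater_0_conv length_pos_if_in_set Suc mod_less_divisor nth_mem)
  qed
  let ?C = "set hs \<union> m ` set hs"
  \<comment> \<open>The head is reached again as \<open>f n\<close>, so every entry has a
    predecessor from which it arises through \<open>p\<close>.\<close>
  have f: "x \<in> set hs \<Longrightarrow> \<exists>i. x = f (Suc i)" for x
  proof -
    assume "x \<in> set hs"
    then obtain i where i: "i < n" "x = f i" by (auto simp: hs_def)
    have "f 0 = f (Suc (n - 1))" using n by (simp add: f_def)
    then show ?thesis using i by (cases i) blast+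
  qed
  have "?C = X"
  proof (rule connD[OF assms(1)])
    show "?C \<subseteq> X" using fX M by (auto simp: hs_def)
    then have sub: "x \<in> X" if "x \<in> set hs" for x using that by auto
    show "?C \<noteq> {}" using fhs by auto
    show "m ` ?C \<subseteq> ?C" using M sub by auto
    have "p (m x) \<in> set hs" if "x \<in> set hs" for x using f[OF that] fhs fS by metis
    moreover have "p x \<in> m ` set hs" if x: "x \<in> set hs" for x
    proof -
      obtain i where "x = p (m (f i))" using f[OF x] fS by metis
      then show ?thesis using fhs fX M(1) P(3) by simp
    qed
    ultimately show "p ` ?C \<subseteq> ?C" by blast
  qed
  moreover have "distinct (hs @ map m hs)"
    using dist disj fX pairing_inj[OF assms(2)] unfolding distinct_append distinct_map
    by (auto simp: hs_def inj_on_def)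
  ultimately show ?thesis using next' unfolding circuit_def by blast
qed

lemma circuit_closed_eq:
  assumes "circuit X m p hs" "pairing X m" "C \<subseteq> X" "C \<noteq> {}" "m ` C \<subseteq> C" "p ` C \<subseteq> C"
  shows "C = X"
  using connD[OF circuit_conn[OF assms(1,2)]] assms by blast

text \<open>Contraction of the edge \<open>{h, k}\<close>: the updated pairing joins the outer
  partners \<open>p h\<close> and \<open>p k\<close> directly. The assumption
  \<open>p h \<noteq> k\<close> excludes that the edge closes up to a circle by itself.\<close>

lemma circuit_remove_edge:
  assumes t: "circuit X m p hs" and m: "pairing X m" and p: "pairing X p"
    and h: "h \<in> X" "k = m h" "p h \<noteq> k"
  shows "circuit (X - {h, k}) m (p(p h := p k, p k := p h)) (filter (\<lambda>x. x \<noteq> h \<and> x \<noteq> k) hs)"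
proof -
  have key: "\<exists>as bs. hs = as @ h # bs \<and>
      circuit (X - {h, k}) m (p(p h := p k, p k := p h)) (bs @ as) \<and> k \<notin> set hs"
    if hhs: "h \<in> set hs" and h: "h \<in> X" "k = m h" "p h \<noteq> k" for h k
  proof -
    obtain as bs where hs: "hs = as @ h # bs" using hhs split_list by metis
    let ?ys = "bs @ as"
    have t': "circuit X m p (h # ?ys)" using t hs circuit_append_commute[of X m p as "h # bs"]
      by simp
    then have s: "successively (\<lambda>x y. y = p (m x)) (h # ?ys @ [h])"
      and d: "distinct (h # ?ys @ map m (h # ?ys))"
      and X: "X = insert h (insert k (set ?ys \<union> m ` set ?ys))"
      by (auto simp: circuit_Cons h)
    have ne: "?ys \<noteq> []"
    proof
      assume "?ys = []"
      then have "h = p k" using s h by (auto simp: successively_Cons)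
      moreover have "p (p k) = k" using pairingD[OF p] pairingD(1)[OF m h(1)] h by simp
      ultimately show False using h by simp
    qed
    have khs: "k \<notin> set hs" using d hs h by auto
    have "circuit (X - {h, k}) m (p(p h := p k, p k := p h)) ?ys"
      unfolding circuit_def cyclic_successively[OF ne, of "\<lambda>x. (p(p h := p k, p k := p h)) (m x)"]
    proof (intro conjI)
      show "set ?ys \<union> m ` set ?ys = X - {h, k}" using X d h by auto
      show "distinct (?ys @ map m ?ys)" using d by auto
      \<comment> \<open>Around the removed entry the circuit arrives through \<open>p h\<close>,
        departs by \<open>h\<close> and continues with \<open>p k\<close>. Without \<open>h\<close>,
        the last entry is followed by the first one through the new value of the pairing at
        \<open>p h\<close>.\<close>
      have l: "h = p (m (last ?ys))" and 1: "hd ?ys = p k"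
        using s[unfolded successively_closed[OF ne]] h by blast+
      have lX: "last ?ys \<in> X" using X last_in_set[OF ne] by auto
      have ml: "m (last ?ys) = p h" using l pairingD[OF p] pairingD(1)[OF m lX] by metis
      obtain zs l where zs: "?ys = zs @ [l]" using ne by (metis append_butlast_last_id)
      have s2: "successively (\<lambda>x y. y = p (m x)) ?ys"
        using s[unfolded successively_closed[OF ne]] by blast
      have dz: "distinct (zs @ [l])" "h \<notin> set (zs @ [l])" "m h \<notin> set (zs @ [l])"
        using d zs by (auto simp: distinct_append)
      have zl: "hd (zs @ [l]) = p k" "m l = p h" using 1 ml zs by auto
      have "successively (\<lambda>x y. y = (p(p h := p k, p k := p h)) (m x)) (zs @ [l])"
      proof (rule successively_mono[OF s2[unfolded zs] _])
        fix x y assume a: "x \<in> set (zs @ [l])" "y \<in> set (zs @ [l])" "y = p (m x)"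
        \<comment> \<open>An interior step through a changed value would lead to \<open>h\<close> or
          \<open>k\<close>, and neither occurs in the rest.\<close>
        have "m x \<noteq> p h" using a(2,3) dz(2) pairingD(3)[OF p] h(1) by auto
        moreover have "m x \<noteq> p k" using a(2,3) dz(3) h pairingD(3)[OF p] pairingD[OF m] by auto
        ultimately show "y = (p(p h := p k, p k := p h)) (m x)" using a by simp
      qed
      moreover have "p h \<noteq> p k" using pairing_inj[OF p] h pairingD[OF m] by metis
      ultimately show "successively (\<lambda>x y. y = (p(p h := p k, p k := p h)) (m x)) (?ys @ [hd ?ys])"
        unfolding zs using zl by (simp add: successively_append_iff)
    qed
    then show ?thesis using hs khs by blast
  qed
  have fin: "filter (\<lambda>x. x \<noteq> a \<and> x \<noteq> b) (as @ a # bs) = as @ bs"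
    if "distinct (as @ a # bs)" "b \<notin> set (as @ a # bs)" for a b :: 'a and as bs
  proof -
    have "filter (\<lambda>x. x \<noteq> a \<and> x \<noteq> b) as = as" "filter (\<lambda>x. x \<noteq> a \<and> x \<noteq> b) bs = bs"
      using that by (auto simp: filter_id_conv)
    then show ?thesis by simp
  qed
  have dh: "distinct hs" using t by (auto simp: circuit_def)
  have hk: "m k = h" "k \<in> X" "p k \<noteq> h" "p h \<noteq> p k"
    using h pairingD[OF m] pairingD[OF p] pairing_inj[OF p] by metis+
  have "X = set hs \<union> m ` set hs" using t by (simp add: circuit_def)
  moreover from this have "k = x" if "x \<in> set hs" "h = m x" for x
    using that h pairingD(3)[OF m, of x] by auto
  ultimately consider "h \<in> set hs" | "k \<in> set hs" using h(1) by blast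
  then show ?thesis
  proof cases
    case 1
    then obtain as bs where a: "hs = as @ h # bs" "k \<notin> set hs"
      "circuit (X - {h, k}) m (p(p h := p k, p k := p h)) (bs @ as)" using key[OF _ h] by blast
    have "filter (\<lambda>x. x \<noteq> h \<and> x \<noteq> k) hs = as @ bs"
      unfolding a(1) by (rule fin) (use a(1,2) dh in simp_all)
    then show ?thesis using circuit_append_commute[OF a(3)] by (simp only:)
  next
    case 2
    have e: "X - {h, k} = X - {k, h}" "p(p h := p k, p k := p h) = p(p k := p h, p h := p k)"
      using hk(4) by auto
    have "k \<in> X" "h = m k" "p k \<noteq> h" using hk by auto
    then obtain as bs where a: "hs = as @ k # bs" "h \<notin> set hs"
      "circuit (X - {h, k}) m (p(p h := p k, p k := p h)) (bs @ as)"
      unfolding e using key[OF 2] by blast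
    have "filter (\<lambda>x. x \<noteq> k \<and> x \<noteq> h) hs = as @ bs"
      unfolding a(1) by (rule fin) (use a(1,2) dh in simp_all)
    then have "filter (\<lambda>x. x \<noteq> h \<and> x \<noteq> k) hs = as @ bs" by (simp only: conj_commute)
    then show ?thesis using circuit_append_commute[OF a(3)] by (simp only:)
  qed
qed

lemma pairing_remove_edge:
  assumes "pairing X m" "pairing X p" "h \<in> X" "k = m h" "p h \<noteq> k"
  shows "pairing (X - {h, k}) m" "pairing (X - {h, k}) (p(p h := p k, p k := p h))"
proof -
  have k: "k \<in> X" "k \<noteq> h" "m k = h" using pairingD[OF assms(1,3)] assms(4) by auto
  have "m x \<noteq> h" "m x \<noteq> k" if "x \<in> X" "x \<noteq> h" "x \<noteq> k" for x
    using that pairingD(3)[OF assms(1), of x] k assms(4) by auto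
  then show "pairing (X - {h, k}) m"
    using pairingD[OF assms(1)] by (simp add: pairing_def)
  have p: "p h \<in> X" "p k \<in> X" "p h \<noteq> p k" "p h \<noteq> h" "p k \<noteq> k" "p k \<noteq> h"
    using pairingD[OF assms(2)] assms(3,5) k pairing_inj[OF assms(2)] by metis+
  have "p x \<noteq> h" "p x \<noteq> k" if "x \<in> X" "x \<noteq> p h" "x \<noteq> p k" for x
    using that pairingD(3)[OF assms(2)] by metis+
  moreover have "p x \<noteq> p h" "p x \<noteq> p k" if "x \<in> X" "x \<noteq> h" "x \<noteq> k" for x
    using that pairing_inj[OF assms(2)] assms(3) k by metis+
  ultimately show "pairing (X - {h, k}) (p(p h := p k, p k := p h))"
    using p k assms(3,5) pairingD[OF assms(2)] unfolding pairing_def by auto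
qed

text \<open>A closed set contains all of \<open>h\<close>, \<open>k\<close>, \<open>p h\<close>,
  \<open>p k\<close> or none of them, so deleting \<open>h\<close> and \<open>k\<close> from it
  leaves a nonempty set that is closed for the contracted pairings.\<close>

lemma conn_remove_edge:
  assumes "conn (X - {h, k}) m (p(p h := p k, p k := p h))"
    and "pairing X m" "pairing X p" "h \<in> X" "k = m h" "p h \<noteq> k"
  shows "conn X m p"
  unfolding conn_def
proof (intro allI impI)
  fix C assume C: "C \<subseteq> X" "C \<noteq> {}" "m ` C \<subseteq> C" "p ` C \<subseteq> C"
  have k: "k \<in> X" "k \<noteq> h" "m k = h" using pairingD[OF assms(2,4)] assms(5) by auto
  have p: "p h \<in> X" "p k \<in> X" "p h \<noteq> h" "p k \<noteq> k" "p k \<noteq> h"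
    using pairingD[OF assms(3,4)] pairingD[OF assms(3) k(1)] pairing_eq_iff[OF assms(3) k(1,1)]
      assms(6) by auto
  have all: "k \<in> C \<longleftrightarrow> h \<in> C" "p h \<in> C \<longleftrightarrow> h \<in> C" "p k \<in> C \<longleftrightarrow> h \<in> C"
    using pairing_closed_iff[OF assms(2) C(3) assms(4)] pairing_closed_iff[OF assms(3) C(4) assms(4)]
      pairing_closed_iff[OF assms(3) C(4) k(1)] assms(5) by auto
  let ?p = "p(p h := p k, p k := p h)"
  have "C - {h, k} = X - {h, k}"
  proof (rule connD[OF assms(1)])
    show "C - {h, k} \<subseteq> X - {h, k}" using C by auto
    show "C - {h, k} \<noteq> {}" using C(2) all p assms(6) by blast
    have sub: "m x \<in> X - {h, k}" "?p x \<in> X - {h, k}" if "x \<in> C - {h, k}" for x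
      using pairing_remove_edge[OF assms(2-6)] that C(1) unfolding pairing_def by blast+
    show "m ` (C - {h, k}) \<subseteq> C - {h, k}" using sub C(3) by blast
    show "?p ` (C - {h, k}) \<subseteq> C - {h, k}"
    proof
      fix y assume "y \<in> ?p ` (C - {h, k})"
      then obtain x where x: "x \<in> C - {h, k}" "y = ?p x" by blast
      then have "y \<in> C" using C(4) all by (auto simp: image_subset_iff)
      then show "y \<in> C - {h, k}" using sub(2)[OF x(1)] x(2) by (metis DiffD2 DiffI)
    qed
  qed
  then show "C = X" using all p assms C(1) k by blast
qed

lemma circuit_cong:
  assumes "\<forall>x\<in>X. m x = m' x" "\<forall>x\<in>X. p x = p' x" "pairing X m" "circuit X m p hs"
  shows "circuit X m' p' hs"
proof -
  have X: "set hs \<subseteq> X" using assms(4) by (auto simp: circuit_def)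
  then have "map m hs = map m' hs" using assms(1) by auto
  moreover from this have "m ` set hs = m' ` set hs" by (metis list.set_map)
  moreover have "p (m (hs ! i)) = p' (m' (hs ! i))" if "i < length hs" for i
    using X that assms(1,2) pairingD[OF assms(3)] by (metis nth_mem subsetD)
  moreover have "hs ! i \<in> X" if "i < length hs" for i using X that by auto
  ultimately show ?thesis
    using assms(4) unfolding circuit_def by (simp del: map_eq_conv)
qed

section \<open>Suppressing half-edges\<close>

lemma circuit_next:
  assumes "circuit X m p hs"
  shows "map (\<lambda>x. p (m x)) hs = rotate1 hs"
proof (rule nth_equalityI)
  show "map (\<lambda>x. p (m x)) hs ! i = rotate1 hs ! i" if "i < length (map (\<lambda>x. p (m x)) hs)" for i
    using that assms by (simp add: circuit_def nth_rotate1)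
qed simp

text \<open>Edges and passages play symmetric roles: the half-edges of arrival form a circuit with
  \<open>m\<close> and \<open>p\<close> exchanged. The removal of a passage through a vertex is thus
  dual to the removal of an edge.\<close>

lemma circuit_dual:
  assumes "circuit X m p hs" "pairing X m" "pairing X p"
  shows "circuit X p m (map m hs)"
  unfolding circuit_def
proof (intro conjI allI impI)
  have n: "map p (map m hs) = rotate1 hs" using circuit_next[OF assms(1)] by (simp add: comp_def)
  have X: "set hs \<union> m ` set hs = X" and d: "distinct (hs @ map m hs)"
    using assms(1) by (auto simp: circuit_def)
  have "p ` set (map m hs) = set hs" using arg_cong[OF n, of set]
    by (simp only: set_map set_rotate1)
  then show "set (map m hs) \<union> p ` set (map m hs) = X" using X by auto
  show "distinct (map m hs @ map p (map m hs))" unfolding n using d by auto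
  fix i assume i: "i < length (map m hs)"
  have "m (hs ! i) \<in> X" using X i by auto
  moreover have "Suc i mod length hs < length hs" using i by (intro mod_less_divisor) auto
  moreover have "hs ! (Suc i mod length hs) = p (m (hs ! i))" using assms(1) i
    by (simp add: circuit_def)
  ultimately show "map m hs ! (Suc i mod length (map m hs)) = m (p (map m hs ! i))"
    using i by simp
qed

lemma filter_rotate1_append:
  "\<exists>as bs. filter P xs = as @ bs \<and> filter P (rotate1 xs) = bs @ as"
proof (cases xs)
  case (Cons x ys)
  then show ?thesis
    by (intro exI[of _ "filter P [x]"] exI[of _ "filter P ys"]) simp
qed simp

lemma circuit_remove_vertex:
  assumes t: "circuit X m p hs" and m: "pairing X m" and p: "pairing X p"
    and h: "h \<in> X" "k = p h" "m h \<noteq> k"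
  shows "circuit (X - {h, k}) (m(m h := m k, m k := m h)) p (filter (\<lambda>x. x \<noteq> h \<and> x \<noteq> k) hs)"
proof -
  let ?Q = "\<lambda>x. x \<noteq> h \<and> x \<noteq> k" and ?m = "m(m h := m k, m k := m h)"
  have 1: "circuit (X - {h, k}) p ?m (filter ?Q (map m hs))"
    using circuit_remove_edge[OF circuit_dual[OF t m p] p m h] .
  have 2: "circuit (X - {h, k}) ?m p (map p (filter ?Q (map m hs)))"
    using circuit_dual[OF 1 pairing_remove_edge[OF p m h]] .
  have k: "k \<in> X" "p k = h" using pairingD[OF p h(1)] h(2) by auto
  have X: "set (map m hs) \<subseteq> X" using t by (auto simp: circuit_def)
  have Q: "?Q (p x) \<longleftrightarrow> ?Q x" if "x \<in> X" for x
    using pairing_eq_iff[OF p that h(1)] pairing_eq_iff[OF p that k(1)] k h by auto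
  have "filter (?Q \<circ> p) xs = filter ?Q xs" if "set xs \<subseteq> X" for xs
    using that Q by (intro filter_cong) auto
  then have "map p (filter (?Q \<circ> p) (map m hs)) = map p (filter ?Q (map m hs))"
    using X by (simp only:)
  then have "map p (filter ?Q (map m hs)) = filter ?Q (map p (map m hs))"
    unfolding filter_map[of ?Q p] by (rule sym)
  \<comment> \<open>Dualising twice advances the starting point by one, so the filtered list is
    obtained up to a rotation.\<close>
  also have "map p (map m hs) = rotate1 hs" using circuit_next[OF t] by (simp add: comp_def)
  finally have 3: "circuit (X - {h, k}) ?m p (filter ?Q (rotate1 hs))" using 2 by (simp only:)
  obtain as bs where "filter ?Q hs = as @ bs" "filter ?Q (rotate1 hs) = bs @ as"
    using filter_rotate1_append[of ?Q hs] by blast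
  then show ?thesis using circuit_append_commute[of _ _ _ bs as] 3 by (simp only:)
qed

section \<open>Gluing through suppressed half-edges\<close>

definition glue :: "'a set \<Rightarrow> ('a \<Rightarrow> 'a) \<Rightarrow> ('a \<Rightarrow> 'a) \<Rightarrow> 'a set \<Rightarrow> ('a \<times> 'a) set" where
  "glue X m p H = ({(x, m x) |x. x \<in> X} \<union> {(x, p x) |x. x \<in> X - H})\<^sup>*"

lemma glue_m: "x \<in> X \<Longrightarrow> (x, m x) \<in> glue X m p H"
  unfolding glue_def by (rule r_into_rtrancl) blast

lemma glue_p: "x \<in> X \<Longrightarrow> x \<notin> H \<Longrightarrow> (x, p x) \<in> glue X m p H"
  unfolding glue_def by (rule r_into_rtrancl) blast

lemma glue_refl: "(x, x) \<in> glue X m p H"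
  unfolding glue_def by simp

lemma glue_trans: "(x, y) \<in> glue X m p H \<Longrightarrow> (y, z) \<in> glue X m p H \<Longrightarrow> (x, z) \<in> glue X m p H"
  unfolding glue_def by (rule rtrancl_trans)

lemma glue_induct [consumes 1, case_names refl m p]:
  assumes "(x, y) \<in> glue X m p H" "P x"
    and "\<And>y. (x, y) \<in> glue X m p H \<Longrightarrow> P y \<Longrightarrow> y \<in> X \<Longrightarrow> P (m y)"
    and "\<And>y. (x, y) \<in> glue X m p H \<Longrightarrow> P y \<Longrightarrow> y \<in> X \<Longrightarrow> y \<notin> H \<Longrightarrow> P (p y)"
  shows "P y"
  using assms(1) unfolding glue_def
  by (induction rule: rtrancl_induct) (use assms(2-4) in \<open>auto simp: glue_def\<close>)

lemma glue_closed:
  assumes "(x, y) \<in> glue X m p H" "x \<in> C" "m ` C \<subseteq> C" "p ` (C - H) \<subseteq> C"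
  shows "y \<in> C"
  using assms(1) by (induction rule: glue_induct) (use assms(2-4) in auto)

lemma glue_mono:
  assumes "(x, y) \<in> glue X' m' p' H'"
    and "\<And>z. z \<in> X' \<Longrightarrow> (z, m' z) \<in> glue X m p H"
    and "\<And>z. z \<in> X' \<Longrightarrow> z \<notin> H' \<Longrightarrow> (z, p' z) \<in> glue X m p H"
  shows "(x, y) \<in> glue X m p H"
  using assms(1) by (induction rule: glue_induct) (auto intro: glue_refl glue_trans assms(2,3))

text \<open>\<open>H\<close> consists of the surviving half-edges, and \<open>glue\<close> is
  \<open>glued\<close> with the smoothing replaced by a pairing acting off \<open>H\<close>. The
  induction suppresses one passage \<open>{h, p h}\<close> at a time and merges its two edges into
  one. The clause that a glue class meets \<open>H\<close> in no more than \<open>x\<close> and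
  \<open>m' x\<close> later evaluates the description by \<open>THE\<close> in
  \<open>smooth\<close>.\<close>

lemma glue_restrict:
  assumes "finite X" "pairing X m" "pairing X p" "H \<subseteq> X" "\<forall>x\<in>X. p x \<in> H \<longleftrightarrow> x \<in> H"
  shows "\<exists>m'. pairing H m' \<and> (\<forall>x\<in>H. (x, m' x) \<in> glue X m p H) \<and>
    (\<forall>x\<in>H. \<forall>y\<in>H. (x, y) \<in> glue X m p H \<longrightarrow> y = x \<or> y = m' x) \<and>
    (\<forall>hs. circuit X m p hs \<longrightarrow> circuit H m' p (filter (\<lambda>x. x \<in> H) hs))"
  using assms
proof (induction "card (X - H)" arbitrary: X m rule: less_induct)
  case less
  note X = less.prems
  show ?case
  proof (cases "X = H")
    case True
    have "y \<in> {x, m x}" if "(x, y) \<in> glue H m p H" "x \<in> H" for x y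
      using that(1) by (rule glue_closed) (use that(2) True pairingD[OF X(2)] in auto)
    moreover have "filter (\<lambda>x. x \<in> H) hs = hs" if "circuit H m p hs" for hs
      using that by (auto simp: circuit_def filter_id_conv)
    ultimately show ?thesis using True X(2) glue_m[of _ H m p H] by (intro exI[of _ m]) auto
  next
    case False
    then obtain h where h: "h \<in> X" "h \<notin> H" using X(4) by blast
    define k where "k = p h"
    note M = pairingD[OF X(2)] and P = pairingD[OF X(3)]
    have k: "k \<in> X" "k \<notin> H" "p k = h" "k \<noteq> h" using h X(5) P[OF h(1)] unfolding k_def by auto
    let ?X = "X - {h, k}"
    have "X - {h, k} - H \<subset> X - H" using h by blast
    then have card: "card (?X - H) < card (X - H)" using X(1) by (intro psubset_card_mono) auto
    have H: "H \<subseteq> ?X" using X(4) h(2) k(2) by auto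
    have fX: "finite ?X" using X(1) by simp
    show ?thesis
    proof (cases "m h = k")
      \<comment> \<open>The passage and its edge form a circle apart from the rest. A circuit
        through all of \<open>X\<close> then leaves no room for \<open>H\<close>.\<close>
      case True
      have "m k = h" "p h = k" by (use M(3)[OF h(1)] True in metis) (rule k_def[symmetric])
      then have "m ` {h, k} \<subseteq> {h, k}" "p ` {h, k} \<subseteq> {h, k}" using True k(3) by simp_all
      then have hk: "m x \<in> {h, k} \<longleftrightarrow> x \<in> {h, k}" "p x \<in> {h, k} \<longleftrightarrow> x \<in> {h, k}" if "x \<in> X" for x
        using pairing_closed_iff[OF X(2) _ that] pairing_closed_iff[OF X(3) _ that] by blast+
      then have pX: "pairing ?X m" "pairing ?X p" "\<forall>x\<in>?X. p x \<in> H \<longleftrightarrow> x \<in> H"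
        using X(2,3,5) unfolding pairing_def by blast+
      obtain m' where m': "pairing H m'" "\<forall>x\<in>H. (x, m' x) \<in> glue ?X m p H"
        "\<forall>x\<in>H. \<forall>y\<in>H. (x, y) \<in> glue ?X m p H \<longrightarrow> y = x \<or> y = m' x"
        using less.hyps[OF card fX pX(1,2) H pX(3)] by blast
      have "(x, y) \<in> glue X m p H" if "(x, y) \<in> glue ?X m p H" for x y
        using that by (rule glue_mono) (auto intro: glue_m glue_p)
      moreover have "y \<in> ?X \<and> (x, y) \<in> glue ?X m p H" if "(x, y) \<in> glue X m p H" "x \<in> ?X" for x y
        using that(1)
      proof (induction rule: glue_induct)
        case (m y)
        then have "m y \<in> ?X" using M(1)[of y] hk(1)[of y] by blast
        then show ?case using m glue_trans[OF _ glue_m[of y ?X m p H]] by blast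
      next
        case (p y)
        then have "p y \<in> ?X" using P(1)[of y] hk(2)[of y] by blast
        then show ?case using p glue_trans[OF _ glue_p[of y ?X H p m]] by blast
      qed (use that in \<open>auto intro: glue_refl\<close>)
      moreover have "circuit H m' p (filter (\<lambda>x. x \<in> H) hs)" if t: "circuit X m p hs" for hs
      proof -
        have "{h, k} = X"
          by (rule circuit_closed_eq[OF t X(2)]) (use hk h(1) k(1) in blast)+
        then have "H = {}" using H by blast
        then show ?thesis by (simp add: circuit_Nil)
      qed
      ultimately show ?thesis using m' H by (intro exI[of _ m']) blast
    next
      case False
      let ?m = "m(m h := m k, m k := m h)"
      have pX: "pairing ?X p" "pairing ?X ?m"
        using pairing_remove_edge[OF X(3,2) h(1) k_def False] by blast+
      have "\<forall>x\<in>?X. p x \<in> H \<longleftrightarrow> x \<in> H" using X(5) by blast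
      then obtain m' where m': "pairing H m'" "\<forall>x\<in>H. (x, m' x) \<in> glue ?X ?m p H"
        "\<forall>x\<in>H. \<forall>y\<in>H. (x, y) \<in> glue ?X ?m p H \<longrightarrow> y = x \<or> y = m' x"
        "\<forall>hs. circuit ?X ?m p hs \<longrightarrow> circuit H m' p (filter (\<lambda>x. x \<in> H) hs)"
        using less.hyps[OF card fX pX(2,1) H] by blast
      have mm: "m h \<in> ?X" "m k \<in> ?X" "m h \<noteq> m k"
        using M[OF h(1)] M[OF k(1)] False pairing_inj[OF X(2) h(1) k(1)] k(4)
          pairing_eq_iff[OF X(2) k(1) h(1)] by auto
      have path: "(m h, m k) \<in> glue X m p H" "(m k, m h) \<in> glue X m p H"
      proof -
        have "(m h, h) \<in> glue X m p H" "(m k, k) \<in> glue X m p H"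
          using glue_m[of "m h" X m p H] glue_m[of "m k" X m p H] M[OF h(1)] M[OF k(1)] by auto
        moreover have "(h, k) \<in> glue X m p H" "(k, h) \<in> glue X m p H"
          using glue_p[OF h, of p m] glue_p[OF k(1,2), of p m] k(3) by (auto simp: k_def)
        ultimately show "(m h, m k) \<in> glue X m p H" "(m k, m h) \<in> glue X m p H"
          using glue_m[OF h(1), of m p H] glue_m[OF k(1), of m p H] by (blast intro: glue_trans)+
      qed
      have 1: "(x, y) \<in> glue X m p H" if "(x, y) \<in> glue ?X ?m p H" for x y
        using that
      proof (rule glue_mono)
        show "(z, ?m z) \<in> glue X m p H" if "z \<in> ?X" for z
          using that path glue_m[of z X m p H] by auto
      qed (auto intro: glue_p)
      \<comment> \<open>A retraction onto the smaller set: the suppressed half-edges go to the far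
        ends of their edges. It carries glue paths of \<open>X\<close> to glue paths of the reduced
        set and fixes \<open>H\<close>.\<close>
      let ?r = "\<lambda>z. if z = h then m h else if z = k then m k else z"
      have mX: "m y \<noteq> h" "m y \<noteq> k" if "y \<in> X" "y \<noteq> m h" "y \<noteq> m k" for y
        using that pairing_eq_iff[OF X(2) that(1)] h k by auto
      have 2: "(?r x, ?r y) \<in> glue ?X ?m p H" if "(x, y) \<in> glue X m p H" for x y
        using that
      proof (induction rule: glue_induct)
        case (m y)
        have "(?r y, ?r (m y)) \<in> glue ?X ?m p H"
        proof (cases "y \<in> {h, k, m h, m k}")
          case True
          then show ?thesis using mm M[OF h(1)] M[OF k(1)] False k(4) by (auto intro: glue_refl)
        next
          case False
          then show ?thesis using glue_m[of y ?X ?m p H] mX[of y] m by auto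
        qed
        then show ?case using m glue_trans by fast
      next
        case (p y)
        have "(?r y, ?r (p y)) \<in> glue ?X ?m p H"
        proof (cases "y \<in> {h, k}")
          case True
          have "(m h, m k) \<in> glue ?X ?m p H" "(m k, m h) \<in> glue ?X ?m p H"
            using glue_m[OF mm(1), of ?m p H] glue_m[OF mm(2), of ?m p H] mm(3) by auto
          then show ?thesis using True k(3,4) by (auto simp: k_def[symmetric])
        next
          case False
          then have "y \<in> ?X" using p by auto
          then have "p y \<in> ?X" using pairingD(1)[OF pX(1)] by blast
          then show ?thesis using \<open>y \<in> ?X\<close> p glue_p[of y ?X H p ?m] by auto
        qed
        then show ?case using p glue_trans by fast
      qed (rule glue_refl)
      have 3: "(x, y) \<in> glue ?X ?m p H" if "(x, y) \<in> glue X m p H" "x \<in> H" "y \<in> H" for x y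
      proof -
        have "x \<noteq> h" "x \<noteq> k" "y \<noteq> h" "y \<noteq> k" using that(2,3) h(2) k(2) by auto
        then show ?thesis using 2[OF that(1)] by simp
      qed
      have 4: "circuit H m' p (filter (\<lambda>x. x \<in> H) hs)" if t: "circuit X m p hs" for hs
      proof -
        have "circuit ?X ?m p (filter (\<lambda>x. x \<noteq> h \<and> x \<noteq> k) hs)"
          using circuit_remove_vertex[OF t X(2,3) h(1) k_def False] .
        then have "circuit H m' p (filter (\<lambda>x. x \<in> H) (filter (\<lambda>x. x \<noteq> h \<and> x \<noteq> k) hs))"
          using m'(4) by blast
        moreover have "filter (\<lambda>x. x \<in> H) (filter (\<lambda>x. x \<noteq> h \<and> x \<noteq> k) hs) = filter (\<lambda>x. x \<in> H) hs"
          unfolding filter_filter by (rule filter_cong) (use h(2) k(2) in auto)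
        ultimately show ?thesis by (simp only:)
      qed
      show ?thesis using m' 1 3 4 by (intro exI[of _ m']) blast
    qed
  qed
qed

text \<open>A glue class offers at most one partner in \<open>H\<close>, so every pairing of
  \<open>H\<close> inside the glue classes agrees with the one constructed above.\<close>

lemma circuit_restrict:
  assumes "finite X" "pairing X m" "pairing X p" "H \<subseteq> X" "\<forall>x\<in>X. p x \<in> H \<longleftrightarrow> x \<in> H"
    and "pairing H m'" "\<forall>x\<in>H. (x, m' x) \<in> glue X m p H" "circuit X m p hs"
  shows "circuit H m' p (filter (\<lambda>x. x \<in> H) hs)"
proof -
  obtain m'' where m'': "pairing H m''"
    "\<forall>x\<in>H. \<forall>y\<in>H. (x, y) \<in> glue X m p H \<longrightarrow> y = x \<or> y = m'' x"
    "circuit H m'' p (filter (\<lambda>x. x \<in> H) hs)"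
    using glue_restrict[OF assms(1-5)] assms(8) by blast
  have "\<forall>x\<in>H. m'' x = m' x" using m''(2) assms(7) pairingD[OF assms(6)] by metis
  then show ?thesis using circuit_cong[of H m'' m' p p] m'' by blast
qed

section \<open>Graphs and their chord diagrams\<close>

lemma framed_graphD:
  assumes "framed_graph G"
  shows "finite (halfs G)" "pairing (halfs G) (mate G)" "pairing (halfs G) (opp G)"
    "h \<in> halfs G \<Longrightarrow> vert G (opp G h) = vert G h"
    "h \<in> halfs G \<Longrightarrow> card {k \<in> halfs G. vert G k = vert G h} = 4"
  using assms by (auto simp: framed_graph_def pairing_def)

lemma framed_graphI:
  assumes "finite (halfs G)" "pairing (halfs G) (mate G)" "pairing (halfs G) (opp G)"
    "\<And>h. h \<in> halfs G \<Longrightarrow> vert G (opp G h) = vert G h"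
    "\<And>h. h \<in> halfs G \<Longrightarrow> card {k \<in> halfs G. vert G k = vert G h} = 4"
  shows "framed_graph G"
  using assms by (auto simp: framed_graph_def pairing_def)

section \<open>Unicursality as connectedness of two pairings\<close>

lemma card_quotient_1:
  assumes "A \<noteq> {}" "refl r" "sym r" "trans r"
  shows "card (A // r) = 1 \<longleftrightarrow> (\<forall>x\<in>A. \<forall>y\<in>A. (x, y) \<in> r)"
proof
  assume "card (A // r) = 1"
  then obtain c where c: "A // r = {c}" by (auto simp: card_1_singleton_iff)
  show "\<forall>x\<in>A. \<forall>y\<in>A. (x, y) \<in> r"
  proof (intro ballI)
    fix x y assume "x \<in> A" "y \<in> A"
    then have "r `` {x} \<in> A // r" "r `` {y} \<in> A // r" by (simp_all add: quotientI)
    then have "r `` {x} = r `` {y}" using c by simp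
    moreover have "y \<in> r `` {y}" using reflD[OF assms(2)] by simp
    ultimately show "(x, y) \<in> r" by blast
  qed
next
  assume r: "\<forall>x\<in>A. \<forall>y\<in>A. (x, y) \<in> r"
  have eq: "r `` {x} = r `` {y}" if "x \<in> A" "y \<in> A" for x y
  proof (rule set_eqI)
    fix z show "z \<in> r `` {x} \<longleftrightarrow> z \<in> r `` {y}"
      using r that transD[OF assms(4), of x y z] transD[OF assms(4), of y x z] by auto
  qed
  obtain a where a: "a \<in> A" using assms(1) by auto
  have "A // r \<subseteq> {r `` {a}}" unfolding quotient_def using eq[OF _ a] by fast
  moreover have "r `` {a} \<in> A // r" using a by (rule quotientI)
  ultimately have "A // r = {r `` {a}}" by blast
  then show "card (A // r) = 1" by simp
qed

lemma sym_opposite_edges: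
  assumes "pairing (halfs G) (opp G)"
  shows "sym ((opposite_edges G)\<^sup>*)"
proof (rule sym_rtrancl, rule symI)
  fix d e assume "(d, e) \<in> opposite_edges G"
  then obtain h where "d \<in> edges G" "e \<in> edges G" "h \<in> halfs G" "h \<in> d" "opp G h \<in> e"
    by (auto simp: opposite_edges_def)
  then show "(e, d) \<in> opposite_edges G"
    unfolding opposite_edges_def using pairingD[OF assms] by fastforce
qed

lemma edges_closed:
  assumes "(d, e) \<in> (opposite_edges G)\<^sup>*" "d \<subseteq> C" "opp G ` C \<subseteq> C"
    and "\<And>h. h \<in> halfs G \<Longrightarrow> mate G h \<in> C \<longleftrightarrow> h \<in> C"
  shows "e \<subseteq> C"
  using assms(1)
proof (induction rule: rtrancl_induct)
  case (step d e)
  then obtain h k where "h \<in> d" "opp G h \<in> e" "k \<in> halfs G" "e = {k, mate G k}"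
    by (auto simp: opposite_edges_def edges_def)
  moreover from this have "opp G h \<in> C" using step(3) assms(3) by blast
  ultimately show ?case using assms(4)[of k] by auto
qed (use assms(2) in simp)

text \<open>Unions of edges are the sets closed under \<open>mate\<close>, and such a union consists
  of whole unicursal components iff it is also closed under \<open>opp\<close>. Without half-edges
  there is no class at all although \<open>conn\<close> holds, hence the assumption
  \<open>halfs G \<noteq> {}\<close>.\<close>

lemma edges_conn_iff:
  assumes "finite (halfs G)" "pairing (halfs G) (mate G)" "pairing (halfs G) (opp G)" "halfs G \<noteq> {}"
  shows "card (edges G // (opposite_edges G)\<^sup>*) = 1 \<longleftrightarrow> conn (halfs G) (mate G) (opp G)"
proof -
  let ?R = "(opposite_edges G)\<^sup>*"
  note M = pairingD[OF assms(2)] and P = pairingD[OF assms(3)]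
  have ne: "edges G \<noteq> {}" using assms(4) by (auto simp: edges_def)
  have "card (edges G // ?R) = 1 \<longleftrightarrow> (\<forall>d\<in>edges G. \<forall>e\<in>edges G. (d, e) \<in> ?R)"
    by (rule card_quotient_1[OF ne refl_rtrancl sym_opposite_edges[OF assms(3)] trans_rtrancl])
  also have "\<dots> \<longleftrightarrow> conn (halfs G) (mate G) (opp G)"
  proof
    assume e: "\<forall>d\<in>edges G. \<forall>e\<in>edges G. (d, e) \<in> ?R"
    show "conn (halfs G) (mate G) (opp G)" unfolding conn_def
    proof (intro allI impI)
      fix C assume C: "C \<subseteq> halfs G" "C \<noteq> {}" "mate G ` C \<subseteq> C" "opp G ` C \<subseteq> C"
      then obtain h where h: "h \<in> C" "h \<in> halfs G" by auto
      have "k \<in> C" if "k \<in> halfs G" for k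
      proof -
        have "({h, mate G h}, {k, mate G k}) \<in> ?R" using e h(2) that by (auto simp: edges_def)
        then have "{k, mate G k} \<subseteq> C"
          by (rule edges_closed) (use C h pairing_closed_iff[OF assms(2) C(3)] in auto)
        then show ?thesis by simp
      qed
      then show "C = halfs G" using C(1) by auto
    qed
  next
    assume c: "conn (halfs G) (mate G) (opp G)"
    show "\<forall>d\<in>edges G. \<forall>e\<in>edges G. (d, e) \<in> ?R"
    proof (intro ballI)
      fix d e assume d: "d \<in> edges G" and e: "e \<in> edges G"
      then obtain h where h: "h \<in> halfs G" "d = {h, mate G h}" by (auto simp: edges_def)
      let ?C = "{k \<in> halfs G. (d, {k, mate G k}) \<in> ?R}"
      have "?C = halfs G"
      proof (rule connD[OF c])
        show "?C \<noteq> {}" using h by auto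
        show "mate G ` ?C \<subseteq> ?C" using M by (auto simp: insert_commute)
        have "({k, mate G k}, {opp G k, mate G (opp G k)}) \<in> opposite_edges G" if "k \<in> halfs G"
          for k
          using that P by (auto simp: opposite_edges_def edges_def)
        then show "opp G ` ?C \<subseteq> ?C" using P by (auto intro: rtrancl_into_rtrancl)
      qed auto
      then show "(d, e) \<in> ?R" using e by (auto simp: edges_def)
    qed
  qed
  finally show ?thesis .
qed

text \<open>Half-edges contribute at least one class, so a total of one means either a single free
  loop and nothing else, or a connected graph without free loops.\<close>

lemma unicursal_graph_iff:
  "unicursal_graph G \<longleftrightarrow> framed_graph G \<and>
     (if halfs G = {} then free_loops G = 1
      else free_loops G = 0 \<and> conn (halfs G) (mate G) (opp G))"
proof (cases "framed_graph G")
  case True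
  note F = framed_graphD[OF True]
  have "card (edges G // (opposite_edges G)\<^sup>*) \<noteq> 0" if "halfs G \<noteq> {}"
  proof -
    have "finite (edges G // (opposite_edges G)\<^sup>*)"
      unfolding quotient_def edges_def using F(1) by (simp add: UNION_singleton_eq_range)
    moreover have "edges G // (opposite_edges G)\<^sup>* \<noteq> {}"
      using that by (auto simp: quotient_def edges_def)
    ultimately show ?thesis by simp
  qed
  then show ?thesis
    using True edges_conn_iff[OF F(1-3)]
    by (cases "halfs G = {}")
      (simp add: unicursal_graph_def num_unicursal_components_def edges_def,
        auto simp: unicursal_graph_def num_unicursal_components_def)
qed (simp add: unicursal_graph_def)

lemma unicursal_circuit:
  assumes "unicursal_graph G"
  shows "\<exists>hs. traversal G hs"
proof -
  have "framed_graph G" using assms by (simp add: unicursal_graph_def)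
  note F = framed_graphD[OF this]
  have "conn (halfs G) (mate G) (opp G)"
    using assms by (auto simp: unicursal_graph_iff conn_def split: if_splits)
  then show ?thesis unfolding traversal_circuit using conn_circuit F by blast
qed

lemma traversal_unicursal:
  assumes "framed_graph G" "traversal G hs" "free_loops G = (if halfs G = {} then 1 else 0)"
  shows "unicursal_graph G"
  using assms circuit_conn[of "halfs G" "mate G" "opp G" hs] framed_graphD(2)[OF assms(1)]
  by (auto simp: unicursal_graph_iff traversal_circuit)

section \<open>Chord diagrams determine graphs up to isomorphism\<close>

lemma chord_diagramI: "traversal G hs \<Longrightarrow> map (vert G) hs \<in> chord_diagram G"
  by (auto simp: chord_diagram_def)

text \<open>Match the circuits position by position and extend along the mates. The opposites are
  respected because both circuits are cyclic, the vertices because the words agree.\<close>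

lemma isomorphic_of_common_word:
  assumes G: "unicursal_graph G" "D \<in> chord_diagram G" and H: "unicursal_graph H"
    "D \<in> chord_diagram H"
  shows "isomorphic G H"
proof -
  obtain hs where hs: "traversal G hs" "D = map (vert G) hs" using G(2)
    by (auto simp: chord_diagram_def)
  obtain ks where ks: "traversal H ks" "D = map (vert H) ks" using H(2)
    by (auto simp: chord_diagram_def)
  have FG: "framed_graph G" and FH: "framed_graph H" using G H by (auto simp: unicursal_graph_def)
  note G' = framed_graphD[OF FG] and H' = framed_graphD[OF FH]
  let ?n = "length hs"
  have n: "length ks = ?n" using hs(2) ks(2) by (metis length_map)
  have v: "vert G (hs ! i) = vert H (ks ! i)" if "i < ?n" for i
    using hs(2) ks(2) that n by (metis nth_map)
  have hX: "halfs G = set hs \<union> mate G ` set hs" "distinct hs" "set hs \<inter> mate G ` set hs = {}"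
    and hN: "\<And>i. i < ?n \<Longrightarrow> hs ! (Suc i mod ?n) = opp G (mate G (hs ! i))"
    using hs(1) by (auto simp: traversal_def)
  have kX: "halfs H = set ks \<union> mate H ` set ks" "distinct ks" "set ks \<inter> mate H ` set ks = {}"
    and kN: "\<And>i. i < ?n \<Longrightarrow> ks ! (Suc i mod ?n) = opp H (mate H (ks ! i))"
    using ks(1) n by (auto simp: traversal_def)
  note MG = pairingD[OF G'(2)] and MH = pairingD[OF H'(2)] and OG = pairingD[OF G'(3)]
    and OH = pairingD[OF H'(3)]
  have hin: "hs ! i \<in> halfs G" "ks ! i \<in> halfs H" if "i < ?n" for i using that hX kX n by auto
  have idx: "\<exists>i<?n. x = hs ! i \<or> x = mate G (hs ! i)" if "x \<in> halfs G" for x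
    using that unfolding hX(1) by (metis Un_iff image_iff in_set_conv_nth)
  have idy: "\<exists>i<?n. y = ks ! i \<or> y = mate H (ks ! i)" if "y \<in> halfs H" for y
    using that unfolding kX(1) by (metis Un_iff image_iff in_set_conv_nth n)
  define ix where "ix x = (THE i. i < ?n \<and> hs ! i = x)" for x
  have ix: "ix (hs ! i) = i" if "i < ?n" for i
    unfolding ix_def using that hX(2) by (intro the_equality) (auto simp: nth_eq_iff_index_eq)
  define f where "f x = (if x \<in> set hs then ks ! ix x else mate H (ks ! ix (mate G x)))" for x
  have f1: "f (hs ! i) = ks ! i" if "i < ?n" for i using that ix by (simp add: f_def)
  have f2: "f (mate G (hs ! i)) = mate H (ks ! i)" if "i < ?n" for i
  proof -
    have "mate G (hs ! i) \<notin> set hs" using that hX(3) by (metis disjoint_iff image_eqI nth_mem)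
    then show ?thesis using that ix MG(3)[OF hin(1)[OF that]] by (simp add: f_def)
  qed
  have inH: "f x \<in> halfs H" if "x \<in> halfs G" for x
    using idx[OF that] f1 f2 hin MH(1) by auto
  have fm: "f (mate G x) = mate H (f x)" if x: "x \<in> halfs G" for x
    using idx[OF x] f1 f2 hin MG(3) MH(3) by auto
  have fp1: "f (opp G x) = opp H (f x)" if x: "x \<in> mate G ` set hs" for x
  proof -
    obtain i where i: "i < ?n" "x = mate G (hs ! i)" using x by (metis image_iff in_set_conv_nth)
    then have "Suc i mod ?n < ?n" by (intro mod_less_divisor) auto
    then show ?thesis using i hN[OF i(1)] kN[OF i(1)] f1 f2 by metis
  qed
  \<comment> \<open>Each departure is opposite to the mate of its predecessor; the predecessor of
    position \<open>0\<close> is the last position.\<close>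
  have pre: "\<exists>j<?n. hs ! i = opp G (mate G (hs ! j))" if "i < ?n" for i
  proof -
    let ?j = "if i = 0 then ?n - 1 else i - 1"
    have "?j < ?n" "Suc ?j mod ?n = i" using that by auto
    then show ?thesis using hN by metis
  qed
  have fp: "f (opp G x) = opp H (f x)" if x: "x \<in> halfs G" for x
  proof (cases "x \<in> mate G ` set hs")
    case False
    then obtain i where "i < ?n" "x = hs ! i" using x hX(1) by (metis Un_iff in_set_conv_nth)
    then obtain j where j: "j < ?n" "x = opp G (mate G (hs ! j))" using pre by blast
    let ?y = "mate G (hs ! j)"
    have y: "?y \<in> halfs G" "?y \<in> mate G ` set hs" using MG(1) hin j by auto
    then show ?thesis using fp1[OF y(2)] OG(3)[OF y(1)] OH(3)[OF inH[OF y(1)]] j(2) by simp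
  qed (rule fp1)
  have vm: "vert G (mate G (hs ! i)) = vert G (hs ! (Suc i mod ?n))"
    "vert H (mate H (ks ! i)) = vert H (ks ! (Suc i mod ?n))" if "i < ?n" for i
    using hN[OF that] kN[OF that] G'(4)[OF MG(1)[OF hin(1)[OF that]]]
      H'(4)[OF MH(1)[OF hin(2)[OF that]]] by simp_all
  have fv: "vert H (f x) = vert G x" if x: "x \<in> halfs G" for x
  proof -
    obtain i where i: "i < ?n" "x = hs ! i \<or> x = mate G (hs ! i)" using idx[OF x] by blast
    then have "Suc i mod ?n < ?n" by (intro mod_less_divisor) auto
    then show ?thesis using i v vm f1 f2 by metis
  qed
  have "f ` halfs G = halfs H"
  proof
    show "halfs H \<subseteq> f ` halfs G"
    proof
      fix y assume "y \<in> halfs H"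
      then obtain i where "i < ?n" "y = ks ! i \<or> y = mate H (ks ! i)" using idy by blast
      then have "y = f (hs ! i) \<or> y = f (mate G (hs ! i))" "i < ?n" using f1 f2 by auto
      then show "y \<in> f ` halfs G" using hin MG(1) by blast
    qed
  qed (use inH in auto)
  moreover have "card (halfs G) = card (halfs H)"
    using circuit_card[OF hs(1)[unfolded traversal_circuit]] circuit_card[OF ks(1)[unfolded traversal_circuit]] n by simp
  ultimately have bij: "bij_betw f (halfs G) (halfs H)"
    using G'(1) by (simp add: bij_betw_def eq_card_imp_inj_on)
  have "halfs G = {} \<longleftrightarrow> halfs H = {}" using hX(1) kX(1) n by auto
  then have "free_loops G = free_loops H"
    using G(1) H(1) by (auto simp: unicursal_graph_iff split: if_splits)
  then show ?thesis unfolding isomorphic_def using bij fm fp fv by metis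
qed

section \<open>Classes of words modulo second moves\<close>

lemma move2_class_eq_iff:
  "unicursal_graph G \<Longrightarrow> unicursal_graph H \<Longrightarrow>
    move2_class_of G = move2_class_of H \<longleftrightarrow> move2_equiv G H"
  using Quotient3_rel[OF Quotient3_move2_class, of G H] by (auto simp: move2_equiv_def)

lemma move2_class_step:
  assumes "unicursal_graph G" "unicursal_graph H" "isomorphic G H \<or> related_by move2 G H"
  shows "move2_class_of G = move2_class_of H"
  using assms by (auto simp: move2_class_eq_iff move2_equiv_def move2_step_def intro: r_into_equivclp)

text \<open>Unspecified unless \<open>w\<close> is a chord diagram.\<close>

definition word_class :: "nat list \<Rightarrow> move2_class" where
  "word_class w = (SOME c. \<exists>G. unicursal_graph G \<and> w \<in> chord_diagram G \<and> c = move2_class_of G)"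

lemma word_class_eq:
  assumes "unicursal_graph G" "w \<in> chord_diagram G"
  shows "word_class w = move2_class_of G"
  unfolding word_class_def
proof (rule some_equality)
  show "\<exists>G'. unicursal_graph G' \<and> w \<in> chord_diagram G' \<and> move2_class_of G = move2_class_of G'"
    using assms by blast
  show "c = move2_class_of G" if
    "\<exists>G. unicursal_graph G \<and> w \<in> chord_diagram G \<and> c = move2_class_of G" for c
    using that isomorphic_of_common_word assms move2_class_step by metis
qed

text \<open>It suffices that the predicates under \<open>SOME\<close> coincide. Words that are no
  chord diagrams share the same unspecified class, so rotation and reversal can be stated for
  arbitrary words.\<close>

lemma word_class_cong:
  assumes "\<And>G. unicursal_graph G \<Longrightarrow> w \<in> chord_diagram G \<Longrightarrow>
      \<exists>H. unicursal_graph H \<and> w' \<in> chord_diagram H \<and> move2_class_of H = move2_class_of G"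
    and "\<And>G. unicursal_graph G \<Longrightarrow> w' \<in> chord_diagram G \<Longrightarrow>
      \<exists>H. unicursal_graph H \<and> w \<in> chord_diagram H \<and> move2_class_of H = move2_class_of G"
  shows "word_class w = word_class w'"
  unfolding word_class_def by (rule arg_cong[of _ _ Eps]) (use assms in \<open>metis (full_types)\<close>)

lemma chord_diagram_append_commute: "as @ bs \<in> chord_diagram G \<Longrightarrow> bs @ as \<in> chord_diagram G"
  unfolding chord_diagram_def traversal_circuit mem_Collect_eq
  by (metis (no_types, lifting) map_append map_eq_append_conv circuit_append_commute)

text \<open>Arrival through \<open>m x\<close> and departure by the next entry happen at the same
  vertex, so reading the labels at the arrivals shifts the word by one.\<close>

lemma circuit_map_mate:
  assumes "circuit X m p hs" "pairing X m" "\<forall>x\<in>X. label (p x) = label x"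
  shows "map label (map m hs) = rotate1 (map label hs)"
proof -
  have "map label (map (\<lambda>x. p (m x)) hs) = map label (map m hs)"
    using assms pairingD(1)[OF assms(2)] by (auto simp: circuit_def)
  then show ?thesis using circuit_next[OF assms(1)] by (simp add: rotate1_map)
qed

lemma chord_diagram_rev:
  assumes "framed_graph G" "w \<in> chord_diagram G"
  shows "rev w \<in> chord_diagram G"
proof -
  note F = framed_graphD[OF assms(1)]
  obtain hs where hs: "circuit (halfs G) (mate G) (opp G) hs" "w = map (vert G) hs"
    using assms(2) by (auto simp: chord_diagram_def traversal_circuit)
  have "map (vert G) (map (mate G) hs) = rotate1 w"
    using circuit_map_mate[OF hs(1) F(2)] F(4) hs(2) by blast
  then have "rev (rotate1 w) = map (vert G) (rev (map (mate G) hs))" by (metis rev_map)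
  \<comment> \<open>The reversed circuit spells the reversal of the shifted word; a rotation undoes
    the shift.\<close>
  then have "rev (rotate1 w) \<in> chord_diagram G"
    unfolding chord_diagram_def traversal_circuit using circuit_rev[OF hs(1) F(2,3)] by blast
  then show ?thesis
    by (cases w) (use chord_diagram_append_commute in force)+
qed

lemma word_class_append_commute: "word_class (as @ bs) = word_class (bs @ as)"
  by (rule word_class_cong) (use chord_diagram_append_commute in blast)+

lemma word_class_rev: "word_class (rev w) = word_class w"
  by (rule word_class_cong) (metis chord_diagram_rev rev_rev_ident unicursal_graph_def)+

lemma verts_word: "w \<in> chord_diagram G \<Longrightarrow> framed_graph G \<Longrightarrow> set w = verts G"
proof -
  assume w: "w \<in> chord_diagram G" and G: "framed_graph G"
  note F = framed_graphD[OF G]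
  obtain hs where hs: "circuit (halfs G) (mate G) (opp G) hs" "w = map (vert G) hs"
    using w by (auto simp: chord_diagram_def traversal_circuit)
  have "map (vert G) (map (mate G) hs) = rotate1 (map (vert G) hs)"
    using circuit_map_mate[OF hs(1) F(2)] F(4) by blast
  then have "vert G ` mate G ` set hs = vert G ` set hs"
    by (metis (no_types, lifting) list.set_map set_rotate1)
  moreover have "halfs G = set hs \<union> mate G ` set hs" using hs(1) by (auto simp: circuit_def)
  ultimately show "set w = verts G" using hs(2) by (simp add: verts_def image_Un)
qed

text \<open>Renaming the vertices leaves half-edges and pairings alone, so the identity on
  half-edges is an isomorphism.\<close>

lemma relabel_vertices:
  assumes "unicursal_graph G" "w \<in> chord_diagram G" "inj_on g (set w)"
  shows "\<exists>H. unicursal_graph H \<and> map g w \<in> chord_diagram H \<and> move2_class_of H = move2_class_of G"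
proof -
  let ?H = "G\<lparr>vert := \<lambda>h. g (vert G h)\<rparr>"
  have FG: "framed_graph G" using assms by (simp add: unicursal_graph_def)
  note F = framed_graphD[OF FG]
  have inj: "g (vert G h) = g (vert G k) \<longleftrightarrow> vert G h = vert G k"
    if "h \<in> halfs G" "k \<in> halfs G" for h k
    using assms(3) that unfolding verts_word[OF assms(2) FG] verts_def by (auto dest: inj_onD)
  have "{k \<in> halfs G. g (vert G k) = g (vert G h)} = {k \<in> halfs G. vert G k = vert G h}"
    if "h \<in> halfs G" for h using inj that by auto
  then have FH: "framed_graph ?H"
    using F by (intro framed_graphI) auto
  then have H: "unicursal_graph ?H" using assms(1) by (simp add: unicursal_graph_iff)
  have "isomorphic G ?H" unfolding isomorphic_def
    using inj by (intro conjI exI[of _ id]) (auto simp: bij_betw_def)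
  moreover have "map g w \<in> chord_diagram ?H"
  proof -
    obtain hs where hs: "traversal G hs" "w = map (vert G) hs"
      using assms(2) by (auto simp: chord_diagram_def)
    then have "traversal ?H hs" "map g w = map (vert ?H) hs" by (simp_all add: traversal_def)
    then show ?thesis unfolding chord_diagram_def by blast
  qed
  ultimately show ?thesis using H assms(1) move2_class_step by metis
qed

lemma word_class_map:
  assumes "inj_on g (set w)"
  shows "word_class (map g w) = word_class w"
proof (rule word_class_cong)
  fix G assume G: "unicursal_graph G" "map g w \<in> chord_diagram G"
  have "map (inv_into (set w) g) (map g w) = w"
    using assms by (simp add: map_idI)
  moreover have "inj_on (inv_into (set w) g) (set (map g w))"
    by (simp add: inj_on_inv_into)
  ultimately show
    "\<exists>H. unicursal_graph H \<and> w \<in> chord_diagram H \<and> move2_class_of H = move2_class_of G"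
    using relabel_vertices[OF G] by metis
qed (rule relabel_vertices[OF _ _ assms])

section \<open>State sums\<close>

text \<open>Half-edges labelled \<open>None\<close> are skipped; this is how resolved vertices
  vanish from the chord diagram.\<close>

abbreviation word :: "('a \<Rightarrow> 'b option) \<Rightarrow> 'a list \<Rightarrow> 'b list" where
  "word \<equiv> List.map_filter"

lemma map_filter_append: "word f (xs @ ys) = word f xs @ word f ys"
  by (simp add: map_filter_def)

lemma map_filter_rev: "word f (rev xs) = rev (word f xs)"
  by (simp add: map_filter_def rev_filter rev_map)

lemma map_filter_map: "word f (map g xs) = word (f \<circ> g) xs"
  by (simp add: map_filter_def filter_map comp_def)

lemma map_filter_filter:
  "(\<And>x. x \<in> set xs \<Longrightarrow> \<not> P x \<Longrightarrow> f x = None) \<Longrightarrow>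
    word f (filter P xs) = word f xs"
  by (induction xs) (auto split: option.split)

lemma map_filter_map_option:
  "word (\<lambda>x. map_option g (f x)) xs = map g (word f xs)"
  by (induction xs) (auto split: option.split)

lemma map_filter_cong:
  "(\<And>x. x \<in> set xs \<Longrightarrow> f x = g x) \<Longrightarrow> word f xs = word g xs"
  by (induction xs) (auto split: option.split)

lemma word_class_map_filter_commute:
  "word_class (word f (as @ bs)) = word_class (word f (bs @ as))"
  unfolding map_filter_append by (rule word_class_append_commute)

text \<open>If the labels are constant on passages, the chosen circuit does not matter: any two
  differ by rotation and reversal, which \<open>word_class\<close> does not see. The value
  \<open>0\<close> of a disconnected state mirrors the restriction of the bracket to one unicursal
  component.\<close>

definition state_value ::
  "nat set \<Rightarrow> (nat \<Rightarrow> nat) \<Rightarrow> (nat \<Rightarrow> nat) \<Rightarrow> (nat \<Rightarrow> nat option) \<Rightarrow> move2_class \<Rightarrow>\<^sub>0 bit"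
  where "state_value X m p label =
    (if conn X m p
     then Poly_Mapping.single (word_class (word label (SOME hs. circuit X m p hs))) 1 else 0)"

definition paired :: "nat set \<Rightarrow> (nat \<Rightarrow> nat) \<Rightarrow> (nat \<Rightarrow> nat) \<Rightarrow> (nat \<Rightarrow> nat option) \<Rightarrow> bool" where
  "paired X m p label \<longleftrightarrow> finite X \<and> pairing X m \<and> pairing X p \<and> (\<forall>x\<in>X. label (p x) = label x)"

lemma state_value_not_conn: "\<not> conn X m p \<Longrightarrow> state_value X m p label = 0"
  by (simp add: state_value_def)

lemma state_value_circuit:
  assumes "paired X m p label" "circuit X m p hs"
  shows "state_value X m p label = Poly_Mapping.single (word_class (word label hs)) 1"
proof -
  have P: "pairing X m" "pairing X p" "\<forall>x\<in>X. label (p x) = label x"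
    using assms(1) by (auto simp: paired_def)
  define ks where "ks = (SOME hs. circuit X m p hs)"
  have ks: "circuit X m p ks" unfolding ks_def using assms(2) by (rule someI)
  have "word_class (word label ks) = word_class (word label hs)"
    using circuit_unique[OF assms(2) ks P(1,2)]
  proof (elim disjE exE conjE)
    fix as bs assume "hs = as @ bs" "ks = bs @ as"
    then show ?thesis using word_class_map_filter_commute by simp
  next
    fix as bs assume r: "rev (map m hs) = as @ bs" "ks = bs @ as"
    have "word_class (word label ks) = word_class (word label (map m hs))"
      using word_class_map_filter_commute[of label bs as] word_class_rev
        unfolding r(2) r(1)[symmetric] map_filter_rev by simp
    also have "word label (map m hs) = word id (map label (map m hs))"
      by (simp add: map_filter_map comp_def)
    also have "\<dots> = word id (rotate1 (map label hs))"
      by (simp only: circuit_map_mate[OF assms(2) P(1,3)])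
    also have "\<dots> = word label (rotate1 hs)"
      by (simp only: rotate1_map map_filter_map id_comp)
    also have "word_class \<dots> = word_class (word label hs)"
    proof (cases hs)
      case (Cons h ys)
      then show ?thesis using word_class_map_filter_commute[of label ys "[h]"] by simp
    qed simp
    finally show ?thesis .
  qed
  moreover have "conn X m p" using circuit_conn[OF assms(2) P(1)] .
  ultimately show ?thesis by (simp add: state_value_def ks_def)
qed

text \<open>Circuits are transported from left to right, connectedness from right to left. Together
  this covers both cases, as a connected state on the left has a circuit.\<close>

lemma state_value_eqI:
  assumes "paired X m p label" "paired X' m' p' label'"
    and "\<And>hs. circuit X m p hs \<Longrightarrow>
      \<exists>hs'. circuit X' m' p' hs' \<and> word_class (word label hs) = word_class (word label' hs')"
    and "conn X' m' p' \<Longrightarrow> conn X m p"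
  shows "state_value X m p label = state_value X' m' p' label'"
proof (cases "conn X m p")
  case True
  then obtain hs where hs: "circuit X m p hs"
    using conn_circuit[of X m p] assms(1) unfolding paired_def by blast
  then obtain hs' where "circuit X' m' p' hs'"
    "word_class (word label hs) = word_class (word label' hs')"
    using assms(3) by blast
  then show ?thesis using state_value_circuit[OF assms(1) hs] state_value_circuit[OF assms(2)]
    by simp
next
  case False
  moreover from this have "\<not> conn X' m' p'" using assms(4) by blast
  ultimately show ?thesis by (simp add: state_value_not_conn)
qed

section \<open>State sums over the choices of smoothings\<close>

definition states :: "nat set \<Rightarrow> (nat \<Rightarrow> nat) \<Rightarrow> (nat \<Rightarrow> nat) \<Rightarrow> nat set \<Rightarrow> (nat \<Rightarrow> nat) set" where
  "states X p v S =
     {j. \<forall>h. if h \<in> X \<and> v h \<in> S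
             then j h \<in> X \<and> v (j h) = v h \<and> j h \<noteq> h \<and> j h \<noteq> p h \<and> j (j h) = h
             else j h = h}"

definition resolve ::
  "nat set \<Rightarrow> (nat \<Rightarrow> nat) \<Rightarrow> (nat \<Rightarrow> nat) \<Rightarrow> nat set \<Rightarrow> (nat \<Rightarrow> nat) \<Rightarrow> nat \<Rightarrow> nat" where
  "resolve X p v S j = (\<lambda>h. if h \<in> X \<and> v h \<in> S then j h else p h)"

definition label :: "(nat \<Rightarrow> nat) \<Rightarrow> nat set \<Rightarrow> nat \<Rightarrow> nat option" where
  "label v Q = (\<lambda>h. if v h \<in> Q then None else Some (v h))"

text \<open>
  The vertices in \<open>R\<close> have already been resolved: \<open>p\<close> pairs their half-edges in some way, and they
  no longer occur in the words. The vertices in \<open>S\<close> are to be smoothed.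
\<close>

definition state_sum :: "nat set \<Rightarrow> (nat \<Rightarrow> nat) \<Rightarrow> (nat \<Rightarrow> nat) \<Rightarrow> (nat \<Rightarrow> nat) \<Rightarrow> nat set \<Rightarrow> nat set \<Rightarrow>
    move2_class \<Rightarrow>\<^sub>0 bit" where
  "state_sum X m p v R S =
      (\<Sum>j\<in>states X p v S. state_value X m (resolve X p v S j) (label v (R \<union> S)))"

text \<open>At resolved vertices \<open>p\<close> only has to respect membership in
  \<open>R\<close>: contraction joins half-edges of different resolved vertices and may leave fewer
  than four of them at a vertex. Unresolved vertices stay framed.\<close>

definition wf_state :: "nat set \<Rightarrow> (nat \<Rightarrow> nat) \<Rightarrow> (nat \<Rightarrow> nat) \<Rightarrow> (nat \<Rightarrow> nat) \<Rightarrow> nat set \<Rightarrow> bool" where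
  "wf_state X m p v R \<longleftrightarrow> finite X \<and> pairing X m \<and> pairing X p \<and>
     (\<forall>x\<in>X. v (p x) \<in> R \<longleftrightarrow> v x \<in> R) \<and>
     (\<forall>x\<in>X. v x \<notin> R \<longrightarrow> v (p x) = v x \<and> card {y \<in> X. v y = v x} = 4)"

lemma wf_stateD:
  assumes "wf_state X m p v R"
  shows "finite X" "pairing X m" "pairing X p"
    "x \<in> X \<Longrightarrow> v (p x) \<in> R \<longleftrightarrow> v x \<in> R" "x \<in> X \<Longrightarrow> v x \<notin> R \<Longrightarrow> v (p x) = v x"
    "x \<in> X \<Longrightarrow> v x \<notin> R \<Longrightarrow> card {y \<in> X. v y = v x} = 4"
  using assms by (auto simp: wf_state_def)

lemma framed_wf_state:
  "framed_graph G \<Longrightarrow> wf_state (halfs G) (mate G) (opp G) (vert G) {}"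
  using framed_graphD[of G] by (auto simp: wf_state_def)

text \<open>For \<open>states\<close> the half-edges, the pairing and the vertex names are separate
  parameters, so that contraction and sliding can change them independently.\<close>

lemma smoothings_eq_states: "smoothings G S = states (halfs G) (opp G) (vert G) S"
  by (simp only: smoothings_def states_def)

lemma finite_states: "finite X \<Longrightarrow> finite (states X p v S)"
  using finite_smoothings[of "\<lparr>halfs = X, vert = v, mate = id, opp = p, free_loops = 0\<rparr>" S]
  unfolding smoothings_eq_states by simp

lemma statesD:
  assumes "j \<in> states X p v S" "h \<in> X" "v h \<in> S"
  shows "j h \<in> X" "v (j h) = v h" "j h \<noteq> h" "j h \<noteq> p h" "j (j h) = h"
proof -
  have "j h \<in> X \<and> v (j h) = v h \<and> j h \<noteq> h \<and> j h \<noteq> p h \<and> j (j h) = h"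
    using assms(1)[unfolded states_def mem_Collect_eq, THEN spec[of _ h]] assms(2,3)
      by (simp only: if_True simp_thms)
  then show "j h \<in> X" "v (j h) = v h" "j h \<noteq> h" "j h \<noteq> p h" "j (j h) = h" by blast+
qed

lemma pairing_resolve:
  assumes "wf_state X m p v R" "R \<inter> S = {}" "j \<in> states X p v S"
  shows "pairing X (resolve X p v S j)"
    "x \<in> X \<Longrightarrow> v (resolve X p v S j x) \<in> R \<longleftrightarrow> v x \<in> R"
    "x \<in> X \<Longrightarrow> v x \<notin> R \<Longrightarrow> v (resolve X p v S j x) = v x"
proof -
  note W = wf_stateD[OF assms(1)] and J = statesD[OF assms(3)]
  have S: "v (p x) \<in> S \<longleftrightarrow> v x \<in> S" if "x \<in> X" for x
    using W(4,5)[OF that] assms(2) by (metis disjoint_iff)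
  show "pairing X (resolve X p v S j)"
    unfolding pairing_def resolve_def using J S pairingD[OF W(3)] by auto
  show "x \<in> X \<Longrightarrow> v (resolve X p v S j x) \<in> R \<longleftrightarrow> v x \<in> R"
    "x \<in> X \<Longrightarrow> v x \<notin> R \<Longrightarrow> v (resolve X p v S j x) = v x"
    using J W(4,5) by (auto simp: resolve_def)
qed

lemma paired_resolve:
  assumes "wf_state X m p v R" "R \<inter> S = {}" "j \<in> states X p v S"
  shows "paired X m (resolve X p v S j) (label v (R \<union> S))"
  unfolding paired_def label_def
  using wf_stateD[OF assms(1)] pairing_resolve[OF assms] by (metis UnI1)

text \<open>Suppressing the half-edges at resolved vertices turns a state with one circuit into a
  graph whose chord diagram is the word of the state; if nothing survives, the circuit becomes a
  free loop. The relation of \<open>m'\<close> to \<open>glue\<close> is recorded in order to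
  compare whole state sums later.\<close>

lemma realize_glued:
  assumes "wf_state X m p v Q" "circuit X m p hs"
  defines "H \<equiv> {x \<in> X. v x \<notin> Q}"
  shows "\<exists>m'. pairing H m' \<and> (\<forall>x\<in>H. (x, m' x) \<in> glue X m p H) \<and>
    (let G = \<lparr>halfs = H, vert = v, mate = m', opp = p, free_loops = if H = {} then 1 else 0\<rparr>
     in unicursal_graph G \<and> word (label v Q) hs \<in> chord_diagram G)"
proof -
  note W = wf_stateD[OF assms(1)]
  have pH: "\<forall>x\<in>X. p x \<in> H \<longleftrightarrow> x \<in> H" using W(4) pairingD[OF W(3)] by (auto simp: H_def)
  have HX: "H \<subseteq> X" by (auto simp: H_def)
  obtain m' where m': "pairing H m'" "\<forall>x\<in>H. (x, m' x) \<in> glue X m p H"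
      "circuit H m' p (filter (\<lambda>x. x \<in> H) hs)"
    using glue_restrict[OF W(1,2,3) HX pH] assms(2) by blast
  let ?G = "\<lparr>halfs = H, vert = v, mate = m', opp = p, free_loops = if H = {} then 1 else 0\<rparr>"
  have "framed_graph ?G"
  proof (rule framed_graphI)
    show "pairing (halfs ?G) (opp ?G)" using W(3,4) by (auto simp: pairing_def H_def)
    show "card {k \<in> halfs ?G. vert ?G k = vert ?G h} = 4" if "h \<in> halfs ?G" for h
    proof -
      have "{k \<in> halfs ?G. vert ?G k = vert ?G h} = {k \<in> X. v k = v h}"
        using that by (auto simp: H_def)
      then show ?thesis using W(6) that by (auto simp: H_def)
    qed
  qed (use W m' finite_subset[OF HX] in \<open>auto simp: H_def\<close>)
  moreover have t: "traversal ?G (filter (\<lambda>x. x \<in> H) hs)" using m'(3)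
    by (simp add: traversal_circuit)
  ultimately have "unicursal_graph ?G" by (rule traversal_unicursal) simp
  moreover have "word (label v Q) hs = map v (filter (\<lambda>x. x \<in> H) hs)"
  proof -
    have "set hs \<subseteq> X" using assms(2) by (auto simp: circuit_def)
    then show ?thesis by (induction hs) (auto simp: label_def H_def)
  qed
  then have "word (label v Q) hs \<in> chord_diagram ?G" using chord_diagramI[OF t] by simp
  ultimately show ?thesis using m'(1,2) unfolding Let_def by blast
qed

lemma realize:
  assumes "wf_state X m p v Q" "circuit X m p hs"
  shows "\<exists>G. unicursal_graph G \<and> word (label v Q) hs \<in> chord_diagram G"
  using realize_glued[OF assms] unfolding Let_def by blast

text \<open>The dictionary between \<open>smooth\<close> and states. Glue classes without surviving
  half-edges are the new free loops; a single circuit means that there is no such class, or that it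
  is the only class and nothing survives.\<close>

lemma smoothing_state:
  assumes F: "framed_graph G" and X: "halfs G \<noteq> {}" "free_loops G = 0" and j: "j \<in> smoothings G S"
  defines "p \<equiv> resolve (halfs G) (opp G) (vert G) S j"
  shows "num_unicursal_components (smooth G S j) = 1 \<longleftrightarrow> conn (halfs G) (mate G) p"
    and "circuit (halfs G) (mate G) p hs \<Longrightarrow>
      unicursal_graph (smooth G S j) \<and> word (label (vert G) S) hs \<in> chord_diagram (smooth G S j)"
proof -
  let ?X = "halfs G" and ?m = "mate G" and ?v = "vert G" and ?G = "smooth G S j"
  define H where "H = {x \<in> ?X. ?v x \<notin> S}"
  let ?r = "glue ?X ?m p H"
  have js: "j \<in> states ?X (opp G) ?v S" using j by (simp only: smoothings_eq_states)
  note wf = framed_wf_state[OF F]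
  note W = wf_stateD[OF wf]
  have disj: "{} \<inter> S = {}" by simp
  note PR = pairing_resolve[OF wf disj js, folded p_def]
  have pH: "\<forall>x\<in>?X. p x \<in> H \<longleftrightarrow> x \<in> H"
    using PR pairingD[OF PR(1)] by (auto simp: H_def)
  have HX: "H \<subseteq> ?X" by (auto simp: H_def)
  have g: "glued G S j = ?r"
  proof -
    have "{(h, j h) |h. h \<in> ?X \<and> ?v h \<in> S} = {(x, p x) |x. x \<in> ?X - H}"
      unfolding p_def resolve_def H_def by force
    then show ?thesis by (simp add: glued_def glue_def)
  qed
  obtain m' where m': "pairing H m'" "\<forall>x\<in>H. (x, m' x) \<in> ?r"
      "\<forall>x\<in>H. \<forall>y\<in>H. (x, y) \<in> ?r \<longrightarrow> y = x \<or> y = m' x"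
      "\<forall>hs. circuit ?X ?m p hs \<longrightarrow> circuit H m' p (filter (\<lambda>x. x \<in> H) hs)"
    using glue_restrict[OF W(1,2) PR(1) HX pH] by blast
  have hG: "halfs ?G = H" "vert ?G = ?v" "opp ?G = opp G"
    by (simp_all add: smooth_def Let_def H_def)
  have mG: "mate ?G x = m' x" if "x \<in> H" for x
  proof -
    \<comment> \<open>The glue class of \<open>x\<close> meets the survivors exactly in
      \<open>x\<close> and \<open>m' x\<close>, so the description has a unique solution.\<close>
    have "(THE k. k \<in> H \<and> k \<noteq> x \<and> (x, k) \<in> ?r) = m' x"
      using that m'(2,3) pairingD[OF m'(1)] by (intro the_equality) auto
    then show ?thesis by (simp add: smooth_def Let_def H_def[symmetric] g)
  qed
  have fG: "free_loops ?G = card {C \<in> ?X // ?r. C \<inter> H = {}}"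
    using X by (simp add: smooth_def Let_def H_def[symmetric] g)
  have pop: "p x = opp G x" if "x \<in> H" for x using that by (simp add: p_def resolve_def H_def)
  have framed: "framed_graph ?G"
  proof (rule framed_graphI; (unfold hG)?)
    show "finite H" using W(1) HX by (rule finite_subset[rotated])
    show "pairing H (mate ?G)" using m'(1) mG by (auto simp: pairing_def)
    show "pairing H (opp G)"
      using pH pop pairingD[OF PR(1)] HX unfolding pairing_def by (metis subsetD)
    show "?v (opp G h) = ?v h" if "h \<in> H" for h using that framed_graphD(4)[OF F] HX by auto
    show "card {k \<in> H. ?v k = ?v h} = 4" if "h \<in> H" for h
    proof -
      have "{k \<in> H. ?v k = ?v h} = {k \<in> ?X. ?v k = ?v h}" using that by (auto simp: H_def)
      then show ?thesis using framed_graphD(5)[OF F, of h] that by (auto simp: H_def)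
    qed
  qed
  have rX: "?r `` {x} \<subseteq> ?X" if "x \<in> ?X" for x
    using that pairingD[OF W(2)] pairingD[OF PR(1)] by (auto elim!: glue_closed)
  have cl: "?m ` (?r `` {x}) \<subseteq> ?r `` {x}" "p ` (?r `` {x} - H) \<subseteq> ?r `` {x}" if "x \<in> ?X" for x
    using rX[OF that] by (auto intro: glue_trans glue_m glue_p)
  have fin: "finite {C \<in> ?X // ?r. C \<inter> H = {}}"
    unfolding quotient_def using W(1) by (simp add: UNION_singleton_eq_range)
  have unic: "unicursal_graph ?G \<and> word (label ?v S) hs \<in> chord_diagram ?G"
    if t: "circuit ?X ?m p hs" for hs
  proof -
    have c: "conn ?X ?m p" using circuit_conn[OF t W(2)] .
    \<comment> \<open>A glue class without survivors is closed under both pairings, so by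
      connectedness it is everything.\<close>
    have whole: "?r `` {x} = ?X" if "x \<in> ?X" "?r `` {x} \<inter> H = {}" for x
      using connD[OF c rX[OF that(1)]] cl[OF that(1)] that(2) glue_refl[of x]
        by (metis Diff_triv Image_singleton_iff empty_iff)
    have t': "circuit H m' p (filter (\<lambda>x. x \<in> H) hs)" using m'(4) t by blast
    have "circuit H (mate ?G) (opp ?G) (filter (\<lambda>x. x \<in> H) hs)"
      using t' by (rule circuit_cong[rotated 3]) (use m'(1) mG pop hG in auto)
    then have tG: "traversal ?G (filter (\<lambda>x. x \<in> H) hs)" unfolding traversal_circuit hG .
    have "free_loops ?G = (if halfs ?G = {} then 1 else 0)"
    proof (cases "H = {}")
      case True
      have "?X // ?r = {?X}" using whole X(1) True by (auto simp: quotient_def)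
      then show ?thesis using True fG hG by simp
    next
      case False
      have "{C \<in> ?X // ?r. C \<inter> H = {}} = {}"
        using whole HX False by (fastforce simp: quotient_def)
      then have "free_loops ?G = 0" unfolding fG by (simp only: card.empty)
      then show ?thesis using False hG by simp
    qed
    then have "unicursal_graph ?G" using traversal_unicursal[OF framed tG] by simp
    moreover have "word (label ?v S) hs = map ?v (filter (\<lambda>x. x \<in> H) hs)"
    proof -
      have "set hs \<subseteq> ?X" using t by (auto simp: circuit_def)
      then show ?thesis by (induction hs) (auto simp: label_def H_def)
    qed
    ultimately show ?thesis using tG hG(2) unfolding chord_diagram_def by force
  qed
  then show "circuit ?X ?m p hs \<Longrightarrow>
      unicursal_graph ?G \<and> word (label ?v S) hs \<in> chord_diagram ?G" .
  show "num_unicursal_components ?G = 1 \<longleftrightarrow> conn ?X ?m p"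
  proof
    assume "conn ?X ?m p"
    then show "num_unicursal_components ?G = 1"
      using conn_circuit[OF _ W(2) PR(1) W(1)] unic by (auto simp: unicursal_graph_def)
  next
    assume "num_unicursal_components ?G = 1"
    then have u: "unicursal_graph ?G" using framed by (simp add: unicursal_graph_def)
    show "conn ?X ?m p" unfolding conn_def
    proof (intro allI impI)
      fix C assume C: "C \<subseteq> ?X" "C \<noteq> {}" "?m ` C \<subseteq> C" "p ` C \<subseteq> C"
      have rC: "?r `` {x} \<subseteq> C" if "x \<in> C" for x
        using that C(3,4) by (auto elim!: glue_closed)
      have iff: "?m x \<in> C \<longleftrightarrow> x \<in> C" "p x \<in> C \<longleftrightarrow> x \<in> C" if "x \<in> ?X" for x
        using pairing_closed_iff[OF W(2) C(3) that] pairing_closed_iff[OF PR(1) C(4) that] .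
      \<comment> \<open>The complement of a closed set is closed as well, so each glue class lies
        entirely in \<open>C\<close> or entirely in \<open>?D\<close>.\<close>
      let ?D = "?X - C"
      have D: "?m ` ?D \<subseteq> ?D" "p ` ?D \<subseteq> ?D"
        using iff pairingD(1)[OF W(2)] pairingD(1)[OF PR(1)] by auto
      have rD: "?r `` {x} \<subseteq> ?D" if "x \<in> ?D" for x
      proof
        fix y assume "y \<in> ?r `` {x}"
        then have "(x, y) \<in> ?r" by simp
        then show "y \<in> ?D" by (rule glue_closed) (use that D in auto)
      qed
      show "C = ?X"
      proof (cases "H = {}")
        \<comment> \<open>Nothing survives: the only component is a free loop, so there is just one
          glue class.\<close>
        case True
        then have "card (?X // ?r) = 1" using u fG hG by (simp add: unicursal_graph_iff)
        then obtain B where B: "?X // ?r = {B}" by (auto simp: card_1_singleton_iff)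
        obtain x where x: "x \<in> C" using C(2) by auto
        have "y \<in> C" if y: "y \<in> ?X" for y
        proof -
          have "?r `` {x} \<in> ?X // ?r" "?r `` {y} \<in> ?X // ?r"
            using x y C(1) by (auto intro: quotientI)
          then have "?r `` {y} = ?r `` {x}" using B by simp
          then have "y \<in> ?r `` {x}" using glue_refl[of y ?X ?m p H] by blast
          then show ?thesis using rC[OF x] by blast
        qed
        then show ?thesis using C(1) by blast
      next
        case False
        then have 0: "free_loops ?G = 0" and c: "conn H (mate ?G) (opp G)"
          using u hG by (auto simp: unicursal_graph_iff)
        \<comment> \<open>In the absence of free loops every glue class reaches a survivor.\<close>
        have meets: "?r `` {x} \<inter> H \<noteq> {}" if "x \<in> ?X" for x
        proof
          assume "?r `` {x} \<inter> H = {}"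
          then have "?r `` {x} \<in> {C \<in> ?X // ?r. C \<inter> H = {}}" using that by (auto intro: quotientI)
          then show False using fG 0 fin by (metis card_eq_0_iff empty_iff)
        qed
        have "C \<inter> H = H"
        proof (rule connD[OF c])
          show "C \<inter> H \<noteq> {}" using C(1,2) meets rC by blast
          have "m' x \<in> C" if "x \<in> C \<inter> H" for x using m'(2) that rC by blast
          then show "mate ?G ` (C \<inter> H) \<subseteq> C \<inter> H" using mG pairingD(1)[OF m'(1)] by auto
          show "opp G ` (C \<inter> H) \<subseteq> C \<inter> H" using pop pH C(1,4) by (auto simp flip: pop)
        qed auto
        then have "?D \<inter> H = {}" by blast
        then have "?D = {}" using meets rD by blast
        then show ?thesis using C(1) by blast
      qed
    qed
  qed
qed

lemma bracket_eq_Z: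
  assumes "unicursal_graph G"
  shows "bracket G = state_sum (halfs G) (mate G) (opp G) (vert G) {} (even_verts G)"
proof -
  let ?X = "halfs G" and ?S = "even_verts G"
  have F: "framed_graph G" using assms by (simp add: unicursal_graph_def)
  note wf = framed_wf_state[OF F]
  have st: "states ?X (opp G) (vert G) ?S = smoothings G ?S"
    by (rule smoothings_eq_states[symmetric])
  have "(if num_unicursal_components (smooth G ?S j) = 1
      then Poly_Mapping.single (move2_class_of (smooth G ?S j)) 1 else 0) =
    state_value ?X (mate G) (resolve ?X (opp G) (vert G) ?S j) (label (vert G) ({} \<union> ?S))"
    if j: "j \<in> smoothings G ?S" for j
  proof (cases "?X = {}")
    \<comment> \<open>A single free loop is invisible to half-edges. It is represented by the empty
      circuit, and smoothing leaves it a single free loop.\<close>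
    case True
    have fl: "free_loops G = 1" using assms True by (simp add: unicursal_graph_iff)
    let ?G = "smooth G ?S j"
    have G: "halfs ?G = {}" "free_loops ?G = 1" using True fl
      by (auto simp: smooth_def Let_def quotient_def)
    then have "unicursal_graph ?G" by (simp add: unicursal_graph_iff framed_graph_def)
    moreover from this have "[] \<in> chord_diagram ?G"
      unfolding chord_diagram_def traversal_circuit using G(1) circuit_Nil by blast
    moreover have t: "circuit ?X (mate G) (resolve ?X (opp G) (vert G) ?S j) []"
      using True by (simp add: circuit_Nil)
    ultimately show ?thesis
      using state_value_circuit[OF paired_resolve[OF wf _ j[folded st]] t] word_class_eq
        by (simp add: unicursal_graph_def)
  next
    case False
    then have fl: "free_loops G = 0" using assms by (simp add: unicursal_graph_iff)
    let ?p = "resolve ?X (opp G) (vert G) ?S j"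
    note sm = smoothing_state[OF F False fl j]
    show ?thesis
    proof (cases "conn ?X (mate G) ?p")
      case True
      have pr: "paired ?X (mate G) ?p (label (vert G) ({} \<union> ?S))"
        by (rule paired_resolve[OF wf _ j[folded st]]) simp
      obtain hs where hs: "circuit ?X (mate G) ?p hs"
        using conn_circuit[OF True] pr by (auto simp: paired_def)
      have "word_class (word (label (vert G) ?S) hs) = move2_class_of (smooth G ?S j)"
        using sm(2)[OF hs] word_class_eq by blast
      then show ?thesis using state_value_circuit[OF pr hs] sm(1) True by simp
    qed (use sm(1) in \<open>simp add: state_value_not_conn\<close>)
  qed
  moreover have "finite (smoothings G ?S)" by (rule finite_smoothings) (rule framed_graphD(1)[OF F])
  ultimately show ?thesis
    unfolding bracket_def state_sum_def st by (simp add: sum.inter_filter)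
qed

section \<open>Elementary relations between state sums\<close>

lemma circuit_map:
  assumes "circuit X m p hs" "bij_betw f X X'" "pairing X m"
    "\<forall>x\<in>X. f (m x) = m' (f x)" "\<forall>x\<in>X. f (p x) = p' (f x)"
  shows "circuit X' m' p' (map f hs)"
proof -
  have X: "set hs \<union> m ` set hs = X" and d: "distinct (hs @ map m hs)"
    and n: "\<And>i. i < length hs \<Longrightarrow> hs ! (Suc i mod length hs) = p (m (hs ! i))"
    using assms(1) by (auto simp: circuit_def)
  have sub: "set hs \<subseteq> X" using X by auto
  then have mm: "map m' (map f hs) = map f (map m hs)" using assms(4) by auto
  have f: "inj_on f X" "f ` X = X'" using assms(2) by (auto simp: bij_betw_def)
  have "set (map f hs) \<union> m' ` set (map f hs) = f ` (set hs \<union> m ` set hs)"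
    using arg_cong[OF mm, of set] unfolding set_map by (simp add: image_Un)
  moreover have "distinct (map f hs @ map m' (map f hs))"
    unfolding mm map_append[symmetric] distinct_map using d f(1) X by (auto intro: inj_on_subset)
  moreover have "map f hs ! (Suc i mod length (map f hs)) = p' (m' (map f hs ! i))"
    if "i < length (map f hs)" for i
  proof -
    have i: "i < length hs" using that by simp
    then have "hs ! i \<in> X" using sub by auto
    moreover from this have "m (hs ! i) \<in> X" using pairingD[OF assms(3)] by auto
    moreover have "Suc i mod length hs < length hs" using i by (intro mod_less_divisor) auto
    ultimately show ?thesis using n[OF i] assms(4,5) i by simp
  qed
  ultimately show ?thesis unfolding circuit_def using X f(2) by blast
qed

lemma conn_map:
  assumes "conn X' m' p'" "bij_betw f X X'"
    "\<forall>x\<in>X. f (m x) = m' (f x)" "\<forall>x\<in>X. f (p x) = p' (f x)"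
  shows "conn X m p"
  unfolding conn_def
proof (intro allI impI)
  fix C assume C: "C \<subseteq> X" "C \<noteq> {}" "m ` C \<subseteq> C" "p ` C \<subseteq> C"
  have f: "inj_on f X" "f ` X = X'" using assms(2) by (auto simp: bij_betw_def)
  have "m' (f x) \<in> f ` C" "p' (f x) \<in> f ` C" if "x \<in> C" for x
    using that C assms(3,4) by (metis image_eqI image_subset_iff subsetD)+
  then have "m' ` f ` C \<subseteq> f ` C" "p' ` f ` C \<subseteq> f ` C" by blast+
  moreover have "f ` C \<subseteq> X'" "f ` C \<noteq> {}" using C(1,2) f(2) by blast+
  ultimately have "f ` C = X'" using connD[OF assms(1), of "f ` C"] by blast
  then show "C = X" using f C(1) by (metis inj_on_image_eq_iff subset_refl)
qed

lemma states_map: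
  assumes "bij_betw f X X'" "\<forall>x\<in>X. f (p x) = p' (f x)"
    "\<forall>x\<in>X. v x \<in> S \<longleftrightarrow> v' (f x) \<in> S'"
    "\<forall>x\<in>X. \<forall>y\<in>X. v x \<in> S \<longrightarrow> v y = v x \<longrightarrow> v' (f y) = v' (f x)"
    "\<forall>x\<in>X. p x \<in> X" "j \<in> states X p v S"
    "\<forall>x\<in>X. f' (f x) = x"
  shows "(\<lambda>y. if y \<in> X' then f (j (f' y)) else y) \<in> states X' p' v' S'"
proof -
  have f: "inj_on f X" "f ` X = X'" using assms(1) by (auto simp: bij_betw_def)
  note J = statesD[OF assms(6)]
  have stay: "j h = h" if "\<not> (h \<in> X \<and> v h \<in> S)" for h
    using assms(6)[unfolded states_def mem_Collect_eq, THEN spec[of _ h]] that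
      by (simp split: if_splits)
  show ?thesis unfolding states_def mem_Collect_eq
  proof
    fix y
    show "if y \<in> X' \<and> v' y \<in> S'
      then (if y \<in> X' then f (j (f' y)) else y) \<in> X' \<and>
        v' (if y \<in> X' then f (j (f' y)) else y) = v' y \<and>
        (if y \<in> X' then f (j (f' y)) else y) \<noteq> y \<and>
        (if y \<in> X' then f (j (f' y)) else y) \<noteq> p' y \<and>
        (if (if y \<in> X' then f (j (f' y)) else y) \<in> X'
         then f (j (f' (if y \<in> X' then f (j (f' y)) else y)))
         else if y \<in> X' then f (j (f' y)) else y) = y
      else (if y \<in> X' then f (j (f' y)) else y) = y"
    proof (cases "y \<in> X'")
      case True
      then obtain x where x: "x \<in> X" "y = f x" using f by auto
      have fx: "f' y = x" using x assms(7) by simp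
      show ?thesis
      proof (cases "v x \<in> S")
        case vS: True
        have jx: "j x \<in> X" "v (j x) = v x" "j x \<noteq> x" "j x \<noteq> p x" "j (j x) = x" using J x vS by auto
        have "f (j x) \<noteq> f x" "f (j x) \<noteq> f (p x)"
          using jx x assms(5) f(1) by (auto dest: inj_onD)
        moreover have "v' (f (j x)) = v' (f x)" using assms(4) x jx vS by blast
        moreover have "f (j x) \<in> X'" using jx f by auto
        ultimately show ?thesis using x fx jx assms(2,3,7) vS True by simp
      next
        case False
        then show ?thesis using stay[of x] fx x assms(3) True by simp
      qed
    qed simp
  qed
qed

text \<open>Isomorphism invariance with extra freedom at resolved vertices: \<open>g\<close> renames
  the vertices outside \<open>R\<close>, while inside \<open>R\<close> half-edges may be distributed
  over the names in any way. Choices correspond by conjugation with \<open>f\<close>.\<close>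

lemma state_sum_iso:
  assumes wf: "wf_state X m p v R" "wf_state X' m' p' v' R'" "R \<inter> S = {}" "R' \<inter> S' = {}"
    and f: "bij_betw f X X'" "\<forall>x\<in>X. f (m x) = m' (f x)" "\<forall>x\<in>X. f (p x) = p' (f x)"
    and R: "\<forall>x\<in>X. v x \<in> R \<longleftrightarrow> v' (f x) \<in> R'" and S: "\<forall>x\<in>X. v x \<in> S \<longleftrightarrow> v' (f x) \<in> S'"
    and g: "\<forall>x\<in>X. v x \<notin> R \<longrightarrow> v' (f x) = g (v x)" "inj_on g (v ` X - R)"
  shows "state_sum X m p v R S = state_sum X' m' p' v' R' S'"
proof -
  define f' where "f' = inv_into X f"
  have fb: "inj_on f X" "f ` X = X'" using f(1) by (auto simp: bij_betw_def)
  have f'1: "\<forall>x\<in>X. f' (f x) = x" unfolding f'_def using fb(1) by simp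
  have f'2: "\<forall>y\<in>X'. f (f' y) = y \<and> f' y \<in> X" unfolding f'_def using fb(2)
    by (metis f_inv_into_f inv_into_into)
  have f'b: "bij_betw f' X' X" unfolding f'_def by (rule bij_betw_inv_into[OF f(1)])
  note W = wf_stateD[OF wf(1)] and W' = wf_stateD[OF wf(2)]
  have pX: "\<forall>x\<in>X. p x \<in> X" "\<forall>x\<in>X'. p' x \<in> X'" using pairingD[OF W(3)] pairingD[OF W'(3)] by auto
  have SR: "v x \<notin> R" if "v x \<in> S" for x using that wf(3) by auto
  let ?F = "\<lambda>j y. if y \<in> X' then f (j (f' y)) else y"
  let ?F' = "\<lambda>j x. if x \<in> X then f' (j (f x)) else x"
  have F: "?F j \<in> states X' p' v' S'" if "j \<in> states X p v S" for j
  proof (rule states_map[OF f(1,3) S _ pX(1) that f'1])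
    show "\<forall>x\<in>X. \<forall>y\<in>X. v x \<in> S \<longrightarrow> v y = v x \<longrightarrow> v' (f y) = v' (f x)"
      using g(1) SR by metis
  qed
  have F': "?F' j \<in> states X p v S" if "j \<in> states X' p' v' S'" for j
  proof (rule states_map[OF f'b _ _ _ pX(2) that])
    show "\<forall>x\<in>X'. f' (p' x) = p (f' x)" using f(3) f'1 f'2 pX by metis
    show "\<forall>x\<in>X'. v' x \<in> S' \<longleftrightarrow> v (f' x) \<in> S" using S f'2 by metis
    show "\<forall>x\<in>X'. f (f' x) = x" using f'2 by blast
    show "\<forall>x\<in>X'. \<forall>y\<in>X'. v' x \<in> S' \<longrightarrow> v' y = v' x \<longrightarrow> v (f' y) = v (f' x)"
    proof (intro ballI impI)
      fix x y assume xy: "x \<in> X'" "y \<in> X'" "v' x \<in> S'" "v' y = v' x"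
      have in': "f' x \<in> X" "f' y \<in> X" "f (f' x) = x" "f (f' y) = y" using f'2 xy by auto
      then have "v (f' x) \<in> S" "v (f' y) \<in> S" using S xy by auto
      then have nR: "v (f' x) \<notin> R" "v (f' y) \<notin> R" using SR by auto
      then have "g (v (f' x)) = g (v (f' y))" using g(1) in' xy(4) by metis
      then show "v (f' y) = v (f' x)" using g(2) nR in' by (auto dest: inj_onD)
    qed
  qed
  have out: "j h = h" if "j \<in> states X p v S" "h \<notin> X" for j h X p v S
    using that(1)[unfolded states_def mem_Collect_eq, THEN spec[of _ h]] that(2) by simp
  have into: "j h \<in> X" if "j \<in> states X p v S" "h \<in> X" for j h X p v S
    using that(1)[unfolded states_def mem_Collect_eq, THEN spec[of _ h]] that(2)
      by (auto split: if_splits)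
  show ?thesis unfolding state_sum_def
  proof (rule sum.reindex_bij_witness[where j = ?F and i = ?F'])
    fix j assume j: "j \<in> states X p v S"
    show "?F' (?F j) = j"
    proof
      fix x show "?F' (?F j) x = j x"
        using f'1 fb into[OF j, of x] out[OF j, of x] by auto
    qed
    show "?F j \<in> states X' p' v' S'" using F[OF j] .
    let ?p = "resolve X p v S j" and ?p' = "resolve X' p' v' S' (?F j)"
    have fp: "\<forall>x\<in>X. f (?p x) = ?p' (f x)"
    proof
      fix x assume x: "x \<in> X"
      have "f x \<in> X'" using x fb by auto
      then show "f (?p x) = ?p' (f x)"
        using x S f'1 f(3) by (cases "v x \<in> S") (simp_all add: resolve_def)
    qed
    have label: "label v' (R' \<union> S') (f x) = map_option g (label v (R \<union> S) x)" if "x \<in> X" for x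
      using that R S g(1) by (auto simp: label_def)
    show "state_value X' m' ?p' (label v' (R' \<union> S')) = state_value X m ?p (label v (R \<union> S))"
    proof (rule state_value_eqI[symmetric, OF paired_resolve[OF wf(1,3) j] paired_resolve[OF wf(2,4) F[OF j]]])
      show "conn X m ?p" if "conn X' m' ?p'" using conn_map[OF that f(1,2) fp] .
      fix hs assume hs: "circuit X m ?p hs"
      have sub: "set hs \<subseteq> X" using hs by (auto simp: circuit_def)
      have "word (label v' (R' \<union> S')) (map f hs) = map g (word (label v (R \<union> S)) hs)"
        unfolding map_filter_map map_filter_map_option[symmetric]
        by (rule map_filter_cong) (use sub label in auto)
      moreover have "set (word (label v (R \<union> S)) hs) \<subseteq> v ` X - R"
        using sub by (auto simp: map_filter_def label_def split: if_splits)
      then have "word_class (map g (word (label v (R \<union> S)) hs)) =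
          word_class (word (label v (R \<union> S)) hs)"
        using g(2) by (intro word_class_map) (rule inj_on_subset)
      ultimately show "\<exists>hs'. circuit X' m' ?p' hs' \<and>
          word_class (word (label v (R \<union> S)) hs) = word_class (word (label v' (R' \<union> S')) hs')"
        using circuit_map[OF hs f(1) W(2) f(2) fp] by metis
    qed
  next
    fix j assume j: "j \<in> states X' p' v' S'"
    show "?F' j \<in> states X p v S" using F'[OF j] .
    show "?F (?F' j) = j"
    proof
      fix y show "?F (?F' j) y = j y"
        using f'2 into[OF j, of y] out[OF j, of y] by auto
    qed
  qed
qed

lemma state_sum_cong:
  assumes "wf_state X m p v R" "wf_state X m p' v' R" "R \<inter> S = {}"
    "\<forall>x\<in>X. p x = p' x" "\<forall>x\<in>X. v x = v' x \<or> v x \<in> R \<and> v' x \<in> R"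
  shows "state_sum X m p v R S = state_sum X m p' v' R S"
  by (rule state_sum_iso[where f = id and g = id])
    (use assms in \<open>auto simp: bij_betw_def\<close>)

lemma wf_state_cong:
  assumes "wf_state X m p v R" "\<forall>x\<in>X. p x = p' x" "\<forall>x\<in>X. v x = v' x \<or> v x \<in> R \<and> v' x \<in> R"
  shows "wf_state X m p' v' R"
proof -
  note W = wf_stateD[OF assms(1)]
  have P: "pairing X p'" using W(3) assms(2) unfolding pairing_def by metis
  show ?thesis unfolding wf_state_def
  proof (intro conjI ballI impI)
    fix x assume x: "x \<in> X"
    have vR: "v z \<in> R \<longleftrightarrow> v' z \<in> R" if "z \<in> X" for z using assms(3) that by fastforce
    have px: "p' x = p x" "p x \<in> X" using assms(2) x pairingD(1)[OF W(3) x] by auto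
    show "v' (p' x) \<in> R \<longleftrightarrow> v' x \<in> R" using W(4)[OF x] vR[OF x] vR[OF px(2)] px(1) by simp
    assume nR: "v' x \<notin> R"
    then have nR': "v x \<notin> R" "v' x = v x" using vR[OF x] assms(3) x by auto
    then have 1: "v (p x) = v x" using W(5)[OF x] by simp
    then show "v' (p' x) = v' x" using px nR' assms(3) by fastforce
    have "v' y = v' x \<longleftrightarrow> v y = v x" if y: "y \<in> X" for y
      using assms(3) y nR nR' by metis
    then have "{y \<in> X. v' y = v' x} = {y \<in> X. v y = v x}" by blast
    then show "card {y \<in> X. v' y = v' x} = 4" using W(6)[OF x nR'(1)] by simp
  qed (use W P in auto)
qed

text \<open>To declare a vertex resolved without touching \<open>p\<close> means to pass straight
  through it and to drop its label, which amounts to deleting its chord.\<close>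

lemma wf_state_forget:
  assumes "wf_state X m p v R" "R \<subseteq> R'"
  shows "wf_state X m p v R'"
  using assms unfolding wf_state_def by (metis subsetD)

section \<open>Contracted edges and split-off circles\<close>

lemma wf_state_contract:
  assumes "wf_state X m p v R" "h \<in> X" "k = m h" "p h \<noteq> k" "v h \<in> R" "v k \<in> R"
  shows "wf_state (X - {h, k}) m (p(p h := p k, p k := p h)) v R"
proof -
  note W = wf_stateD[OF assms(1)]
  have "k \<in> X" using assms(2,3) pairingD[OF W(2)] by auto
  then have "v (p h) \<in> R" "v (p k) \<in> R" using W(4) assms by auto
  moreover have "{y \<in> X - {h, k}. v y = v x} = {y \<in> X. v y = v x}" if "v x \<notin> R" for x
    using that assms by auto
  ultimately show ?thesis
    unfolding wf_state_def using pairing_remove_edge[OF W(2,3) assms(2-4)] W by auto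
qed

text \<open>Both ends of the edge lie at resolved vertices, so the edge affects neither the choices
  nor the words; termwise this is the contraction of an edge of a circuit.\<close>

lemma state_sum_contract:
  assumes wf: "wf_state X m p v R" and h: "h \<in> X" "k = m h" "p h \<noteq> k" "v h \<in> R" "v k \<in> R"
    and SR: "R \<inter> S = {}"
  shows "state_sum X m p v R S = state_sum (X - {h, k}) m (p(p h := p k, p k := p h)) v R S"
proof -
  note W = wf_stateD[OF wf]
  let ?X = "X - {h, k}" and ?p = "p(p h := p k, p k := p h)"
  have k: "k \<in> X" using h pairingD[OF W(2)] by auto
  have R: "v (p h) \<in> R" "v (p k) \<in> R" using W(4) h k by auto
  have nS: "v h \<notin> S" "v k \<notin> S" "v (p h) \<notin> S" "v (p k) \<notin> S" using R h SR by auto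
  have st: "states ?X ?p v S = states X p v S"
    unfolding states_def
  proof (intro Collect_cong all_cong1)
    fix j z
    show "(if z \<in> ?X \<and> v z \<in> S then j z \<in> ?X \<and> v (j z) = v z \<and> j z \<noteq> z \<and> j z \<noteq> ?p z \<and> j (j z) =
        z else j z = z) =
      (if z \<in> X \<and> v z \<in> S then j z \<in> X \<and> v (j z) = v z \<and> j z \<noteq> z \<and> j z \<noteq> p z \<and> j (j z) = z else j z = z)"
    proof (cases "z \<in> X \<and> v z \<in> S")
      case True
      then have "z \<noteq> h" "z \<noteq> k" "z \<noteq> p h" "z \<noteq> p k" using nS by auto
      moreover have "v (j z) = v z \<longrightarrow> j z \<noteq> h \<and> j z \<noteq> k" using True nS by auto
      ultimately show ?thesis using True by auto
    qed auto
  qed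
  have "state_value X m (resolve X p v S j) (label v (R \<union> S)) =
      state_value ?X m (resolve ?X ?p v S j) (label v (R \<union> S))"
    if j: "j \<in> states X p v S" for j
  proof -
    let ?q = "resolve X p v S j"
    have q: "?q h = p h" "?q k = p k" using nS by (auto simp: resolve_def)
    \<comment> \<open>Contraction commutes with the choice, because all changed values belong to
      resolved vertices.\<close>
    have eq: "resolve ?X ?p v S j = ?q(?q h := ?q k, ?q k := ?q h)"
      unfolding q using nS by (auto simp: resolve_def fun_eq_iff)
    note Q = pairing_resolve(1)[OF wf SR j]
    have hq: "?q h \<noteq> k" using q h by simp
    show ?thesis
    proof (rule state_value_eqI[OF paired_resolve[OF wf SR j] paired_resolve[OF wf_state_contract[OF wf h] SR]])
      show "j \<in> states ?X ?p v S" using j st by simp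
      show "conn X m ?q" if "conn ?X m (resolve ?X ?p v S j)"
        using conn_remove_edge[OF that[unfolded eq] W(2) Q h(1,2) hq] .
      fix hs assume hs: "circuit X m ?q hs"
      have "word (label v (R \<union> S)) (filter (\<lambda>x. x \<noteq> h \<and> x \<noteq> k) hs) =
          word (label v (R \<union> S)) hs"
        by (rule map_filter_filter) (use h in \<open>auto simp: label_def\<close>)
      then show "\<exists>hs'. circuit ?X m (resolve ?X ?p v S j) hs' \<and>
          word_class (word (label v (R \<union> S)) hs) = word_class (word (label v (R \<union> S)) hs')"
        using circuit_remove_edge[OF hs W(2) Q h(1,2) hq] unfolding eq by metis
    qed
  qed
  then show ?thesis unfolding state_sum_def st by (rule sum.cong[OF refl])
qed

text \<open>No choice at the vertices of \<open>S\<close> can connect \<open>C\<close> with the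
  rest, so every summand vanishes; \<open>C \<noteq> X\<close> ensures that there is a rest.\<close>

lemma state_sum_circle:
  assumes "C \<subseteq> X" "C \<noteq> {}" "C \<noteq> X" "m ` C \<subseteq> C" "p ` C \<subseteq> C" "v ` C \<subseteq> R" "R \<inter> S = {}"
  shows "state_sum X m p v R S = 0"
  unfolding state_sum_def
proof (rule sum.neutral, rule ballI)
  fix j
  have "resolve X p v S j x = p x" if "x \<in> C" for x
    using that assms(6,7) by (auto simp: resolve_def)
  then have "resolve X p v S j ` C \<subseteq> C" using assms(5) by auto
  then have "\<not> conn X m (resolve X p v S j)" using connD assms(1-4) by blast
  then show "state_value X m (resolve X p v S j) (label v (R \<union> S)) = 0"
    by (rule state_value_not_conn)
qed

section \<open>Smoothing one vertex at a time\<close>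

definition smooth_pairing :: "(nat \<Rightarrow> nat) \<Rightarrow> nat \<Rightarrow> nat \<Rightarrow> nat \<Rightarrow> nat" where
  "smooth_pairing p x y = p(x := y, y := x, p x := p y, p y := p x)"

lemma wf_state_smooth:
  assumes wf: "wf_state X m p v R" and a: "v x = a" "a \<notin> R" and x: "x \<in> X" "y \<in> X"
    and H: "{h \<in> X. v h = a} = {x, p x, y, p y}" "distinct [x, p x, y, p y]"
  shows "wf_state X m (smooth_pairing p x y) v (insert a R)"
proof -
  note W = wf_stateD[OF wf] and P = pairingD[OF wf_stateD(3)[OF wf]]
  let ?H = "{x, p x, y, p y}"
  have va: "v h = a \<longleftrightarrow> h \<in> ?H" if "h \<in> X" for h using H(1) that by blast
  have out: "p h \<notin> ?H" if "h \<in> X" "h \<notin> ?H" for h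
    using that va W(4,5) a P(1)
    by (metis (no_types, lifting) H(1) mem_Collect_eq P(3))
  have pair: "pairing X (smooth_pairing p x y)"
    unfolding pairing_def
  proof
    fix h assume h: "h \<in> X"
    show "smooth_pairing p x y h \<in> X \<and> smooth_pairing p x y h \<noteq> h \<and>
      smooth_pairing p x y (smooth_pairing p x y h) = h"
    proof (cases "h \<in> ?H")
      case True
      then show ?thesis using H(2) x P(1) by (auto simp: smooth_pairing_def)
    next
      case False
      then show ?thesis using out[OF h False] P[OF h] by (auto simp: smooth_pairing_def)
    qed
  qed
  have "v (smooth_pairing p x y h) = a" if "h \<in> ?H" for h
    using that va x P(1) H(2) by (auto simp: smooth_pairing_def)
  moreover have "smooth_pairing p x y h = p h" if "h \<notin> ?H" for h
    using that by (auto simp: smooth_pairing_def)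
  ultimately have *: "v (smooth_pairing p x y h) = (if h \<in> ?H then a else v (p h))" if "h \<in> X" for h
    using that by presburger
  have **: "v (p h) \<in> insert a R \<longleftrightarrow> v h \<in> insert a R" if "h \<in> X" "h \<notin> ?H" for h
    using W(4)[OF that(1)] va[OF that(1)] va[OF P(1)[OF that(1)]] out[OF that] that(2) by blast
  show ?thesis
    unfolding wf_state_def
  proof (intro conjI ballI impI)
    fix h assume h: "h \<in> X"
    show "v (smooth_pairing p x y h) \<in> insert a R \<longleftrightarrow> v h \<in> insert a R"
    proof (cases "h \<in> ?H")
      case True
      then have "v h = a" using va[OF h] by blast
      then show ?thesis using *[OF h] True by (simp only: if_True insertI1)
    next
      case False
      then show ?thesis using *[OF h] **[OF h False] by (simp only: if_False)
    qed
    assume "v h \<notin> insert a R"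
    then have "v h \<notin> R" "h \<notin> ?H" using va[OF h] by auto
    then show "v (smooth_pairing p x y h) = v h" "card {y \<in> X. v y = v h} = 4"
      using *[OF h] W(5,6)[OF h] by simp_all
  qed (use W(1,2) pair in auto)
qed

text \<open>The value \<open>j x = y\<close> fixes the choice at the whole vertex, since the two
  remaining half-edges have only each other left. Forgetting it is a bijection onto the choices for
  the state in which \<open>a\<close> is already resolved.\<close>

lemma state_sum_split_half:
  assumes wf: "wf_state X m p v R" and a: "v x = a" "a \<notin> R" "a \<notin> S" and x: "x \<in> X" "y \<in> X"
    and H: "{h \<in> X. v h = a} = {x, p x, y, p y}" "distinct [x, p x, y, p y]"
  shows "(\<Sum>j\<in>{j \<in> states X p v (insert a S). j x = y}.
      state_value X m (resolve X p v (insert a S) j) (label v (R \<union> insert a S))) =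
    state_sum X m (smooth_pairing p x y) v (insert a R) S"
proof -
  let ?H = "{x, p x, y, p y}" and ?q = "smooth_pairing p x y"
  note P = pairingD[OF wf_stateD(3)[OF wf]]
  have va: "v h = a \<longleftrightarrow> h \<in> ?H" if "h \<in> X" for h using H(1) that by blast
  have HX: "?H \<subseteq> X" using H(1) by blast
  have q: "?q x = y" "?q y = x" "?q (p x) = p y" "?q (p y) = p x"
    using H(2) by (auto simp: smooth_pairing_def)
  have q': "?q h = p h" if "h \<notin> ?H" for h using that by (auto simp: smooth_pairing_def)
  have vH: "v h = a" "h \<in> X" if h: "h \<in> ?H" for h
  proof -
    show "h \<in> X" using h HX by (rule subsetD[rotated])
    then show "v h = a" using va h by (simp only:)
  qed
  have jH: "j h = ?q h" if j: "j \<in> states X p v (insert a S)" "j x = y" and h: "h \<in> ?H" for j h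
  proof -
    note J = statesD[OF j(1)]
    have 1: "j y = x" using J(5)[of x] j(2) x a by simp
    have "j (p x) \<in> ?H" "j (p x) \<noteq> p x"
      using J(1-3)[of "p x"] vH[of "p x"] va by auto
    moreover have "j (p x) \<noteq> x" "j (p x) \<noteq> y"
      using J(5)[of "p x"] vH[of "p x"] 1 j(2) H(2) by auto
    ultimately have 2: "j (p x) = p y" by auto
    have 3: "j (p y) = p x" using J(5)[of "p x"] vH[of "p x"] 2 by simp
    show ?thesis using h 1 2 3 j(2) q by auto
  qed
  \<comment> \<open>\<open>?F\<close> forgets the choice at \<open>a\<close>, being the identity
    there as \<open>states\<close> demands outside \<open>S\<close>; \<open>?F'\<close> puts it
    back.\<close>
  let ?F = "\<lambda>j h. if h \<in> ?H then h else j h" and ?F' = "\<lambda>j h. if h \<in> ?H then ?q h else j h"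
  show ?thesis unfolding state_sum_def
  proof (rule sum.reindex_bij_witness[where j = ?F and i = ?F'])
    fix j assume "j \<in> {j \<in> states X p v (insert a S). j x = y}"
    then have j: "j \<in> states X p v (insert a S)" "j x = y" by auto
    note J = statesD[OF j(1)]
    show "?F' (?F j) = j"
    proof
      fix h show "?F' (?F j) h = j h"
        using jH[OF j, of h] by (cases "h \<in> ?H") (simp_all only: if_True if_False)
    qed
    show "?F j \<in> states X ?q v S" unfolding states_def mem_Collect_eq
    proof
      fix h
      show "if h \<in> X \<and> v h \<in> S
         then ?F j h \<in> X \<and> v (?F j h) = v h \<and> ?F j h \<noteq> h \<and> ?F j h \<noteq> ?q h \<and> ?F j (?F j h) = h
         else ?F j h = h"
      proof (cases "h \<in> X \<and> v h \<in> S")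
        case True
        then have h: "h \<in> X" "v h \<in> insert a S" "v h \<noteq> a" using a by auto
        have "h \<notin> ?H" using va[OF h(1)] h(3) by blast
        moreover have "j h \<notin> ?H" using va[OF J(1)[OF h(1,2)]] J(2)[OF h(1,2)] h(3) by metis
        ultimately have "h \<notin> ?H" "j h \<notin> ?H" .
        then show ?thesis using True J[OF h(1,2)] q'[of h]
          by (simp only: if_True if_False simp_thms)
      next
        case False
        have "j h = h" if "h \<notin> ?H"
          using j(1)[unfolded states_def mem_Collect_eq, THEN spec[of _ h]] that False va[of h]
            by auto
        then show ?thesis using False by auto
      qed
    qed
    have "resolve X p v (insert a S) j = resolve X ?q v S (?F j)"
    proof
      fix h show "resolve X p v (insert a S) j h = resolve X ?q v S (?F j) h"
        using jH[OF j, of h] q'[of h] va[of h] HX a by (cases "h \<in> ?H") (auto simp: resolve_def)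
    qed
    then show "state_value X m (resolve X ?q v S (?F j)) (label v (insert a R \<union> S)) =
      state_value X m (resolve X p v (insert a S) j) (label v (R \<union> insert a S))" by simp
  next
    fix j assume j: "j \<in> states X ?q v S"
    note J = statesD[OF j]
    have jfix: "j h = h" if "\<not> (h \<in> X \<and> v h \<in> S)" for h
      using j[unfolded states_def mem_Collect_eq, THEN spec[of _ h]] that by (simp split: if_splits)
    show "?F (?F' j) = j"
      using jfix va HX a by (fastforce simp: fun_eq_iff)
    have "?F' j \<in> states X p v (insert a S)" unfolding states_def mem_Collect_eq
    proof
      fix h
      show "if h \<in> X \<and> v h \<in> insert a S
         then ?F' j h \<in> X \<and> v (?F' j h) = v h \<and> ?F' j h \<noteq> h \<and> ?F' j h \<noteq> p h \<and> ?F' j (?F' j h) = h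
         else ?F' j h = h"
      proof (cases "h \<in> ?H")
        case True
        have pp: "p (p x) = x" "p (p y) = y" using P(3) x by auto
        have qH: "?q h \<in> ?H" "?q h \<noteq> h" "?q h \<noteq> p h" "?q (?q h) = h"
          using True q H(2) pp by auto
        moreover have "?q h \<in> X" "v (?q h) = v h" using vH[OF qH(1)] vH[OF True] by simp_all
        moreover have "h \<in> X" "v h \<in> insert a S" using vH[OF True] by simp_all
        ultimately show ?thesis using True by (simp only: if_True simp_thms)
      next
        case False
        show ?thesis
        proof (cases "h \<in> X \<and> v h \<in> S")
          case True
          then have h: "h \<in> X" "v h \<in> S" by auto
          have "j h \<notin> ?H" using False va[OF h(1)] va[OF J(1)[OF h]] J(2)[OF h] by auto
          then show ?thesis using True False J[OF h] q'[of h]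
            by (simp only: if_True if_False simp_thms insert_iff)
        next
          case nS: False
          then have "\<not> (h \<in> X \<and> v h \<in> insert a S)" using False va by auto
          then show ?thesis using False jfix[OF nS] by (simp only: if_False)
        qed
      qed
    qed
    then show "?F' j \<in> {j \<in> states X p v (insert a S). j x = y}" using q by simp
  qed
qed

text \<open>The two smoothings join \<open>x\<close> to one or the other half-edge of the second
  opposite pair, \<open>y\<close> or \<open>p y\<close>; the two half-edges left over are then
  joined as well.\<close>

lemma state_sum_split:
  assumes wf: "wf_state X m p v R" and a: "v x = a" "a \<notin> R" "a \<notin> S" and x: "x \<in> X" "y \<in> X"
    and H: "{h \<in> X. v h = a} = {x, p x, y, p y}" "distinct [x, p x, y, p y]"
  shows "state_sum X m p v R (insert a S) =
    state_sum X m (smooth_pairing p x y) v (insert a R) S + state_sum X m (smooth_pairing p x (p y)) v (insert a R) S"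
proof -
  note P = pairingD[OF wf_stateD(3)[OF wf]]
  have py: "p (p y) = y" "p y \<in> X" using P x by auto
  have H': "{h \<in> X. v h = a} = {x, p x, p y, p (p y)}" "distinct [x, p x, p y, p (p y)]"
    using H py by auto
  let ?A = "\<lambda>y. {j \<in> states X p v (insert a S). j x = y}"
  have "states X p v (insert a S) = ?A y \<union> ?A (p y)"
  proof -
    have "j x = y \<or> j x = p y" if j: "j \<in> states X p v (insert a S)" for j
    proof -
      have "j x \<in> X" "v (j x) = a" "j x \<noteq> x" "j x \<noteq> p x"
        using statesD[OF j x(1)] a(1) by auto
      then show ?thesis using H(1) by blast
    qed
    then show ?thesis by blast
  qed
  moreover have "?A y \<inter> ?A (p y) = {}" using H(2) by auto
  moreover have "finite (states X p v (insert a S))" by (rule finite_states[OF wf_stateD(1)[OF wf]])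
  ultimately have "state_sum X m p v R (insert a S) =
      (\<Sum>j\<in>?A y. state_value X m (resolve X p v (insert a S) j) (label v (R \<union> insert a S))) +
      (\<Sum>j\<in>?A (p y). state_value X m (resolve X p v (insert a S) j) (label v (R \<union> insert a S)))"
    unfolding state_sum_def by (metis (no_types, lifting) finite_Un sum.union_disjoint)
  then show ?thesis
    using state_sum_split_half[OF wf a x H] state_sum_split_half[OF wf a x(1) py(2) H'] by simp
qed

section \<open>Sliding a passage along an edge\<close>

lemma circuit_start:
  assumes "circuit X m p hs" "h \<in> set hs"
  obtains ys where "circuit X m p (h # ys)" "set (h # ys) = set hs"
    "\<And>L. word_class (word L hs) = word_class (word L (h # ys))"
proof -
  obtain as bs where hs: "hs = as @ h # bs" using split_list[OF assms(2)] by blast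
  show ?thesis
  proof (rule that[of "bs @ as"])
    show "circuit X m p (h # bs @ as)"
      using circuit_append_commute[of X m p as "h # bs"] assms(1) hs by simp
    show "set (h # bs @ as) = set hs" using hs by auto
    show "word_class (word L hs) = word_class (word L (h # bs @ as))" for L
      using word_class_map_filter_commute[of L as "h # bs"] hs by simp
  qed
qed

lemma circuit_second:
  assumes "circuit X m p (h # ys)" "p (m h) \<noteq> h"
  obtains zs where "ys = p (m h) # zs"
  using assms by (cases ys) (auto simp: circuit_Cons)

text \<open>Each edge and each passage is run through once, in one direction, so at most one
  half-edge of any pair is a departure.\<close>

lemma circuit_excl:
  assumes "circuit X m p hs" "pairing X m" "pairing X p" "h \<in> set hs"
  shows "m h \<notin> set hs" "p h \<notin> set hs"
proof -
  have d: "set hs \<inter> m ` set hs = {}" using assms(1) by (auto simp: circuit_def)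
  then show "m h \<notin> set hs" using assms(4) by blast
  have "set (map (\<lambda>x. p (m x)) hs) = set hs" using circuit_next[OF assms(1)] by simp
  then obtain k where k: "k \<in> set hs" "h = p (m k)" using assms(4) by auto
  then have "m k \<in> X" using assms(1) by (auto simp: circuit_def)
  then have "p h = m k" using k pairingD(3)[OF assms(3)] by simp
  then show "p h \<notin> set hs" using d k by auto
qed

text \<open>The passages \<open>{x, q x}\<close> and \<open>{y, q y}\<close> are neighbours on the
  circuit and the second one is unlabelled, so moving the label there leaves the sequence of visible
  labels unchanged.\<close>

lemma state_value_slide:
  assumes P: "paired X m q L" "paired X m q L1" and x: "x \<in> X" "y = m (q x)"
    and d: "distinct [x, q x, y, q y]" and L: "L y = None"
    and L1: "L1 = L(x := None, q x := None, y := L x, q y := L x)"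
  shows "state_value X m q L = state_value X m q L1"
proof (rule state_value_eqI[OF P])
  fix hs assume t: "circuit X m q hs"
  have m: "pairing X m" and q: "pairing X q" and Lq: "\<And>z. z \<in> X \<Longrightarrow> L (q z) = L z"
    using P by (auto simp: paired_def)
  have in': "q x \<in> X" "y \<in> X" "q y \<in> X" "m y = q x" "q (q x) = x" "q (q y) = y"
    using x pairingD[OF m] pairingD[OF q] by auto
  have X: "X = set hs \<union> m ` set hs" using t by (auto simp: circuit_def)
  have dist: "distinct hs" if "circuit X m q hs" for hs using that by (simp add: circuit_def)
  have "word_class (word L hs) = word_class (word L1 hs)"
  proof (cases "q x \<in> set hs")
    \<comment> \<open>Here the circuit runs from \<open>q x\<close> to \<open>y\<close>; in the
      other case it departs by \<open>y\<close> and arrives through \<open>q x\<close>.\<close>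
    case True
    obtain ys where ys: "circuit X m q (q x # ys)" "set (q x # ys) = set hs"
      "\<And>L. word_class (word L hs) = word_class (word L (q x # ys))"
      using circuit_start[OF t True] by blast
    have "q (m (q x)) \<noteq> q x" using x d by auto
    then obtain zs where zs: "ys = q y # zs" using circuit_second[OF ys(1)] x by metis
    have t': "circuit X m q (q x # q y # zs)" using ys(1) zs by simp
    have "x \<notin> set zs" "y \<notin> set zs" "q x \<notin> set zs" "q y \<notin> set zs"
      using circuit_excl[OF t' m q, of "q x"] circuit_excl[OF t' m q, of "q y"] in'(4-6) x(2) dist[OF t']
      by simp_all
    then have rest: "word L1 zs = word L zs"
      unfolding L1 by (intro map_filter_cong) (auto simp del: distinct.simps)
    have "L1 (q x) = None" "L1 (q y) = L x" "L (q x) = L x" "L (q y) = None"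
      using L Lq[OF x(1)] Lq[OF in'(2)] d unfolding L1 by auto
    then have "word L1 (q x # ys) = word L (q x # ys)"
      unfolding zs by (auto simp: rest split: option.split)
    then show ?thesis using ys(3) by metis
  next
    case False
    then obtain w where "w \<in> set hs" "q x = m w" using X in' by auto
    then have y: "y \<in> set hs" using x pairingD(3)[OF m, of w] X by auto
    obtain ys where ys: "circuit X m q (y # ys)" "set (y # ys) = set hs"
      "\<And>L. word_class (word L hs) = word_class (word L (y # ys))"
      using circuit_start[OF t y] by blast
    have "q (m y) \<noteq> y" using in' d by auto
    then obtain zs where zs: "ys = x # zs" using circuit_second[OF ys(1)] in' by metis
    have t': "circuit X m q (y # x # zs)" using ys(1) zs by simp
    have "x \<notin> set zs" "y \<notin> set zs" "q x \<notin> set zs" "q y \<notin> set zs"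
      using circuit_excl[OF t' m q, of x] circuit_excl[OF t' m q, of y] in'(4-6) x(2) dist[OF t']
      by simp_all
    then have rest: "word L1 zs = word L zs"
      unfolding L1 by (intro map_filter_cong) (auto simp del: distinct.simps)
    have "L1 y = L x" "L1 x = None"
      using d unfolding L1 by auto
    then have "word L1 (y # ys) = word L (y # ys)"
      unfolding zs by (auto simp: rest L split: option.split)
    then show ?thesis using ys(3) by metis
  qed
  then show "\<exists>hs'. circuit X m q hs' \<and> word_class (word L hs) = word_class (word L1 hs')"
    using t by blast
qed

lemma vertex_halves:
  assumes wf: "wf_state X m p v R" and x: "x \<in> X" "v x \<notin> R"
  obtains z where "z \<in> X" "{h \<in> X. v h = v x} = {x, p x, z, p z}" "distinct [x, p x, z, p z]"
proof -
  note W = wf_stateD[OF wf] and P = pairingD[OF wf_stateD(3)[OF wf]]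
  let ?V = "{h \<in> X. v h = v x}"
  have c: "card ?V = 4" using W(6)[OF x] .
  have f: "finite ?V" using W(1) by simp
  have px: "p x \<in> ?V" "p x \<noteq> x" using P[OF x(1)] W(5)[OF x] by auto
  have "\<not> ?V \<subseteq> {x, p x}"
  proof
    assume "?V \<subseteq> {x, p x}"
    then have "card ?V \<le> card {x, p x}" by (intro card_mono) auto
    then show False using c px(2) by simp
  qed
  then obtain z where z: "z \<in> X" "v z = v x" "z \<noteq> x" "z \<noteq> p x" by auto
  have pz: "p z \<in> ?V" "p z \<noteq> z" "p z \<noteq> x" "p z \<noteq> p x"
    using P[OF z(1)] W(5)[of z] z x P[OF x(1)] pairing_inj[OF W(3) z(1) x(1)] by auto
  have d: "distinct [x, p x, z, p z]" using z pz px by auto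
  then have "card {x, p x, z, p z} = 4" by (simp add: card_insert_if)
  moreover have "{x, p x, z, p z} \<subseteq> ?V" using x z px pz by auto
  ultimately have "{x, p x, z, p z} = ?V" using c f by (intro card_subset_eq) auto
  then show ?thesis using that z(1) d by metis
qed

text \<open>The vertex \<open>v x\<close> gives up one passage and receives another, so it keeps
  four half-edges, and \<open>p\<close> still respects the names.\<close>

lemma wf_state_slide:
  assumes wf: "wf_state X m p v R" and x: "x \<in> X" "v x \<notin> R" and y: "y \<in> X" "v y \<in> R"
  shows "wf_state X m p (v(x := v y, p x := v y, y := v x, p y := v x)) R"
proof -
  note W = wf_stateD[OF wf] and P = pairingD[OF wf_stateD(3)[OF wf]]
  let ?v = "v(x := v y, p x := v y, y := v x, p y := v x)"
  have vpx: "v (p x) = v x" "v (p y) \<in> R" using W(4,5) x y by auto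
  have d: "distinct [x, p x, y, p y]" "p x \<in> X" "p y \<in> X"
    using P(1,2)[OF x(1)] P(1,2)[OF y(1)] x y vpx by auto
  have out: "p h \<notin> {x, p x, y, p y}" if "h \<in> X" "h \<notin> {x, p x, y, p y}" for h
    using that P x(1) y(1) by (metis insert_iff singletonD)
  have vs: "?v x = v y" "?v (p x) = v y" "?v y = v x" "?v (p y) = v x" using d by auto
  have vo: "?v h = v h" if "h \<notin> {x, p x, y, p y}" for h using that by simp
  have card: "card {h \<in> X. ?v h = w} = card {h \<in> X. v h = w}" if w: "w \<notin> R" for w
  proof (cases "w = v x")
    case True
    have "{h \<in> X. ?v h = w} = ({h \<in> X. v h = w} - {x, p x}) \<union> {y, p y}"
      using True d x y vpx vs vo w by (auto split: if_splits)
    moreover have "card ({h \<in> X. v h = w} - {x, p x}) = card {h \<in> X. v h = w} - card {x, p x}"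
      using True d x vpx W(1) by (intro card_Diff_subset) auto
    moreover have "({h \<in> X. v h = w} - {x, p x}) \<inter> {y, p y} = {}" using y vpx w by auto
    moreover have "card {h \<in> X. v h = w} = 4" using W(6)[OF x] True by simp
    moreover define A where "A = {h \<in> X. v h = w} - {x, p x}"
    ultimately have "{h \<in> X. ?v h = w} = A \<union> {y, p y}" "card A = 4 - card {x, p x}"
      "A \<inter> {y, p y} = {}" "card {h \<in> X. v h = w} = 4" by (simp_all only:)
    moreover have "finite A" using W(1) by (simp add: A_def)
    moreover have "card {x, p x} = 2" "card {y, p y} = 2" using d(1) by auto
    ultimately show ?thesis using card_Un_disjoint[of A "{y, p y}"] by simp
  next
    case False
    then have "{h \<in> X. ?v h = w} = {h \<in> X. v h = w}"
      using y vpx w by (auto split: if_splits)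
    then show ?thesis by simp
  qed
  show ?thesis unfolding wf_state_def
  proof (intro conjI ballI impI)
    fix h assume h: "h \<in> X"
    show "?v (p h) \<in> R \<longleftrightarrow> ?v h \<in> R"
    proof (cases "h \<in> {x, p x, y, p y}")
      case True
      then show ?thesis using vs x y P(3)[OF x(1)] P(3)[OF y(1)] by (elim insertE) simp_all
    next
      case False
      then show ?thesis using vo[OF False] vo[OF out[OF h False]] W(4)[OF h] by simp
    qed
    assume nR: "?v h \<notin> R"
    show "?v (p h) = ?v h"
    proof (cases "h \<in> {x, p x, y, p y}")
      case True
      then show ?thesis using vs P(3)[OF x(1)] P(3)[OF y(1)] by (elim insertE) simp_all
    next
      case False
      then show ?thesis using vo[OF False] vo[OF out[OF h False]] W(5)[OF h] nR by simp
    qed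
    show "card {k \<in> X. ?v k = ?v h} = 4"
    proof (cases "h \<in> {x, p x, y, p y}")
      case True
      then have "?v h = v x" using vs nR y(2) by auto
      then show ?thesis using card[OF nR] W(6)[OF x] by simp
    next
      case False
      then have "?v h = v h" by (rule vo)
      then show ?thesis using card[OF nR] W(6)[OF h] nR by simp
    qed
  qed (use W in auto)
qed

lemma wf_state_resolve:
  assumes "wf_state X m p v R" "R \<inter> S = {}" "j \<in> states X p v S"
  shows "wf_state X m (resolve X p v S j) v (R \<union> S)"
  unfolding wf_state_def
proof (intro conjI ballI impI)
  note W = wf_stateD[OF assms(1)] and Q = pairing_resolve[OF assms]
  show "finite X" "pairing X m" "pairing X (resolve X p v S j)" using W Q by auto
  fix x assume x: "x \<in> X"
  show "v (resolve X p v S j x) \<in> R \<union> S \<longleftrightarrow> v x \<in> R \<union> S"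
    using Q(2,3)[OF x] by (cases "v x \<in> R") auto
  assume "v x \<notin> R \<union> S"
  then show "v (resolve X p v S j x) = v x" "card {y \<in> X. v y = v x} = 4"
    using Q(3)[OF x] W(6)[OF x] by auto
qed

text \<open>
  Here \<open>{x, p x}\<close> and \<open>{y, p y}\<close> are consecutive passages on a circuit. As \<open>v y\<close> is resolved, the
  passage through \<open>v x\<close> may take place at either of them.
\<close>

lemma state_sum_slide_unsmoothed:
  assumes wf: "wf_state X m p v R" and SR: "R \<inter> S = {}"
    and x: "x \<in> X" "v x \<notin> R" "v x \<notin> S" and y: "y = m (p x)" "v y \<in> R"
  shows "state_sum X m p v R S =
      state_sum X m p (v(x := v y, p x := v y, y := v x, p y := v x)) R S"
proof -
  note W = wf_stateD[OF wf] and P = pairingD[OF wf_stateD(3)[OF wf]]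
    and M = pairingD[OF wf_stateD(2)[OF wf]]
  let ?v = "v(x := v y, p x := v y, y := v x, p y := v x)"
  have yX: "y \<in> X" using M P x y by auto
  note wf' = wf_state_slide[OF wf x(1,2) yX y(2)]
  have vpx: "v (p x) = v x" "v (p y) \<in> R" using W(4,5) x y yX by auto
  have d: "distinct [x, p x, y, p y]"
    using P(1,2)[OF x(1)] P(1,2)[OF yX] x y(2) vpx by auto
  have nS: "v y \<notin> S" "v (p y) \<notin> S" using y(2) vpx SR by auto
  have Sv: "?v h \<in> S \<longleftrightarrow> v h \<in> S" for h using nS x(3) vpx by auto
  have vS: "?v h = v h" if "v h \<in> S" for h using that nS x(3) vpx by auto
  have st: "states X p ?v S = states X p v S"
    unfolding states_def
  proof (intro Collect_cong all_cong1)
    fix j h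
    have "?v (j h) = ?v h \<longleftrightarrow> v (j h) = v h" if "v h \<in> S"
      using vS[of h] vS[of "j h"] Sv[of "j h"] that by metis
    then show "(if h \<in> X \<and> ?v h \<in> S then j h \<in> X \<and> ?v (j h) = ?v h \<and> j h \<noteq> h \<and> j h \<noteq> p h \<and>
        j (j h) = h else j h = h) =
      (if h \<in> X \<and> v h \<in> S then j h \<in> X \<and> v (j h) = v h \<and> j h \<noteq> h \<and> j h \<noteq> p h \<and> j (j h) = h else j h = h)"
      unfolding Sv by (simp only: cong: if_cong)
  qed
  have res: "resolve X p ?v S j = resolve X p v S j" for j
    unfolding resolve_def Sv ..
  have "state_value X m (resolve X p v S j) (label v (R \<union> S)) =
      state_value X m (resolve X p v S j) (label ?v (R \<union> S))"
    if j: "j \<in> states X p v S" for j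
  proof -
    have r: "resolve X p v S j x = p x" "resolve X p v S j y = p y"
      using x nS by (simp_all add: resolve_def)
    show ?thesis
    proof (rule state_value_slide[OF paired_resolve[OF wf SR j], of _ x y]; (unfold r)?)
      show "paired X m (resolve X p v S j) (label ?v (R \<union> S))"
        using paired_resolve[OF wf' SR, of j] j st res by simp
      show "label ?v (R \<union> S) = (label v (R \<union> S))
          (x := None, p x := None, y := label v (R \<union> S) x, p y := label v (R \<union> S) x)"
        using d x y by (auto simp: label_def fun_eq_iff)
      show "label v (R \<union> S) y = None" using y by (simp add: label_def)
    qed (use x y d in auto)
  qed
  then show ?thesis unfolding state_sum_def st res by (rule sum.cong[OF refl])
qed

text \<open>The new case is that \<open>v x\<close> is going to be smoothed. Expand both sides at
  this vertex; the edge between the two passages then joins resolved vertices, and contracting it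
  makes corresponding terms equal.\<close>

lemma state_sum_slide:
  assumes wf: "wf_state X m p v R" and SR: "R \<inter> S = {}"
    and x: "x \<in> X" "v x \<notin> R" and y: "y = m (p x)" "v y \<in> R"
  shows "state_sum X m p v R S =
      state_sum X m p (v(x := v y, p x := v y, y := v x, p y := v x)) R S"
proof (cases "v x \<in> S")
  case False
  then show ?thesis using state_sum_slide_unsmoothed assms by blast
next
  case True
  note W = wf_stateD[OF wf] and P = pairingD[OF wf_stateD(3)[OF wf]]
    and M = pairingD[OF wf_stateD(2)[OF wf]]
  define b where "b = v x"
  define S0 where "S0 = S - {b}"
  have S: "S = insert b S0" "b \<notin> S0" "b \<notin> R" using True x(2) by (auto simp: S0_def b_def)
  define v' where "v' = v(x := v y, p x := v y, y := v x, p y := v x)"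
  have yX: "y \<in> X" using M P x y by auto
  have wf': "wf_state X m p v' R" unfolding v'_def by (rule wf_state_slide[OF wf x yX y(2)])
  have vpx: "v (p x) = b" "v (p y) \<in> R" using W(4,5) x y yX by (auto simp: b_def)
  obtain z where z: "z \<in> X" "{h \<in> X. v h = v x} = {x, p x, z, p z}" "distinct [x, p x, z, p z]"
    using vertex_halves[OF wf x] by blast
  define x' y' z' where "x' = p x" and "y' = p y" and "z' = p z"
  note pd = x'_def[symmetric] y'_def[symmetric] z'_def[symmetric]
  have pp: "p x' = x" "p y' = y" "p z' = z" unfolding x'_def y'_def z'_def using P x yX z by auto
  have in': "x' \<in> X" "y' \<in> X" "z' \<in> X" unfolding x'_def y'_def z'_def using P x yX z by auto
  have H: "{h \<in> X. v h = b} = {x, x', z, z'}" using z(2) by (simp add: b_def pd)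
  have yb: "y \<notin> {h \<in> X. v h = b}" "y' \<notin> {h \<in> X. v h = b}"
    using y(2) vpx(2) S(3) by (auto simp: y'_def)
  have d: "distinct [x, x', z, z', y, y']"
    using z(3) yb P(2)[OF yX] unfolding H pd by auto
  have H': "{h \<in> X. v' h = b} = {y, y', z, z'}"
  proof -
    have "v' h = b \<longleftrightarrow> h \<in> {y, y', z, z'}" if h: "h \<in> X" for h
    proof -
      have "v h = b \<longleftrightarrow> h \<in> {x, x', z, z'}" using H h by blast
      then show ?thesis using d y(2) S(3) unfolding v'_def pd by (auto simp: b_def)
    qed
    then show ?thesis using yX in' z(1) by blast
  qed
  let ?R = "insert b R"
  have SR0: "?R \<inter> S0 = {}" using SR S by auto
  have mx: "m x' = y" using y by (simp add: x'_def)
  have Z1: "state_sum X m p v R S = state_sum X m (smooth_pairing p x z) v ?R S0 +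
      state_sum X m (smooth_pairing p x z') v ?R S0"
    using state_sum_split[OF wf _ S(3,2) x(1) z(1)] H z(3) unfolding S(1) by (simp add: b_def pd)
  have pw: "{w, p w} = {z, z'} \<and> distinct [w, p w]" if "w = z \<or> w = z'" for w
    using that
  proof
    assume "w = z"
    then show ?thesis using d by (simp add: pd)
  next
    assume "w = z'"
    then show ?thesis using d pp(3) by (auto simp: insert_commute)
  qed
  have pw': "{s, t, w, p w} = {s, t, z, z'}" "distinct [s, t, z, z'] \<Longrightarrow> distinct [s, t, w, p w]"
    if "w = z \<or> w = z'" for w s t
    using pw[OF that] by (metis insert_is_Un sup_assoc) (use pw[OF that] in auto)
  have wz: "wf_state X m (smooth_pairing p x w) v ?R" if "w = z \<or> w = z'" for w
  proof (rule wf_state_smooth[OF wf _ S(3) x(1)])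
    show "v x = b" by (simp add: b_def)
    show "w \<in> X" using that z(1) in' by auto
    show "{h \<in> X. v h = b} = {x, p x, w, p w}" unfolding pw'(1)[OF that] H pd ..
    show "distinct [x, p x, w, p w]" by (rule pw'(2)[OF that]) (use d in \<open>auto simp: pd\<close>)
  qed
  have Z2: "state_sum X m p v' R S = state_sum X m (smooth_pairing p y z) v' ?R S0 +
      state_sum X m (smooth_pairing p y z') v' ?R S0"
  proof -
    have "v' y = b" using d by (simp add: v'_def pd b_def)
    moreover have "{h \<in> X. v' h = b} = {y, p y, z, p z}" "distinct [y, p y, z, p z]"
      using H' d by (simp_all add: pd) auto
    ultimately show ?thesis using state_sum_split[OF wf' _ S(3,2) yX z(1)] unfolding S(1)
      by (simp add: pd)
  qed
  have wz': "wf_state X m (smooth_pairing p y w) v' ?R" if "w = z \<or> w = z'" for w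
  proof (rule wf_state_smooth[OF wf' _ S(3) yX])
    show "v' y = b" using d by (simp add: v'_def pd b_def)
    show "w \<in> X" using that z(1) in' by auto
    show "{h \<in> X. v' h = b} = {y, p y, w, p w}" unfolding pw'(1)[OF that] H' pd ..
    show "distinct [y, p y, w, p w]" by (rule pw'(2)[OF that]) (use d in \<open>auto simp: pd\<close>)
  qed
  have vR: "v x' \<in> ?R" "v y \<in> ?R" "v' x' \<in> ?R" "v' y \<in> ?R"
    using vpx y(2) d by (auto simp: v'_def pd b_def)
  have vv': "v h = v' h \<or> v h \<in> ?R \<and> v' h \<in> ?R" for h
  proof (cases "h \<in> {x, x', y, y'}")
    case True
    then have "v h \<in> ?R" using vpx y(2) by (auto simp: pd b_def)
    moreover have "v' h \<in> ?R" using True d y(2) by (auto simp: v'_def pd b_def)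
    ultimately show ?thesis by blast
  next
    case False
    then show ?thesis by (simp add: v'_def pd)
  qed
  \<comment> \<open>\<open>w\<close> is the half-edge of the other passage that is joined to
    \<open>x\<close> on the left and to \<open>y\<close> on the right. After contraction of
    \<open>{x', y}\<close>, both pairings join \<open>x\<close> to \<open>w\<close> and
    \<open>y'\<close> to \<open>p w\<close>.\<close>
  have eq: "state_sum X m (smooth_pairing p x w) v ?R S0 =
      state_sum X m (smooth_pairing p y w) v' ?R S0"
    if w: "w = z \<or> w = z'" for w
  proof -
    let ?q = "smooth_pairing p x w" and ?q' = "smooth_pairing p y w"
    let ?p1 = "?q(?q x' := ?q y, ?q y := ?q x')" and ?p2 = "?q'(?q' x' := ?q' y, ?q' y := ?q' x')"
    define w' where "w' = p w"
    have w': "p w' = w" "distinct [x, x', w, w', y, y']"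
    proof -
      show "p w' = w" using w by (elim disjE) (simp_all add: w'_def pd pp)
      have "distinct [x, x', w, w']" "distinct [y, y', w, w']" "distinct [x, x', y, y']"
        using pw'(2)[OF w, of x x'] pw'(2)[OF w, of y y'] d by (auto simp: w'_def)
      then show "distinct [x, x', w, w', y, y']" by auto
    qed
    have q: "?q x' = w'" "?q y = y'" "?q' x' = x" "?q' y = w" "?q x = w" "?q w = x" "?q w' = x'"
      "?q y' = y"
      "?q' x = x'" "?q' w = y" "?q' w' = y'" "?q' y' = w'"
      using w' pp by (auto simp: smooth_pairing_def pd w'_def[symmetric])
    have qo: "?q h = p h" "?q' h = p h" if "h \<notin> {x, x', w, w', y, y'}" for h
      using that by (auto simp: smooth_pairing_def pd w'_def[symmetric])
    have 1: "state_sum X m ?q v ?R S0 = state_sum (X - {x', y}) m ?p1 v ?R S0"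
      by (rule state_sum_contract[OF wz[OF w] in'(1) mx[symmetric] _ vR(1,2) SR0]) (use q w' in auto)
    have w1: "wf_state (X - {x', y}) m ?p1 v ?R"
      by (rule wf_state_contract[OF wz[OF w] in'(1) mx[symmetric] _ vR(1,2)]) (use q w' in auto)
    have 2: "state_sum X m ?q' v' ?R S0 = state_sum (X - {x', y}) m ?p2 v' ?R S0"
      by (rule state_sum_contract[OF wz'[OF w] in'(1) mx[symmetric] _ vR(3,4) SR0]) (use q w' in auto)
    have w2: "wf_state (X - {x', y}) m ?p2 v' ?R"
      by (rule wf_state_contract[OF wz'[OF w] in'(1) mx[symmetric] _ vR(3,4)]) (use q w' in auto)
    have "?p1 h = ?p2 h" if "h \<in> X - {x', y}" for h
    proof (cases "h \<in> {x, w, w', y'}")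
      case True
      then show ?thesis using w'(2) by (elim insertE) (auto simp: q)
    next
      case False
      then show ?thesis using that qo[of h] by (simp add: q)
    qed
    then have "state_sum (X - {x', y}) m ?p1 v ?R S0 = state_sum (X - {x', y}) m ?p2 v' ?R S0"
      using vv' by (intro state_sum_cong[OF w1 w2 SR0]) blast+
    then show ?thesis using 1 2 by simp
  qed
  show ?thesis using Z1 Z2 eq by (simp add: v'_def)
qed

section \<open>Loops, bigons and triangles\<close>

text \<open>As \<open>q\<close> joins \<open>h\<close> to \<open>h'\<close>, the half-edges
  \<open>y\<close>, \<open>k\<close>, \<open>h\<close>, \<open>h'\<close>, \<open>k'\<close>,
  \<open>y'\<close> form a path in this order; contracting its two edges joins \<open>y\<close> to
  \<open>y'\<close>.\<close>

lemma state_sum_contract_path: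
  assumes wf: "wf_state X m q v R" and SR: "R \<inter> S = {}"
    and h: "h \<in> X" "k = m h" "h' \<in> X" "k' = m h'" "distinct [h, k, h', k', y, y']"
    and v: "v h \<in> R" "v k \<in> R" "v h' \<in> R" "v k' \<in> R"
    and q: "q h = h'" "q k = y" "q k' = y'"
    and t: "\<forall>z\<in>X - {h, k, h', k', y, y'}. t z = q z" "t y = y'" "t y' = y"
  shows "wf_state (X - {h, k, h', k'}) m t v R"
    and "state_sum X m q v R S = state_sum (X - {h, k, h', k'}) m t v R S"
proof -
  have d: "h \<noteq> k" "h \<noteq> h'" "h \<noteq> k'" "k \<noteq> h'" "k \<noteq> k'" "h' \<noteq> k'" "y \<notin> {h, k, h', k'}"
    "y' \<notin> {h, k, h', k'}" "y \<noteq> y'"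
    using h(5) by auto
  let ?q1 = "q(q h := q k, q k := q h)" and ?X1 = "X - {h, k}"
  have c1: "q h \<noteq> k" using q d by simp
  have w1: "wf_state ?X1 m ?q1 v R" using wf_state_contract[OF wf h(1,2) c1 v(1,2)] .
  have Z1: "state_sum X m q v R S = state_sum ?X1 m ?q1 v R S"
    using state_sum_contract[OF wf h(1,2) c1 v(1,2) SR] .
  have q1: "?q1 h' = y" "?q1 k' = y'" using q d by auto
  have h'1: "h' \<in> ?X1" using h(3) d by auto
  have c2: "?q1 h' \<noteq> k'" using q1(1) d(7) by simp
  let ?q2 = "?q1(?q1 h' := ?q1 k', ?q1 k' := ?q1 h')" and ?X2 = "?X1 - {h', k'}"
  have w2: "wf_state ?X2 m ?q2 v R" using wf_state_contract[OF w1 h'1 h(4) c2 v(3,4)] .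
  have Z2: "state_sum ?X1 m ?q1 v R S = state_sum ?X2 m ?q2 v R S"
    using state_sum_contract[OF w1 h'1 h(4) c2 v(3,4) SR] .
  have X2: "?X2 = X - {h, k, h', k'}" by auto
  have "?q2 z = t z" if z: "z \<in> X - {h, k, h', k'}" for z
  proof -
    consider "z = y" | "z = y'" | "z \<in> X - {h, k, h', k', y, y'}" using z by auto
    then show ?thesis
    proof cases
      case 3
      then have "?q1 z = q z" "z \<noteq> y" "z \<noteq> y'" using q by auto
      then show ?thesis using 3 t(1) q1 by simp
    qed (use q1 t d in auto)
  qed
  then have e: "\<forall>z\<in>X - {h, k, h', k'}. ?q2 z = t z" by blast
  show w3: "wf_state (X - {h, k, h', k'}) m t v R"
    by (rule wf_state_cong[OF w2[unfolded X2] e]) blast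
  show "state_sum X m q v R S = state_sum (X - {h, k, h', k'}) m t v R S"
    unfolding Z1 Z2 X2 by (rule state_sum_cong[OF w2[unfolded X2] w3 SR e]) blast
qed

text \<open>\<open>q\<close> makes no connection between the two edges, so each contraction joins
  only the outer partners of its own edge.\<close>

lemma state_sum_contract_parallel:
  assumes wf: "wf_state X m q v R" and SR: "R \<inter> S = {}"
    and h: "h \<in> X" "k = m h" "h' \<in> X" "k' = m h'" "distinct [h, k, h', k', x, y, x', y']"
    and v: "v h \<in> R" "v k \<in> R" "v h' \<in> R" "v k' \<in> R"
    and q: "q h = x" "q k = y" "q h' = x'" "q k' = y'"
    and t: "\<forall>z\<in>X - {h, k, h', k', x, y, x', y'}. t z = q z" "t x = y" "t y = x" "t x' = y'"
      "t y' = x'"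
  shows "state_sum X m q v R S = state_sum (X - {h, k, h', k'}) m t v R S"
    and "wf_state (X - {h, k, h', k'}) m t v R"
proof -
  have d: "h \<noteq> k" "h \<noteq> h'" "h \<noteq> k'" "k \<noteq> h'" "k \<noteq> k'" "h' \<noteq> k'" "x \<notin> {h, k, h', k', y, x', y'}"
    "y \<notin> {h, k, h', k', x', y'}" "x' \<notin> {h, k, h', k', y'}" "y' \<notin> {h, k, h', k'}"
    using h(5) by auto
  let ?q1 = "q(q h := q k, q k := q h)" and ?X1 = "X - {h, k}"
  have c1: "q h \<noteq> k" using q d by simp
  have w1: "wf_state ?X1 m ?q1 v R" using wf_state_contract[OF wf h(1,2) c1 v(1,2)] .
  have Z1: "state_sum X m q v R S = state_sum ?X1 m ?q1 v R S"
    using state_sum_contract[OF wf h(1,2) c1 v(1,2) SR] .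
  have q1: "?q1 h' = x'" "?q1 k' = y'" using q d by auto
  have h'1: "h' \<in> ?X1" using h(3) d by auto
  have c2: "?q1 h' \<noteq> k'" using q1(1) d(9) by simp
  let ?q2 = "?q1(?q1 h' := ?q1 k', ?q1 k' := ?q1 h')" and ?X2 = "?X1 - {h', k'}"
  have w2: "wf_state ?X2 m ?q2 v R" using wf_state_contract[OF w1 h'1 h(4) c2 v(3,4)] .
  have Z2: "state_sum ?X1 m ?q1 v R S = state_sum ?X2 m ?q2 v R S"
    using state_sum_contract[OF w1 h'1 h(4) c2 v(3,4) SR] .
  have X2: "?X2 = X - {h, k, h', k'}" by auto
  have "?q2 z = t z" if z: "z \<in> X - {h, k, h', k'}" for z
  proof -
    consider "z \<in> {x, y, x', y'}" | "z \<in> X - {h, k, h', k', x, y, x', y'}" using z by auto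
    then show ?thesis
    proof cases
      case 1
      have "x \<noteq> x'" "x \<noteq> y'" "y \<noteq> x'" "y \<noteq> y'" "x' \<noteq> y'" "x \<noteq> y" using d by auto
      moreover have "?q1 x = y" "?q1 y = x" unfolding q using \<open>x \<noteq> y\<close> by simp_all
      ultimately have "?q2 x = y" "?q2 y = x" "?q2 x' = y'" "?q2 y' = x'"
        unfolding q1 by (simp_all only: fun_upd_other fun_upd_same not_False_eq_True)
      then show ?thesis using 1 t(2-5) by (elim insertE) simp_all
    next
      case 2
      then have "?q1 z = q z" "z \<noteq> x'" "z \<noteq> y'" using q by auto
      then show ?thesis using 2 t(1) q1 by simp
    qed
  qed
  then have e: "\<forall>z\<in>X - {h, k, h', k'}. ?q2 z = t z" by blast
  show w3: "wf_state (X - {h, k, h', k'}) m t v R"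
    by (rule wf_state_cong[OF w2[unfolded X2] e]) blast
  show "state_sum X m q v R S = state_sum (X - {h, k, h', k'}) m t v R S"
    unfolding Z1 Z2 X2 by (rule state_sum_cong[OF w2[unfolded X2] w3 SR e]) blast
qed

text \<open>Here the coefficients enter: equal terms of a bigon cancel in characteristic
  two.\<close>

lemma add_self_bit: "(x :: 'a \<Rightarrow>\<^sub>0 bit) + x = 0"
  by (rule poly_mapping_eqI) (simp add: lookup_add)

text \<open>The smoothing joining \<open>h\<close> to \<open>k\<close> splits the loop off as a
  circle. The other one, after contraction of the loop edge, joins \<open>p h\<close> to
  \<open>p k\<close>, and so does the straight passage.\<close>

lemma state_sum_loop:
  assumes wf: "wf_state X m p v R" and SR: "R \<inter> S = {}"
    and a: "v h = a" "a \<notin> R" "a \<notin> S" and h: "h \<in> X" "k = m h"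
    and H: "{z \<in> X. v z = a} = {h, p h, k, p k}" "distinct [h, p h, k, p k]"
  shows "state_sum X m p v R (insert a S) = state_sum X m p v (insert a R) S"
proof -
  note P = pairingD[OF wf_stateD(3)[OF wf]] and M = pairingD[OF wf_stateD(2)[OF wf]]
  define h' k' where "h' = p h" and "k' = p k"
  note pd = h'_def[symmetric] k'_def[symmetric]
  have k: "k \<in> X" using h M by auto
  have pp: "p h' = h" "p k' = k" unfolding h'_def k'_def using P h k by auto
  have d: "distinct [h, h', k, k']" using H(2) by (simp add: pd)
  let ?R = "insert a R"
  have SR': "?R \<inter> S = {}" using SR a by auto
  have va: "v k = a" using H(1) by auto
  have vR: "v h \<in> ?R" "v k \<in> ?R" using a va by auto
  let ?A = "smooth_pairing p h k" and ?B = "smooth_pairing p h k'"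
  have split: "state_sum X m p v R (insert a S) = state_sum X m ?A v ?R S + state_sum X m ?B v ?R S"
    using state_sum_split[OF wf a h(1) k H] by (simp add: pd)
  have "state_sum X m ?A v ?R S = 0"
  proof (rule state_sum_circle[of "{h, k}"])
    show "{h, k} \<noteq> X" using d P(1)[OF h(1)] by (auto simp: pd)
    show "m ` {h, k} \<subseteq> {h, k}" using h M by auto
    show "?A ` {h, k} \<subseteq> {h, k}" using d by (auto simp: smooth_pairing_def pd)
  qed (use h k vR SR' in auto)
  moreover have wB: "wf_state X m ?B v ?R"
  proof (rule wf_state_smooth[OF wf a(1,2) h(1)])
    show "k' \<in> X" using k P by (simp add: k'_def)
    show "{z \<in> X. v z = a} = {h, p h, k', p k'}" using H(1) pp by (simp add: pd insert_commute)
    show "distinct [h, p h, k', p k']" using d pp by (auto simp: pd)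
  qed
  have ws: "wf_state X m p v ?R" by (rule wf_state_forget[OF wf]) blast
  have B: "?B h = k'" "?B k = h'" "?B h' = k" "?B k' = h"
    using d pp by (auto simp: smooth_pairing_def pd)
  have Bo: "?B z = p z" if "z \<notin> {h, h', k, k'}" for z
    using that pp by (auto simp: smooth_pairing_def pd)
  have cB: "?B h \<noteq> k" "p h \<noteq> k" using B d by (auto simp: pd)
  have "state_sum X m ?B v ?R S = state_sum X m p v ?R S"
    unfolding state_sum_contract[OF wB h cB(1) vR SR'] state_sum_contract[OF ws h cB(2) vR SR']
  proof (rule state_sum_cong[OF wf_state_contract[OF wB h cB(1) vR] wf_state_contract[OF ws h cB(2) vR] SR'])
    show "\<forall>x\<in>X - {h, k}. (?B(?B h := ?B k, ?B k := ?B h)) x = (p(p h := p k, p k := p h)) x"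
    proof
      fix z assume "z \<in> X - {h, k}"
      then show "(?B(?B h := ?B k, ?B k := ?B h)) z = (p(p h := p k, p k := p h)) z"
        unfolding B pd using Bo[of z] d by auto
    qed
  qed blast
  ultimately show ?thesis using split by simp
qed

text \<open>The edges \<open>{ea, eb}\<close> and \<open>{fa, fb}\<close> bound the bigon; in the
  proof, capital letters denote the opposite half-edges, which lead out of it. The four terms are
  indexed by the partners of \<open>ea\<close> and \<open>eb\<close>.\<close>

lemma state_sum_bigon_smoothed:
  assumes wf: "wf_state X m p v R" and SR: "R \<inter> S = {}"
    and ab: "a \<noteq> b" "a \<notin> R" "b \<notin> R" "a \<notin> S" "b \<notin> S"
    and e: "ea \<in> X" "eb = m ea" "fa \<in> X" "fb = m fa"
    and Ha: "{h \<in> X. v h = a} = {ea, p ea, fa, p fa}" "distinct [ea, p ea, fa, p fa]"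
    and Hb: "{h \<in> X. v h = b} = {eb, p eb, fb, p fb}" "distinct [eb, p eb, fb, p fb]"
  shows "state_sum X m p v R (insert a (insert b S)) = state_sum X m p v (insert a (insert b R)) S"
proof -
  note P = pairingD[OF wf_stateD(3)[OF wf]] and M = pairingD[OF wf_stateD(2)[OF wf]]
  define Ea Fa Eb Fb where "Ea = p ea" and "Fa = p fa" and "Eb = p eb" and "Fb = p fb"
  note pd = Ea_def[symmetric] Fa_def[symmetric] Eb_def[symmetric] Fb_def[symmetric]
  have eX: "eb \<in> X" "fb \<in> X" "Ea \<in> X" "Eb \<in> X" "Fa \<in> X" "Fb \<in> X"
    unfolding Ea_def Fa_def Eb_def Fb_def using e M P by auto
  have pp: "p Ea = ea" "p Fa = fa" "p Eb = eb" "p Fb = fb"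
    unfolding Ea_def Fa_def Eb_def Fb_def using e eX P by auto
  have mm: "m eb = ea" "m fb = fa" using e M by auto
  note Ha' = Ha[unfolded pd] and Hb' = Hb[unfolded pd]
  have va: "v ea = a" "v fa = a" "v Ea = a" "v Fa = a" using Ha'(1) by blast+
  have vb: "v eb = b" "v fb = b" "v Eb = b" "v Fb = b" using Hb'(1) by blast+
  have dab: "s \<noteq> t" if "v s = a" "v t = b" for s t using that ab(1) by auto
  have d: "distinct [ea, eb, fa, fb, Ea, Eb, Fa, Fb]"
    using Ha'(2) Hb'(2) dab[OF va(1) vb(1)] dab[OF va(1) vb(2)] dab[OF va(1) vb(3)] dab[OF va(1) vb(4)]
      dab[OF va(2) vb(1)] dab[OF va(2) vb(2)] dab[OF va(2) vb(3)] dab[OF va(2) vb(4)]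
      dab[OF va(3) vb(1)] dab[OF va(3) vb(2)] dab[OF va(3) vb(3)] dab[OF va(3) vb(4)]
      dab[OF va(4) vb(1)] dab[OF va(4) vb(2)] dab[OF va(4) vb(3)] dab[OF va(4) vb(4)]
    by auto
  let ?Ra = "insert a R" and ?R = "insert b (insert a R)"
  have SR': "?R \<inter> S = {}" using SR ab by auto
  have vR: "v ea \<in> ?R" "v eb \<in> ?R" "v fa \<in> ?R" "v fb \<in> ?R" using va vb by auto
  let ?A = "\<lambda>w. smooth_pairing p ea w" and ?AB = "\<lambda>w u. smooth_pairing (smooth_pairing p ea w) eb u"
  have Haw: "{h \<in> X. v h = a} = {ea, p ea, w, p w}" "distinct [ea, p ea, w, p w]" "w \<in> X"
    if "w = fa \<or> w = Fa" for w
    using that Ha' pp e eX by (elim disjE; auto simp: pd)+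
  have wA: "wf_state X m (?A w) v ?Ra" if "w = fa \<or> w = Fa" for w
    using wf_state_smooth[OF wf va(1) ab(2) e(1) Haw(3)[OF that] Haw(1,2)[OF that]] .
  have Ab: "?A w eb = Eb" "?A w Eb = eb" "?A w fb = Fb" "?A w Fb = fb" if w: "w = fa \<or> w = Fa" for w
    using w d pp by (elim disjE; simp add: smooth_pairing_def pd; blast?)+
  have Hbw: "{h \<in> X. v h = b} = {eb, ?A w eb, u, ?A w u}" "distinct [eb, ?A w eb, u, ?A w u]"
    "u \<in> X"
    if w: "w = fa \<or> w = Fa" and u: "u = fb \<or> u = Fb" for w u
    using u Hb' eX by (elim disjE; auto simp: Ab[OF w])+
  have nb: "b \<notin> ?Ra" using ab by auto
  have wAB: "wf_state X m (?AB w u) v ?R" if w: "w = fa \<or> w = Fa" and u: "u = fb \<or> u = Fb" for w u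
    using wf_state_smooth[OF wA[OF w] vb(1) nb eX(1) Hbw(3)[OF w u] Hbw(1,2)[OF w u]] .
  have split: "state_sum X m (?A w) v ?Ra (insert b S) = state_sum X m (?AB w fb) v ?R S +
      state_sum X m (?AB w Fb) v ?R S"
    if w: "w = fa \<or> w = Fa" for w
    using state_sum_split[OF wA[OF w] vb(1) nb ab(5) eX(1,2) Hbw(1,2)[OF w]] by (simp add: Ab[OF w])
  have "state_sum X m p v R (insert a (insert b S)) = state_sum X m (?A fa) v ?Ra (insert b S) +
      state_sum X m (?A Fa) v ?Ra (insert b S)"
    using state_sum_split[OF wf va(1) ab(2) _ e(1,3) Ha, of "insert b S"] ab by (simp add: pd)
  then have sum4: "state_sum X m p v R (insert a (insert b S)) =
      state_sum X m (?AB fa fb) v ?R S + state_sum X m (?AB fa Fb) v ?R S + (state_sum X m (?AB Fa fb) v ?R S + state_sum X m (?AB Fa Fb) v ?R S)"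
    by (simp add: split)
  have o: "?AB w u z = p z" if "w = fa \<or> w = Fa" "u = fb \<or> u = Fb"
    "z \<notin> {ea, eb, fa, fb, Ea, Eb, Fa, Fb}" for w u z
    using that pp by (elim disjE) (simp_all add: smooth_pairing_def pd)
  have v11: "?AB fa fb ea = fa" "?AB fa fb fa = ea" "?AB fa fb eb = fb" "?AB fa fb fb = eb"
    using d by (auto simp: smooth_pairing_def pd)
  have v12: "?AB fa Fb ea = fa" "?AB fa Fb fa = ea" "?AB fa Fb Ea = Fa" "?AB fa Fb Fa = Ea"
    "?AB fa Fb eb = Fb" "?AB fa Fb Fb = eb" "?AB fa Fb Eb = fb" "?AB fa Fb fb = Eb"
    using d pp by (auto simp: smooth_pairing_def pd)
  have v21: "?AB Fa fb ea = Fa" "?AB Fa fb Fa = ea" "?AB Fa fb Ea = fa" "?AB Fa fb fa = Ea"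
    "?AB Fa fb eb = fb" "?AB Fa fb fb = eb" "?AB Fa fb Eb = Fb" "?AB Fa fb Fb = Eb"
    using d pp by (auto simp: smooth_pairing_def pd)
  have v22: "?AB Fa Fb ea = Fa" "?AB Fa Fb Fa = ea" "?AB Fa Fb Ea = fa" "?AB Fa Fb fa = Ea"
    "?AB Fa Fb eb = Fb" "?AB Fa Fb Fb = eb" "?AB Fa Fb Eb = fb" "?AB Fa Fb fb = Eb"
    using d pp by (auto simp: smooth_pairing_def pd)
  \<comment> \<open>Partners \<open>fa\<close> and \<open>fb\<close>: the boundary of the bigon
    closes up to a circle.\<close>
  have Z11: "state_sum X m (?AB fa fb) v ?R S = 0"
  proof (rule state_sum_circle[of "{ea, eb, fa, fb}"])
    show "{ea, eb, fa, fb} \<noteq> X" using d eX(3) by auto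
    show "m ` {ea, eb, fa, fb} \<subseteq> {ea, eb, fa, fb}" using e mm by auto
    show "?AB fa fb ` {ea, eb, fa, fb} \<subseteq> {ea, eb, fa, fb}" by (simp add: v11)
    show "v ` {ea, eb, fa, fb} \<subseteq> ?R" using vR by auto
  qed (use e eX SR' in auto)
  \<comment> \<open>The mixed choices: one outer pair is joined directly, the other along the
    boundary of the bigon. Both times \<open>Ea\<close> meets \<open>Fa\<close> and
    \<open>Eb\<close> meets \<open>Fb\<close>.\<close>
  define t1 where "t1 = p(Ea := Fa, Fa := Ea, Eb := Fb, Fb := Eb)"
  have t1: "t1 Ea = Fa" "t1 Fa = Ea" "t1 Eb = Fb" "t1 Fb = Eb" "t1 z = p z" if
    "z \<notin> {Ea, Eb, Fa, Fb}" for z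
    using that d by (auto simp: t1_def)
  have t1': "t1 Ea = Fa" "t1 Fa = Ea" "t1 Eb = Fb" "t1 Fb = Eb" using d by (auto simp: t1_def)
  have Z12: "state_sum X m (?AB fa Fb) v ?R S = state_sum (X - {ea, eb, fa, fb}) m t1 v ?R S"
  proof (rule state_sum_contract_path(2)[OF wAB SR' e(1,2,3,4), where y = Fb and y' = Eb])
    show "\<forall>z\<in>X - {ea, eb, fa, fb, Fb, Eb}. t1 z = ?AB fa Fb z"
    proof
      fix z assume "z \<in> X - {ea, eb, fa, fb, Fb, Eb}"
      then show "t1 z = ?AB fa Fb z" using o[of fa Fb z] t1(5)[of z] t1' v12
        by (cases "z \<in> {Ea, Fa}") auto
    qed
    show "distinct [ea, eb, fa, fb, Fb, Eb]" using d by auto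
  qed (simp_all add: va vb v12 t1')
  have Z21: "state_sum X m (?AB Fa fb) v ?R S = state_sum (X - {eb, ea, fb, fa}) m t1 v ?R S"
  proof (rule state_sum_contract_path(2)[OF wAB SR' eX(1) _ eX(2), where y = Fa and y' = Ea])
    show "\<forall>z\<in>X - {eb, ea, fb, fa, Fa, Ea}. t1 z = ?AB Fa fb z"
    proof
      fix z assume "z \<in> X - {eb, ea, fb, fa, Fa, Ea}"
      then show "t1 z = ?AB Fa fb z" using o[of Fa fb z] t1(5)[of z] t1' v21
        by (cases "z \<in> {Eb, Fb}") auto
    qed
    show "distinct [eb, ea, fb, fa, Fa, Ea]" using d by auto
  qed (simp_all add: va vb v21 t1' mm)
  have "{ea, eb, fa, fb} = {eb, ea, fb, fa}" by auto
  then have cancel: "state_sum X m (?AB fa Fb) v ?R S + state_sum X m (?AB Fa fb) v ?R S = 0"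
    unfolding Z12 Z21 using add_self_bit by simp
  \<comment> \<open>Partners \<open>Fa\<close> and \<open>Fb\<close>: each boundary edge connects an
    outer half-edge of \<open>a\<close> with one of \<open>b\<close>. The straight passages produce
    the same two joins, only along exchanged boundary edges.\<close>
  define t2 where "t2 = p(Ea := Eb, Eb := Ea, Fa := Fb, Fb := Fa)"
  have t2: "t2 Ea = Eb" "t2 Eb = Ea" "t2 Fa = Fb" "t2 Fb = Fa" using d by (auto simp: t2_def)
  have t2o: "t2 z = p z" if "z \<notin> {Ea, Eb, Fa, Fb}" for z using that by (auto simp: t2_def)
  have Z22: "state_sum X m (?AB Fa Fb) v ?R S = state_sum (X - {ea, eb, fa, fb}) m t2 v ?R S"
  proof (rule state_sum_contract_parallel(1)[OF wAB SR' e(1,2,3,4), where x = Fa and y = Fb and x' = Ea and y' = Eb])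
    show "\<forall>z\<in>X - {ea, eb, fa, fb, Fa, Fb, Ea, Eb}. t2 z = ?AB Fa Fb z"
    proof
      fix z assume "z \<in> X - {ea, eb, fa, fb, Fa, Fb, Ea, Eb}"
      then show "t2 z = ?AB Fa Fb z" using o[of Fa Fb z] t2o[of z] by simp
    qed
    show "distinct [ea, eb, fa, fb, Fa, Fb, Ea, Eb]" using d by auto
  qed (simp_all add: va vb v22 t2)
  have ws: "wf_state X m p v ?R" by (rule wf_state_forget[OF wf]) blast
  have Zs: "state_sum X m p v ?R S = state_sum (X - {ea, eb, fa, fb}) m t2 v ?R S"
  proof (rule state_sum_contract_parallel(1)[OF ws SR' e(1,2,3,4), where x = Ea and y = Eb and x' = Fa and y' = Fb])
    show "\<forall>z\<in>X - {ea, eb, fa, fb, Ea, Eb, Fa, Fb}. t2 z = p z" using t2o by auto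
    show "distinct [ea, eb, fa, fb, Ea, Eb, Fa, Fb]" using d by auto
  qed (simp_all add: va vb t2 pd)
  have "state_sum X m p v R (insert a (insert b S)) = state_sum X m p v ?R S"
    unfolding sum4 Z11 Zs Z22[symmetric] using cancel by (simp add: add.assoc[symmetric])
  then show ?thesis by (simp add: insert_commute)
qed

text \<open>The passages at the ends of a bigon edge are consecutive on the circuit, so erasing
  \<open>a\<close> and \<open>b\<close> from the word undoes a second move between the graphs
  realising the two words. This is what passing to classes modulo second moves is for.\<close>

lemma word_class_bigon:
  assumes wf: "wf_state X m q v Q" and t: "circuit X m q hs" and ab: "a \<noteq> b" "a \<notin> Q" "b \<notin> Q"
    and e: "ea \<in> X" "eb = m ea" "fa \<in> X" "fb = m fa"
    and Ha: "{h \<in> X. v h = a} = {ea, q ea, fa, q fa}" "distinct [ea, q ea, fa, q fa]"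
    and Hb: "{h \<in> X. v h = b} = {eb, q eb, fb, q fb}" "distinct [eb, q eb, fb, q fb]"
  shows "word_class (word (label v Q) hs) = word_class (word (label v (insert a (insert b Q))) hs)"
proof -
  note W = wf_stateD[OF wf] and M = pairingD[OF wf_stateD(2)[OF wf]]
  let ?L = "label v Q" and ?L' = "label v (insert a (insert b Q))"
  have va: "v ea = a" "v fa = a" "v (q ea) = a" "v (q fa) = a" using Ha(1) by blast+
  have vb: "v eb = b" "v fb = b" "v (q eb) = b" "v (q fb) = b" using Hb(1) by blast+
  have dab: "s \<noteq> t" if "v s = a" "v t = b" for s t using that ab(1) by auto
  have X: "X = set hs \<union> m ` set hs" using t by (auto simp: circuit_def)
  \<comment> \<open>\<open>c1\<close> and \<open>c2\<close> are the departures at the two ends of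
    the edge, in the direction in which the circuit traverses it.\<close>
  have start: "\<exists>c1 c2. c1 \<in> set hs \<and> c2 = q (m c1) \<and> {v c1, v c2} = {a, b} \<and>
      {ca, cb, q ca, q cb} = {c1, c2, m c1, q c1} \<and> c1 \<noteq> c2"
    if c: "ca \<in> X" "cb = m ca" "v ca = a" "v cb = b" "v (q ca) = a" "v (q cb) = b" for ca cb
  proof (cases "ca \<in> set hs")
    case True
    then show ?thesis using c ab(1) by (intro exI[of _ ca] exI[of _ "q cb"]) auto
  next
    case False
    then obtain w where w: "w \<in> set hs" "ca = m w" using X c(1) by auto
    then have "cb = w" using c(2) M(3)[of w] X by auto
    then show ?thesis using w c ab(1) by (intro exI[of _ cb] exI[of _ "q ca"]) auto
  qed
  obtain e1 e2 where e12: "e1 \<in> set hs" "e2 = q (m e1)" "{v e1, v e2} = {a, b}"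
      "{ea, eb, q ea, q eb} = {e1, e2, m e1, q e1}" "e1 \<noteq> e2"
    using start[OF e(1,2) va(1) vb(1) va(3) vb(3)] by blast
  obtain f1 f2 where f12: "f1 \<in> set hs" "f2 = q (m f1)" "{v f1, v f2} = {a, b}"
      "{fa, fb, q fa, q fb} = {f1, f2, m f1, q f1}" "f1 \<noteq> f2"
    using start[OF e(3,4) va(2) vb(2) va(4) vb(4)] by blast
  have "{ea, eb, q ea, q eb} \<inter> {fa, fb, q fa, q fb} = {}"
    using Ha(2) Hb(2) dab[OF va(1) vb(2)] dab[OF va(1) vb(4)] dab[OF va(3) vb(2)] dab[OF va(3) vb(4)]
      dab[OF va(2) vb(1)] dab[OF va(2) vb(3)] dab[OF va(4) vb(1)] dab[OF va(4) vb(3)] by auto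
  then have ef: "{e1, e2, m e1, q e1} \<inter> {f1, f2, m f1, q f1} = {}" unfolding e12(4) f12(4) .
  obtain ys where ys: "circuit X m q (e1 # ys)" "set (e1 # ys) = set hs"
    "\<And>L. word_class (word L hs) = word_class (word L (e1 # ys))"
    using circuit_start[OF t e12(1)] by blast
  obtain rest where rest: "ys = e2 # rest"
    using circuit_second[OF ys(1)] e12(2,5) by metis
  have "f1 \<in> set rest" using f12(1) ys(2) rest ef by auto
  then obtain us vs where uv: "rest = us @ f1 # vs" using split_list by metis
  have t1: "circuit X m q (f1 # vs @ e1 # e2 # us)"
    using circuit_append_commute[of X m q "e1 # e2 # us" "f1 # vs"] ys(1) rest uv by simp
  obtain zs where zs: "vs @ e1 # e2 # us = f2 # zs"
    using circuit_second[OF t1] f12(2,5) by metis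
  \<comment> \<open>Were \<open>f1\<close> the last entry, \<open>f2\<close> would be
    \<open>e1\<close>, which belongs to the other edge.\<close>
  have "vs \<noteq> []" using zs ef by auto
  then obtain ws where ws: "vs = f2 # ws" using zs by (cases vs) auto
  let ?ks = "[e1, e2] @ us @ [f1, f2] @ ws"
  have ks: "circuit X m q ?ks" "\<And>L. word_class (word L hs) = word_class (word L ?ks)"
    using ys(1,3) rest uv ws by simp_all
  have "distinct (?ks @ map m ?ks)" using ks(1) unfolding circuit_def by (elim conjE)
  then have dist: "distinct ?ks" unfolding distinct_append[of ?ks] by (elim conjE)
  note ex = circuit_excl[OF ks(1) W(2,3)]
  have other: "v z \<noteq> a \<and> v z \<noteq> b" if z: "z \<in> set us \<union> set ws" for z
  proof -
    have zk: "z \<in> set ?ks" using z by auto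
    then have zX: "z \<in> X" using ks(1) unfolding circuit_def by blast
    have "z \<notin> {e1, e2, f1, f2}" using z dist by auto
    moreover have "z \<notin> {m e1, q e1, m f1, q f1}" using ex[of e1] ex[of f1] zk by auto
    ultimately have "z \<notin> {ea, eb, q ea, q eb}" "z \<notin> {fa, fb, q fa, q fb}" unfolding e12(4) f12(4)
      by auto
    then have "z \<notin> {h \<in> X. v h = a}" "z \<notin> {h \<in> X. v h = b}" unfolding Ha(1) Hb(1) by auto
    then show ?thesis using zX by blast
  qed
  define U Ws where "U = word ?L us" and "Ws = word ?L ws"
  have U': "word ?L' us = U" "word ?L' ws = Ws"
  proof -
    have "?L' z = ?L z" if "z \<in> set us \<union> set ws" for z
      using other[OF that] by (simp add: label_def)
    then show "word ?L' us = U" "word ?L' ws = Ws"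
      unfolding U_def Ws_def by (intro map_filter_cong; blast)+
  qed
  have in': "v e1 \<in> {a, b}" "v e2 \<in> {a, b}" "v f1 \<in> {a, b}" "v f2 \<in> {a, b}"
    using e12(3) f12(3) by blast+
  then have nQ: "v e1 \<notin> Q" "v e2 \<notin> Q" "v f1 \<notin> Q" "v f2 \<notin> Q"
    using ab(2,3) by fastforce+
  have w: "word ?L ?ks = [v e1, v e2] @ U @ [v f1, v f2] @ Ws"
    using nQ by (simp add: map_filter_append label_def U_def Ws_def)
  have w': "word ?L' ?ks = U @ Ws"
  proof -
    have N: "?L' z = None" if "v z \<in> {a, b}" for z using that by (auto simp: label_def)
    show ?thesis
      using N[OF in'(1)] N[OF in'(2)] N[OF in'(3)] N[OF in'(4)] unfolding map_filter_append U'
        by simp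
  qed
  obtain G where G: "unicursal_graph G" "word ?L ?ks \<in> chord_diagram G"
    using realize[OF wf ks(1)] by blast
  have "wf_state X m q v (insert a (insert b Q))" by (rule wf_state_forget[OF wf]) blast
  then obtain H where H: "unicursal_graph H" "word ?L' ?ks \<in> chord_diagram H"
    using realize[OF _ ks(1)] by blast
  have "move2 (word ?L' ?ks) (word ?L ?ks)"
    unfolding w w' by (rule move2.intros[OF ab(1) e12(3) f12(3)])
  then have "related_by move2 H G" unfolding related_by_def using G H by blast
  then have "move2_class_of H = move2_class_of G" using move2_class_step G H by blast
  then show ?thesis unfolding ks(2) using word_class_eq[OF G] word_class_eq[OF H] by simp
qed

lemma state_sum_bigon_unsmoothed:
  assumes wf: "wf_state X m p v R" and SR: "R \<inter> S = {}"
    and ab: "a \<noteq> b" "a \<notin> R" "b \<notin> R" "a \<notin> S" "b \<notin> S"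
    and e: "ea \<in> X" "eb = m ea" "fa \<in> X" "fb = m fa"
    and Ha: "{h \<in> X. v h = a} = {ea, p ea, fa, p fa}" "distinct [ea, p ea, fa, p fa]"
    and Hb: "{h \<in> X. v h = b} = {eb, p eb, fb, p fb}" "distinct [eb, p eb, fb, p fb]"
  shows "state_sum X m p v R S = state_sum X m p v (insert a (insert b R)) S"
  unfolding state_sum_def
proof (rule sum.cong[OF refl])
  fix j assume j: "j \<in> states X p v S"
  let ?q = "resolve X p v S j" and ?R = "insert a (insert b R)"
  have va: "v ea = a" "v fa = a" using Ha(1) by blast+
  have vb: "v eb = b" "v fb = b" using Hb(1) by blast+
  have q: "?q ea = p ea" "?q fa = p fa" "?q eb = p eb" "?q fb = p fb"
    using va vb ab by (simp_all add: resolve_def)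
  have wf': "wf_state X m p v ?R" by (rule wf_state_forget[OF wf]) blast
  have SR': "?R \<inter> S = {}" using SR ab by auto
  show "state_value X m ?q (label v (R \<union> S)) = state_value X m ?q (label v (?R \<union> S))"
  proof (rule state_value_eqI[OF paired_resolve[OF wf SR j] paired_resolve[OF wf' SR' j]])
    fix hs assume t: "circuit X m ?q hs"
    have "word_class (word (label v (R \<union> S)) hs) =
        word_class (word (label v (insert a (insert b (R \<union> S)))) hs)"
      by (rule word_class_bigon[OF wf_state_resolve[OF wf SR j] t ab(1) _ _ e])
        (use ab Ha Hb in \<open>simp_all add: q\<close>)
    then show "\<exists>hs'. circuit X m ?q hs' \<and>
        word_class (word (label v (R \<union> S)) hs) = word_class (word (label v (?R \<union> S)) hs')"
      using t by auto
  qed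
qed

lemma state_sum_bigon:
  assumes wf: "wf_state X m p v R" and SR: "R \<inter> S = {}"
    and ab: "a \<noteq> b" "a \<notin> R" "b \<notin> R" "a \<in> S \<longleftrightarrow> b \<in> S"
    and e: "ea \<in> X" "eb = m ea" "fa \<in> X" "fb = m fa"
    and Ha: "{h \<in> X. v h = a} = {ea, p ea, fa, p fa}" "distinct [ea, p ea, fa, p fa]"
    and Hb: "{h \<in> X. v h = b} = {eb, p eb, fb, p fb}" "distinct [eb, p eb, fb, p fb]"
  shows "state_sum X m p v R S = state_sum X m p v (insert a (insert b R)) (S - {a, b})"
proof (cases "a \<in> S")
  case True
  let ?S = "S - {a, b}"
  have "S = insert a (insert b ?S)" using True ab(4) by auto
  moreover have "R \<inter> ?S = {}" "a \<notin> ?S" "b \<notin> ?S" using SR by auto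
  ultimately show ?thesis using state_sum_bigon_smoothed[OF wf _ ab(1-3) _ _ e Ha Hb, of ?S] by simp
next
  case False
  then have "S - {a, b} = S" using ab(4) by auto
  then show ?thesis using state_sum_bigon_unsmoothed[OF wf SR ab(1-3) _ _ e Ha Hb] False ab(4)
    by simp
qed

text \<open>Here straightened vertices are really removed and their edges merged along
  \<open>glue\<close>. Connectedness under \<open>p\<close> rules out a separate piece lying wholly
  at vertices of \<open>R\<close>, which would be lost with them.\<close>

lemma state_sum_delete:
  assumes wf: "wf_state X m p v R" and SR: "R \<inter> S = {}" and c: "conn X m p"
    and X': "X' = {x \<in> X. v x \<notin> R}" "pairing X' m'" "\<forall>x\<in>X'. (x, m' x) \<in> glue X m p X'"
  shows "state_sum X m p v R S = state_sum X' m' p v {} S"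
proof -
  note W = wf_stateD[OF wf]
  have sub: "X' \<subseteq> X" using X'(1) by auto
  have pX': "\<forall>x\<in>X. p x \<in> X' \<longleftrightarrow> x \<in> X'" using W(4) pairingD[OF W(3)] X'(1) by auto
  have wf': "wf_state X' m' p v {}" unfolding wf_state_def
  proof (intro conjI ballI impI)
    show "finite X'" using finite_subset[OF sub W(1)] .
    show "pairing X' p" using pX' pairingD[OF W(3)] sub unfolding pairing_def by blast
    fix x assume x: "x \<in> X'"
    then show "v (p x) = v x" using W(5) X'(1) by auto
    have "{y \<in> X'. v y = v x} = {y \<in> X. v y = v x}" using x X'(1) by auto
    then show "card {y \<in> X'. v y = v x} = 4" using W(6) x X'(1) by auto
  qed (use X' in auto)
  have nS: "v x \<notin> S" if "x \<in> X - X'" for x using that SR X'(1) by auto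
  have vS: "v h \<notin> S" if "h \<in> X" "h \<notin> X'" for h using nS that by blast
  have st: "states X' p v S = states X p v S"
    unfolding states_def
  proof (intro Collect_cong all_cong1)
    fix j h
    show "(if h \<in> X' \<and> v h \<in> S then j h \<in> X' \<and> v (j h) = v h \<and> j h \<noteq> h \<and> j h \<noteq> p h \<and> j (j h) =
        h else j h = h) =
      (if h \<in> X \<and> v h \<in> S then j h \<in> X \<and> v (j h) = v h \<and> j h \<noteq> h \<and> j h \<noteq> p h \<and> j (j h) = h else j h = h)"
    proof -
      have "h \<in> X \<and> v h \<in> S \<longleftrightarrow> h \<in> X' \<and> v h \<in> S" using vS[of h] sub by blast
      moreover have "j h \<in> X' \<longleftrightarrow> j h \<in> X" if "v h \<in> S" "v (j h) = v h"
        using vS[of "j h"] sub that by (metis subsetD)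
      ultimately show ?thesis by (auto split: if_splits)
    qed
  qed
  have "state_value X m (resolve X p v S j) (label v (R \<union> S)) =
      state_value X' m' (resolve X' p v S j) (label v ({} \<union> S))"
    if j: "j \<in> states X p v S" for j
  proof -
    let ?q = "resolve X p v S j"
    note Q = pairing_resolve[OF wf SR j]
    have q': "resolve X' p v S j = ?q" using vS sub by (auto simp: resolve_def fun_eq_iff)
    have qX': "\<forall>x\<in>X. ?q x \<in> X' \<longleftrightarrow> x \<in> X'" using Q(2) pairingD[OF Q(1)] X'(1) by auto
    have qp: "?q x = p x" if "x \<in> X" "x \<notin> X'" for x using that vS by (auto simp: resolve_def)
    have g: "glue X m ?q X' = glue X m p X'"
    proof -
      have "{(x, ?q x) |x. x \<in> X - X'} = {(x, p x) |x. x \<in> X - X'}" using qp by force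
      then show ?thesis unfolding glue_def by simp
    qed
    show ?thesis unfolding q'
    proof (rule state_value_eqI[OF paired_resolve[OF wf SR j]])
      show "paired X' m' ?q (label v ({} \<union> S))"
        using paired_resolve[OF wf' _ j[folded st]] q' by simp
      show "\<exists>hs'. circuit X' m' ?q hs' \<and>
          word_class (word (label v (R \<union> S)) hs) = word_class (word (label v ({} \<union> S)) hs')"
        if t: "circuit X m ?q hs" for hs
      proof (intro exI conjI)
        show "circuit X' m' ?q (filter (\<lambda>x. x \<in> X') hs)"
          by (rule circuit_restrict[OF W(1,2) Q(1) sub qX' X'(2) _ t]) (use X'(3) g in simp)
        have hX: "set hs \<subseteq> X" using t unfolding circuit_def by blast
        have "word (label v ({} \<union> S)) (filter (\<lambda>x. x \<in> X') hs) =
            word (label v (R \<union> S)) (filter (\<lambda>x. x \<in> X') hs)"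
          by (rule map_filter_cong) (auto simp: label_def X'(1))
        also have "\<dots> = word (label v (R \<union> S)) hs"
          by (rule map_filter_filter) (use hX in \<open>auto simp: label_def X'(1)\<close>)
        finally show "word_class (word (label v (R \<union> S)) hs) =
            word_class (word (label v ({} \<union> S)) (filter (\<lambda>x. x \<in> X') hs))" by simp
      qed
      assume c': "conn X' m' ?q"
      show "conn X m ?q" unfolding conn_def
      proof (intro allI impI)
        fix C assume C: "C \<subseteq> X" "C \<noteq> {}" "m ` C \<subseteq> C" "?q ` C \<subseteq> C"
        \<comment> \<open>A closed piece avoiding \<open>X'\<close> meets only half-edges where
          \<open>?q\<close> agrees with \<open>p\<close>, so it is closed under \<open>p\<close> and
          hence everything.\<close>
        have key: "D = X" if D: "D \<subseteq> X" "D \<noteq> {}" "m ` D \<subseteq> D" "?q ` D \<subseteq> D" "D \<inter> X' = {}" for D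
        proof (rule connD[OF c D(1-3)])
          show "p ` D \<subseteq> D" using D qp by force
        qed
        let ?D = "X - C"
        have D: "m ` ?D \<subseteq> ?D" "?q ` ?D \<subseteq> ?D"
          using pairing_closed_iff[OF W(2) C(3)] pairing_closed_iff[OF Q(1) C(4)]
            pairingD(1)[OF W(2)] pairingD(1)[OF Q(1)] by auto
        show "C = X"
        proof (cases "C \<inter> X' = {}")
          case False
          have "C \<inter> X' = X'"
          proof (rule connD[OF c' _ False])
            have "m' x \<in> C" if "x \<in> C \<inter> X'" for x
            proof -
              have "(x, m' x) \<in> glue X m ?q X'" using X'(3) that g by auto
              then show ?thesis by (rule glue_closed) (use that C(3,4) in auto)
            qed
            then show "m' ` (C \<inter> X') \<subseteq> C \<inter> X'" using pairingD(1)[OF X'(2)] by auto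
            show "?q ` (C \<inter> X') \<subseteq> C \<inter> X'" using C(1,4) qX' by auto
          qed auto
          then have "?D \<inter> X' = {}" by blast
          then have "?D = {}" using key[of ?D] D C by blast
          then show ?thesis using C(1) by blast
        qed (use key C in blast)
      qed
    qed
  qed
  then show ?thesis unfolding state_sum_def st by (rule sum.cong[OF refl])
qed

text \<open>\<open>ab\<close> is the half-edge at \<open>a\<close> on the triangle edge towards
  \<open>b\<close>, and a prime marks the opposite half-edge. The move interchanges the names at the
  two ends of each triangle edge, which gives \<open>v2\<close>. That \<open>b\<close> and
  \<open>c\<close> are treated alike is used both for the bigon and for the isomorphism exchanging
  them.\<close>

lemma state_sum_triangle:
  fixes a b c ab bc ac :: nat
  assumes wf: "wf_state X m p v R" and w2: "wf_state X m p v2 R" and SR: "R \<inter> S = {}"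
    and abc: "distinct [a, b, c]" "a \<notin> R" "b \<notin> R" "c \<notin> R" "a \<notin> S" "b \<in> S \<longleftrightarrow> c \<in> S"
    and X: "ab \<in> X" "bc \<in> X" "ac \<in> X" and m: "ba = m ab" "cb = m bc" "ca = m ac"
    and p: "ab' = p ab" "ba' = p ba" "bc' = p bc" "cb' = p cb" "ac' = p ac" "ca' = p ca"
    and H: "{h \<in> X. v h = a} = {ab, ab', ac, ac'}" "{h \<in> X. v h = b} = {ba, ba', bc, bc'}"
      "{h \<in> X. v h = c} = {ca, ca', cb, cb'}"
    and d: "distinct [ab, ba, bc, cb, ac, ca, ab', ba', bc', cb', ac', ca']"
    and v2: "v2 ab = b" "v2 ab' = b" "v2 ba = a" "v2 ba' = a" "v2 bc = c" "v2 bc' = c"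
      "v2 cb = b" "v2 cb' = b" "v2 ac = c" "v2 ac' = c" "v2 ca = a" "v2 ca' = a"
    and v2o: "\<forall>h\<in>X. v h \<notin> {a, b, c} \<longrightarrow> v2 h = v h"
  shows "state_sum X m p v R (insert a S) = state_sum X m p v2 R (insert a S)"
proof -
  note P = pairingD[OF wf_stateD(3)[OF wf]] and M = pairingD[OF wf_stateD(2)[OF wf]]
  let ?D = "{ab, ba, bc, cb, ac, ca, ab', ba', bc', cb', ac', ca'}"
  have dr: "distinct [ca', ac', cb', bc', ba', ab', ca, ac, cb, bc, ba, ab]" using d by auto
  note ne = d[simplified] dr[simplified]
  have nabc: "a \<noteq> b" "b \<noteq> a" "a \<noteq> c" "c \<noteq> a" "b \<noteq> c" "c \<noteq> b" using abc(1) by auto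
  have v: "v ab = a" "v ab' = a" "v ac = a" "v ac' = a" "v ba = b" "v ba' = b" "v bc = b"
    "v bc' = b"
      "v ca = c" "v ca' = c" "v cb = c" "v cb' = c"
    using H by blast+
  have DX: "?D \<subseteq> X" using H by blast
  then have X': "ba \<in> X" "cb \<in> X" "ca \<in> X" "ab' \<in> X" "ba' \<in> X" "bc' \<in> X" "cb' \<in> X" "ac' \<in> X"
    "ca' \<in> X"
    by simp_all
  have out: "v h \<notin> {a, b, c}" if "h \<in> X" "h \<notin> ?D" for h
  proof -
    have "h \<notin> {h \<in> X. v h = a}" "h \<notin> {h \<in> X. v h = b}" "h \<notin> {h \<in> X. v h = c}"
      using that(2) unfolding H by simp_all
    then show ?thesis using that(1) by simp
  qed
  have v2out: "v2 h = v h" if "h \<in> X" "h \<notin> ?D" for h using out[OF that] v2o that(1) by blast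
  have pv: "p ab = ab'" "p ba = ba'" "p bc = bc'" "p cb = cb'" "p ac = ac'" "p ca = ca'"
    using p by simp_all
  have pv': "p ab' = ab" "p ba' = ba" "p bc' = bc" "p cb' = cb" "p ac' = ac" "p ca' = ca"
    unfolding p using P(3) X X' by simp_all
  have mv: "m ab = ba" "m bc = cb" "m ac = ca" "m ba = ab" "m cb = bc" "m ca = ac"
    using m M X by simp_all
  have classes: "{h \<in> X. w h = z} = {x1, x2, x3, x4}"
    if "{x1, x2, x3, x4} \<subseteq> ?D" "\<forall>h\<in>{x1, x2, x3, x4}. w h = z"
      "\<forall>h\<in>?D. h \<in> {x1, x2, x3, x4} \<or> w h \<noteq> z"
      "\<forall>h\<in>X - ?D. w h = v h" "z \<in> {a, b, c}" for w :: "nat \<Rightarrow> nat" and z x1 x2 x3 x4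
  proof (intro equalityI subsetI)
    fix h assume h: "h \<in> {h \<in> X. w h = z}"
    have "h \<in> ?D"
    proof (rule ccontr)
      assume n: "h \<notin> ?D"
      have "h \<in> X - ?D" using h n by blast
      then have "w h = v h" using that(4) by (rule bspec[rotated])
      then have "v h = z" using h by simp
      then show False using out[of h] h n that(5) by simp
    qed
    then show "h \<in> {x1, x2, x3, x4}" using that(3) h by blast
  next
    fix h assume h: "h \<in> {x1, x2, x3, x4}"
    then show "h \<in> {h \<in> X. w h = z}" using that(1,2) DX by blast
  qed
  let ?R = "insert a R"
  have SR': "?R \<inter> S = {}" using SR abc by auto
  define A B A2 B2 where "A = smooth_pairing p ab ac" and "B = smooth_pairing p ab ac'"
    and "A2 = smooth_pairing p ba ca" and "B2 = smooth_pairing p ba ca'"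
  have A: "A ab = ac" "A ac = ab" "A ab' = ac'" "A ac' = ab'" "A ba = ba'" "A ba' = ba"
    "A bc = bc'" "A bc' = bc"
    "A ca = ca'" "A ca' = ca" "A cb = cb'" "A cb' = cb"
    unfolding A_def smooth_pairing_def by (simp_all add: pv pv' ne)
  have B: "B ab = ac'" "B ac' = ab" "B ab' = ac" "B ac = ab'" "B ba = ba'" "B ba' = ba"
    "B bc = bc'" "B bc' = bc"
    "B ca = ca'" "B ca' = ca" "B cb = cb'" "B cb' = cb"
    unfolding B_def smooth_pairing_def by (simp_all add: pv pv' ne)
  have A2: "A2 ba = ca" "A2 ca = ba" "A2 ba' = ca'" "A2 ca' = ba'" "A2 ab = ab'" "A2 ab' = ab"
    "A2 bc = bc'" "A2 bc' = bc"
    "A2 ac = ac'" "A2 ac' = ac" "A2 cb = cb'" "A2 cb' = cb"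
    unfolding A2_def smooth_pairing_def by (simp_all add: pv pv' ne)
  have B2: "B2 ba = ca'" "B2 ca' = ba" "B2 ba' = ca" "B2 ca = ba'" "B2 ab = ab'" "B2 ab' = ab"
    "B2 bc = bc'" "B2 bc' = bc"
    "B2 ac = ac'" "B2 ac' = ac" "B2 cb = cb'" "B2 cb' = cb"
    unfolding B2_def smooth_pairing_def by (simp_all add: pv pv' ne)
  have o: "A h = p h" "B h = p h" "A2 h = p h" "B2 h = p h" if "h \<notin> ?D" for h
    using that unfolding A_def B_def A2_def B2_def smooth_pairing_def by (simp_all add: pv pv')
  have Hv: "{h \<in> X. v h = a} = {ab, p ab, ac, p ac}" "distinct [ab, p ab, ac, p ac]"
    "{h \<in> X. v h = a} = {ab, p ab, ac', p ac'}" "distinct [ab, p ab, ac', p ac']"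
    unfolding H pv pv' by (simp_all add: ne insert_commute)
  have "{h \<in> X. v2 h = a} = {ba, ba', ca, ca'}"
    by (rule classes) (simp_all add: v2 ne nabc v2out)
  then have Hv2: "{h \<in> X. v2 h = a} = {ba, p ba, ca, p ca}" "distinct [ba, p ba, ca, p ca]"
    "{h \<in> X. v2 h = a} = {ba, p ba, ca', p ca'}" "distinct [ba, p ba, ca', p ca']"
    unfolding pv pv' by (simp_all add: ne insert_commute)
  have split: "state_sum X m p v R (insert a S) = state_sum X m A v ?R S + state_sum X m B v ?R S"
    using state_sum_split[OF wf v(1) abc(2,5) X(1,3) Hv(1,2)] by (simp add: A_def B_def pv)
  have split2: "state_sum X m p v2 R (insert a S) = state_sum X m A2 v2 ?R S +
      state_sum X m B2 v2 ?R S"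
    using state_sum_split[OF w2 v2(3) abc(2,5) X'(1,3) Hv2(1,2)] by (simp add: A2_def B2_def pv)
  have wA: "wf_state X m A v ?R" unfolding A_def
    by (rule wf_state_smooth[OF wf v(1) abc(2) X(1,3) Hv(1,2)])
  have wB: "wf_state X m B v ?R" unfolding B_def
    by (rule wf_state_smooth[OF wf v(1) abc(2) X(1) X'(8) Hv(3,4)])
  have wA2: "wf_state X m A2 v2 ?R" unfolding A2_def
    by (rule wf_state_smooth[OF w2 v2(3) abc(2) X'(1,3) Hv2(1,2)])
  have wB2: "wf_state X m B2 v2 ?R" unfolding B2_def
    by (rule wf_state_smooth[OF w2 v2(3) abc(2) X'(1) X'(9) Hv2(3,4)])
  have nR: "b \<notin> ?R" "c \<notin> ?R" using abc nabc by auto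
  let ?R3 = "insert b (insert c ?R)" and ?S3 = "S - {b, c}"
  have SR3: "?R3 \<inter> ?S3 = {}" using SR' by auto

  \<comment> \<open>First smoothing, \<open>ab\<close> joined to \<open>ac\<close>: a passage of
    \<open>b\<close> slides across the edge \<open>{ba, ab}\<close> onto \<open>{ab, ac}\<close>.
    Now \<open>b\<close> and \<open>c\<close> bound a bigon with the edges \<open>{ac, ca}\<close>
    and \<open>{bc, cb}\<close>.\<close>
  define v1 where "v1 = v(ba' := a, ba := a, ab := b, ac := b)"
  have v1: "v1 ab = b" "v1 ac = b" "v1 ba = a" "v1 ba' = a" "v1 ab' = a" "v1 ac' = a" "v1 bc = b"
    "v1 bc' = b"
      "v1 ca = c" "v1 ca' = c" "v1 cb = c" "v1 cb' = c"
    unfolding v1_def by (simp_all add: v ne)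
  have v1o: "v1 h = v h" if "h \<notin> ?D" for h using that by (simp add: v1_def)
  have wv1: "wf_state X m A v1 ?R"
    using wf_state_slide[OF wA, of ba' ab] X X' nR by (simp add: v A v1_def)
  have ZA1: "state_sum X m A v ?R S = state_sum X m A v1 ?R S"
    using state_sum_slide[OF wA SR', of ba' ab] X' nR by (simp add: v A v1_def mv)
  have "{h \<in> X. v1 h = b} = {ac, ab, bc, bc'}"
    by (rule classes) (simp_all add: v1 ne nabc v1o)
  then have Hb: "{h \<in> X. v1 h = b} = {ac, A ac, bc, A bc}" "distinct [ac, A ac, bc, A bc]"
    unfolding A by (simp_all add: ne)
  have "{h \<in> X. v1 h = c} = {ca, ca', cb, cb'}"
    by (rule classes) (simp_all add: v1 ne nabc v1o)
  then have Hc: "{h \<in> X. v1 h = c} = {ca, A ca, cb, A cb}" "distinct [ca, A ca, cb, A cb]"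
    unfolding A by (simp_all add: ne)
  have ZA2: "state_sum X m A v1 ?R S = state_sum X m A v1 ?R3 ?S3"
    by (rule state_sum_bigon[OF wv1 SR' nabc(5) nR abc(6) X(3) m(3) X(2) m(2) Hb Hc])
  have wv13: "wf_state X m A v1 ?R3" by (rule wf_state_forget[OF wv1]) blast

  \<comment> \<open>The same after the move, with \<open>ab\<close> and \<open>ba\<close>,
    \<open>ac\<close> and \<open>ca\<close>, \<open>bc\<close> and \<open>cb\<close>
    exchanged.\<close>
  define v3 where "v3 = v2(ab' := a, ab := a, ba := b, ca := b)"
  have v3: "v3 ab = a" "v3 ab' = a" "v3 ba = b" "v3 ca = b" "v3 ba' = a" "v3 ca' = a" "v3 bc = c"
    "v3 bc' = c"
      "v3 ac = c" "v3 ac' = c" "v3 cb = b" "v3 cb' = b"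
    unfolding v3_def by (simp_all add: v2 ne)
  have v3o: "v3 h = v h" if "h \<in> X" "h \<notin> ?D" for h using that(2) v2out[OF that]
    by (simp add: v3_def)
  have wv3: "wf_state X m A2 v3 ?R"
    using wf_state_slide[OF wA2, of ab' ba] X X' nR by (simp add: v2 A2 v3_def)
  have ZA3: "state_sum X m A2 v2 ?R S = state_sum X m A2 v3 ?R S"
    using state_sum_slide[OF wA2 SR', of ab' ba] X' nR by (simp add: v2 A2 v3_def mv)
  have "{h \<in> X. v3 h = b} = {ca, ba, cb, cb'}"
    by (rule classes) (simp_all add: v3 ne nabc v3o)
  then have Hb3: "{h \<in> X. v3 h = b} = {ca, A2 ca, cb, A2 cb}" "distinct [ca, A2 ca, cb, A2 cb]"
    unfolding A2 by (simp_all add: ne)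
  have "{h \<in> X. v3 h = c} = {ac, ac', bc, bc'}"
    by (rule classes) (simp_all add: v3 ne nabc v3o)
  then have Hc3: "{h \<in> X. v3 h = c} = {ac, A2 ac, bc, A2 bc}" "distinct [ac, A2 ac, bc, A2 bc]"
    unfolding A2 by (simp_all add: ne)
  have ZA4: "state_sum X m A2 v3 ?R S = state_sum X m A2 v3 ?R3 ?S3"
    by (rule state_sum_bigon[OF wv3 SR' nabc(5) nR abc(6) X'(3) mv(6)[symmetric] X'(2) mv(5)[symmetric] Hb3 Hc3])
  have wv33: "wf_state X m A2 v3 ?R3" by (rule wf_state_forget[OF wv3]) blast

  \<comment> \<open>The common outcome. Before the move, the path through the smoothed corner
    collapses to a join of \<open>ba'\<close> and \<open>ca'\<close>, and \<open>ab'\<close> is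
    already joined to \<open>ac'\<close>; after the move it is the other way round.\<close>
  define t where "t = p(ab' := ac', ac' := ab', ba' := ca', ca' := ba')"
  have t: "t ab' = ac'" "t ac' = ab'" "t ba' = ca'" "t ca' = ba'" "t bc = bc'" "t bc' = bc"
    "t cb = cb'" "t cb' = cb"
    unfolding t_def by (simp_all add: ne pv pv')
  have tout: "t h = p h" if "h \<notin> ?D" for h using that by (simp add: t_def)
  have cA: "\<forall>z\<in>X - {ab, ba, ac, ca, ba', ca'}. t z = A z"
  proof
    fix z assume z: "z \<in> X - {ab, ba, ac, ca, ba', ca'}"
    show "t z = A z"
    proof (cases "z \<in> ?D")
      case True
      then have "z \<in> {ab', ac', bc, bc', cb, cb'}" using z by blast
      then show ?thesis by (elim insertE) (simp_all add: t A)
    qed (simp add: tout o)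
  qed
  have cA2: "\<forall>z\<in>X - {ba, ab, ca, ac, ab', ac'}. t z = A2 z"
  proof
    fix z assume z: "z \<in> X - {ba, ab, ca, ac, ab', ac'}"
    show "t z = A2 z"
    proof (cases "z \<in> ?D")
      case True
      then have "z \<in> {ba', ca', bc, bc', cb, cb'}" using z by blast
      then show ?thesis by (elim insertE) (simp_all add: t A2)
    qed (simp add: tout o)
  qed
  have d1: "distinct [ab, ba, ac, ca, ba', ca']" "distinct [ba, ab, ca, ac, ab', ac']"
    by (simp_all add: ne)
  note pathA = state_sum_contract_path[OF wv13 SR3 X(1) m(1) X(3) m(3) d1(1) _ _ _ _ _ _ _ cA]
  have pA: "wf_state (X - {ab, ba, ac, ca}) m t v1 ?R3"
      "state_sum X m A v1 ?R3 ?S3 = state_sum (X - {ab, ba, ac, ca}) m t v1 ?R3 ?S3"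
    by (rule pathA; simp add: v1 A t)+
  note pathA2 = state_sum_contract_path[OF wv33 SR3 X'(1) mv(4)[symmetric] X'(3) mv(6)[symmetric] d1(2) _ _ _ _ _ _ _ cA2]
  have pA2: "wf_state (X - {ba, ab, ca, ac}) m t v3 ?R3"
      "state_sum X m A2 v3 ?R3 ?S3 = state_sum (X - {ba, ab, ca, ac}) m t v3 ?R3 ?S3"
    by (rule pathA2; simp add: v3 A2 t)+
  have X4: "X - {ba, ab, ca, ac} = X - {ab, ba, ac, ca}" by blast
  have "v1 z = v3 z \<or> v1 z \<in> ?R3 \<and> v3 z \<in> ?R3" if z: "z \<in> X" for z
  proof (cases "z \<in> ?D")
    case True
    then have "v1 z \<in> {a, b, c}" by (elim insertE) (simp_all add: v1)
    moreover have "v3 z \<in> {a, b, c}" using True by (elim insertE) (simp_all add: v3)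
    ultimately show ?thesis by blast
  next
    case False
    then show ?thesis using v1o v3o z by simp
  qed
  then have "state_sum (X - {ab, ba, ac, ca}) m t v1 ?R3 ?S3 =
      state_sum (X - {ab, ba, ac, ca}) m t v3 ?R3 ?S3"
    by (intro state_sum_cong[OF pA(1) pA2(1)[unfolded X4] SR3]) blast+
  then have AA: "state_sum X m A v ?R S = state_sum X m A2 v2 ?R S"
    using ZA1 ZA2 ZA3 ZA4 pA(2) pA2(2) X4 by simp

  \<comment> \<open>Second smoothing, \<open>ab\<close> joined to \<open>ac'\<close>: both
    \<open>b\<close> and \<open>c\<close> slide onto passages of the resolved vertex. Exchanging the
    edges \<open>{ab, ba}\<close> and \<open>{ac, ca}\<close> then carries the state to the one
    after the move, with \<open>b\<close> and \<open>c\<close> swapped.\<close>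
  define u where "u = v(ba' := a, ba := a, ab := b, ac' := b)"
  have u: "u ca = c" "u ca' = c" "u ac = a" "u ab' = a" unfolding u_def by (simp_all add: v ne)
  have wu: "wf_state X m B u ?R"
    using wf_state_slide[OF wB, of ba' ab] X X' nR by (simp add: v B u_def)
  have ZB1: "state_sum X m B v ?R S = state_sum X m B u ?R S"
    using state_sum_slide[OF wB SR', of ba' ab] X' nR by (simp add: v B u_def mv)
  define u' where "u' = u(ca' := a, ca := a, ac := c, ab' := c)"
  have wu': "wf_state X m B u' ?R"
    using wf_state_slide[OF wu, of ca' ac] X X' nR by (simp add: u B u'_def)
  have ZB2: "state_sum X m B u ?R S = state_sum X m B u' ?R S"
    using state_sum_slide[OF wu SR', of ca' ac] X' nR by (simp add: u B u'_def mv)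
  have u': "u' ab = b" "u' ac' = b" "u' bc = b" "u' bc' = b" "u' ac = c" "u' ab' = c" "u' cb = c"
    "u' cb' = c"
      "u' ba = a" "u' ba' = a" "u' ca = a" "u' ca' = a"
    unfolding u'_def u_def by (simp_all add: v ne)
  have u'o: "u' h = v h" if "h \<notin> ?D" for h using that by (simp add: u'_def u_def)
  define f :: "nat \<Rightarrow> nat" where "f = id(ba := ca, ca := ba, ab := ac, ac := ab)"
  define g :: "nat \<Rightarrow> nat" where "g = id(b := c, c := b)"
  have f: "f ba = ca" "f ca = ba" "f ab = ac" "f ac = ab" "f bc = bc" "f cb = cb" "f ab' = ab'"
    "f ba' = ba'"
    "f bc' = bc'" "f cb' = cb'" "f ac' = ac'" "f ca' = ca'"
    unfolding f_def by (simp_all add: ne)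
  have fo: "f h = h" if "h \<notin> {ab, ba, ac, ca}" for h using that by (simp add: f_def)
  have ff: "f (f h) = h" for h
    by (cases "h \<in> {ab, ba, ac, ca}") (auto simp: f fo)
  have fX: "f h \<in> X" if "h \<in> X" for h
    using that X X' by (cases "h \<in> {ab, ba, ac, ca}") (auto simp: f fo)
  have poD: "p h \<notin> ?D" if h: "h \<in> X" "h \<notin> ?D" for h
  proof
    assume "p h \<in> ?D"
    then have "p (p h) \<in> ?D" by (elim insertE) (simp_all add: pv pv')
    then show False using h P(3)[OF h(1)] by simp
  qed
  have gabc: "g a = a" "g b = c" "g c = b" using nabc by (simp_all add: g_def)
  have go: "g z = z" if "z \<notin> {a, b, c}" for z using that by (simp add: g_def)
  have vg: "v2 (f x) = g (u' x)" if x: "x \<in> X" for x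
  proof (cases "x \<in> ?D")
    case True
    then show ?thesis by (elim insertE) (simp_all add: f u' v2 gabc)
  next
    case False
    then have "f x = x" by (intro fo) blast
    then show ?thesis using False x u'o v2out go out by simp
  qed
  have gR: "g z \<in> ?R \<longleftrightarrow> z \<in> ?R" "g z \<in> S \<longleftrightarrow> z \<in> S" for z
    using nR abc nabc by (auto simp: g_def)
  have "state_sum X m B u' ?R S = state_sum X m B2 v2 ?R S"
  proof (rule state_sum_iso[OF wu' wB2 SR' SR'])
    show "bij_betw f X X" using ff fX by (intro bij_betw_byWitness[where f' = f]) auto
    show "\<forall>x\<in>X. f (m x) = m (f x)"
    proof
      fix x assume x: "x \<in> X"
      show "f (m x) = m (f x)"
      proof (cases "x \<in> {ab, ba, ac, ca}")
        case True
        then show ?thesis by (elim insertE) (simp_all add: mv f)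
      next
        case False
        have "m x \<notin> {ab, ba, ac, ca}"
        proof
          assume "m x \<in> {ab, ba, ac, ca}"
          then have "m (m x) \<in> {ab, ba, ac, ca}" by (elim insertE) (simp_all add: mv)
          then show False using M(3)[OF x] False by simp
        qed
        then show ?thesis using False fo by simp
      qed
    qed
    show "\<forall>x\<in>X. f (B x) = B2 (f x)"
    proof
      fix x assume x: "x \<in> X"
      show "f (B x) = B2 (f x)"
      proof (cases "x \<in> ?D")
        case True
        then show ?thesis by (elim insertE) (simp_all add: B B2 f)
      next
        case False
        have 1: "f x = x" using False by (intro fo) blast
        have 2: "f (p x) = p x" using poD[OF x False] by (intro fo) blast
        show ?thesis unfolding 1 o(2,4)[OF False] 2 ..
      qed
    qed
    show "\<forall>x\<in>X. u' x \<in> ?R \<longleftrightarrow> v2 (f x) \<in> ?R" "\<forall>x\<in>X. u' x \<in> S \<longleftrightarrow> v2 (f x) \<in> S"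
      using vg gR by simp_all
    show "\<forall>x\<in>X. u' x \<notin> ?R \<longrightarrow> v2 (f x) = g (u' x)" using vg by blast
    show "inj_on g (u' ` X - ?R)" by (rule inj_onI) (simp add: g_def split: if_splits)
  qed
  then show ?thesis using split split2 AA ZB1 ZB2 by simp
qed

section \<open>Parity of vertices\<close>

text \<open>If the letter moved to the end is \<open>a\<close> itself, the two arcs between the ends
  of \<open>a\<close> exchange their roles.\<close>

lemma linked_rotate1: "linked D a b \<Longrightarrow> linked (rotate1 D) a b"
proof -
  assume "linked D a b"
  then obtain u v w where D: "D = u @ [a] @ v @ [a] @ w" "b \<in> set v" "b \<in> set (w @ u)"
    by (auto simp: linked_def)
  show "linked (rotate1 D) a b"
  proof (cases u)
    case Nil
    then have "rotate1 D = v @ [a] @ w @ [a] @ []" using D by simp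
    moreover have "b \<in> set w" "b \<in> set ([] @ v)" using D Nil by auto
    ultimately show ?thesis unfolding linked_def by blast
  next
    case (Cons c u')
    then have "rotate1 D = u' @ [a] @ v @ [a] @ (w @ [c])" using D by simp
    moreover have "b \<in> set v" "b \<in> set ((w @ [c]) @ u')" using D Cons by auto
    ultimately show ?thesis unfolding linked_def by blast
  qed
qed

lemma linked_append_commute: "linked (as @ bs) a b \<Longrightarrow> linked (bs @ as) a b"
proof -
  assume l: "linked (as @ bs) a b"
  have "linked (rotate n (as @ bs)) a b" for n using l by (induction n) (auto intro: linked_rotate1)
  then show ?thesis using rotate_append[of as bs] by metis
qed

lemma linked_rev: "linked D a b \<Longrightarrow> linked (rev D) a b"
proof -
  assume "linked D a b"
  then obtain u v w where D: "D = u @ [a] @ v @ [a] @ w" "b \<in> set v" "b \<in> set (w @ u)"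
    by (auto simp: linked_def)
  then have "rev D = rev w @ [a] @ rev v @ [a] @ rev u" "b \<in> set (rev v)" "b \<in> set (rev u @ rev w)"
    by auto
  then show ?thesis unfolding linked_def by blast
qed

text \<open>All words of a graph arise from one by rotation and reversal, so incidence can be read
  off any of them.\<close>

lemma linked_chord_diagram:
  assumes "framed_graph G" "D \<in> chord_diagram G" "E \<in> chord_diagram G" "linked D a b"
  shows "linked E a b"
proof -
  note F = framed_graphD[OF assms(1)]
  obtain hs where hs: "circuit (halfs G) (mate G) (opp G) hs" "D = map (vert G) hs"
    using assms(2) by (auto simp: chord_diagram_def traversal_circuit)
  obtain ks where ks: "circuit (halfs G) (mate G) (opp G) ks" "E = map (vert G) ks"
    using assms(3) by (auto simp: chord_diagram_def traversal_circuit)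
  show ?thesis using circuit_unique[OF hs(1) ks(1) F(2,3)]
  proof (elim disjE exE conjE)
    fix as bs assume "hs = as @ bs" "ks = bs @ as"
    then show ?thesis using linked_append_commute assms(4) hs(2) ks(2) by simp
  next
    fix as bs assume r: "rev (map (mate G) hs) = as @ bs" "ks = bs @ as"
    have "map (vert G) (map (mate G) hs) = rotate1 D"
      using circuit_map_mate[OF hs(1) F(2)] F(4) hs(2) by blast
    then have "rev (rotate1 D) = map (vert G) as @ map (vert G) bs"
      by (metis r(1) rev_map map_append)
    moreover have "linked (rev (rotate1 D)) a b" using assms(4) linked_rotate1 linked_rev by blast
    ultimately have "linked (map (vert G) bs @ map (vert G) as) a b" using linked_append_commute
      by simp
    then show ?thesis using r(2) ks(2) by simp
  qed
qed

lemma incident_iff: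
  assumes "framed_graph G" "D \<in> chord_diagram G"
  shows "incident G a b \<longleftrightarrow> a \<noteq> b \<and> linked D a b"
  using linked_chord_diagram[OF assms(1)] assms(2) unfolding incident_def by blast

text \<open>Of each of the two opposite pairs at a vertex exactly one half-edge is a
  departure.\<close>

lemma chord_diagram_count:
  assumes "framed_graph G" "D \<in> chord_diagram G" "a \<in> set D"
  shows "count_list D a = 2"
proof -
  note F = framed_graphD[OF assms(1)]
  let ?v = "vert G" and ?p = "opp G" and ?m = "mate G"
  obtain hs where t: "circuit (halfs G) ?m ?p hs" and D: "D = map ?v hs"
    using assms(2) by (auto simp: chord_diagram_def traversal_circuit)
  have X: "halfs G = set hs \<union> ?m ` set hs" and d: "set hs \<inter> ?m ` set hs = {}" "distinct hs"
    using t by (auto simp: circuit_def)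
  let ?A = "{h \<in> set hs. ?v h = a}"
  obtain h where h: "h \<in> set hs" "?v h = a" using assms(3) D by auto
  then have "card {k \<in> halfs G. ?v k = a} = 4" using F(5)[of h] X by auto
  moreover have "{k \<in> halfs G. ?v k = a} = ?A \<union> ?p ` ?A"
  proof (intro equalityI subsetI)
    fix k assume k: "k \<in> {k \<in> halfs G. ?v k = a}"
    show "k \<in> ?A \<union> ?p ` ?A"
    proof (cases "k \<in> set hs")
      case False
      then obtain w where w: "w \<in> set hs" "k = ?m w" using k X by blast
      have "set (map (\<lambda>x. ?p (?m x)) hs) = set hs" using circuit_next[OF t] by simp
      then have "?p k \<in> set hs" using w by auto
      then have "?p k \<in> ?A" "k = ?p (?p k)" using k F(4) pairingD(3)[OF F(3)] by auto
      then show ?thesis by blast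
    qed (use k in simp)
  next
    fix k assume "k \<in> ?A \<union> ?p ` ?A"
    then show "k \<in> {k \<in> halfs G. ?v k = a}" using X F(4) pairingD(1)[OF F(3)] by auto
  qed
  moreover have "?A \<inter> ?p ` ?A = {}" using circuit_excl(2)[OF t F(2,3)] by auto
  moreover have "card (?p ` ?A) = card ?A"
    using X by (intro card_image inj_onI) (auto intro: pairing_inj[OF F(3)])
  ultimately have "card ?A = 2" by (simp add: card_Un_disjoint)
  moreover have "card ?A = length (filter (\<lambda>h. ?v h = a) hs)"
    using d(2) distinct_card[of "filter (\<lambda>h. ?v h = a) hs"] by simp
  moreover have "count_list (map ?v ks) a = length (filter (\<lambda>h. ?v h = a) ks)" for ks
    by (induction ks) auto
  ultimately show ?thesis using D by simp
qed

text \<open>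
  A vertex is even iff the number of chord ends between the two ends of its chord is even, that is,
  iff the sum of the positions of these two ends is odd.
\<close>

fun positions_sum :: "'a list \<Rightarrow> 'a \<Rightarrow> nat" where
  "positions_sum [] a = 0"
| "positions_sum (x # xs) a = positions_sum xs a + count_list xs a"

lemma positions_sum_append:
  "positions_sum (xs @ ys) a = positions_sum xs a + positions_sum ys a +
      length xs * count_list ys a"
  by (induction xs) auto

lemma positions_sum_notin: "a \<notin> set xs \<Longrightarrow> positions_sum xs a = 0"
  by (induction xs) auto

lemma positions_sum_map:
  assumes "inj_on g (set D)" "a \<in> set D"
  shows "positions_sum (map g D) (g a) = positions_sum D a"
proof -
  have c: "count_list (map g xs) (g a) = count_list xs a" if "set xs \<subseteq> set D" for xs
    using that assms by (induction xs) (auto dest: inj_onD)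
  have "set xs \<subseteq> set D \<Longrightarrow> positions_sum (map g xs) (g a) = positions_sum xs a" for xs
    by (induction xs) (auto simp: c)
  then show ?thesis by simp
qed

lemma even_sum_card:
  fixes f :: "'a \<Rightarrow> nat"
  assumes "finite A"
  shows "even (sum f A) \<longleftrightarrow> even (card {x \<in> A. odd (f x)})"
  using assms
proof (induction A)
  case (insert x A)
  have "{y \<in> insert x A. odd (f y)} =
      (if odd (f x) then insert x {y \<in> A. odd (f y)} else {y \<in> A. odd (f y)})"
    by auto
  then show ?case using insert by simp
qed simp

text \<open>Write the word as \<open>x @ [a] @ y @ [a] @ z\<close>. A letter is linked with
  \<open>a\<close> iff it occurs exactly once in \<open>y\<close>; letters occurring twice there
  contribute evenly, so the number of linked letters has the parity of \<open>length y\<close>. The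
  two positions of \<open>a\<close> add up to \<open>2 * length x + 1 + length y\<close>.\<close>

lemma even_linked_iff:
  assumes c: "\<And>x. x \<in> set D \<Longrightarrow> count_list D x = 2" and a: "a \<in> set D"
  shows "even (card {b \<in> set D. a \<noteq> b \<and> linked D a b}) \<longleftrightarrow> odd (positions_sum D a)"
proof -
  obtain x r where r: "D = x @ a # r" "a \<notin> set x" using split_list_first[OF a] by blast
  then have "count_list r a = 1" using c[OF a] by simp
  then have "a \<in> set r" using count_list_0_iff[of r a] by (metis zero_neq_one)
  then obtain y z where yz: "r = y @ a # z" "a \<notin> set y" using split_list_first by metis
  have az: "a \<notin> set z" using c[OF a] r yz count_list_0_iff[of z a] by simp
  have D: "D = x @ [a] @ y @ [a] @ z" using r yz by simp
  have lk: "linked D a b \<longleftrightarrow> b \<in> set y \<and> b \<in> set (z @ x)" for b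
  proof
    assume "linked D a b"
    then obtain u v w where e: "D = u @ [a] @ v @ [a] @ w" and b: "b \<in> set v" "b \<in> set (w @ u)"
      by (auto simp: linked_def)
    have "count_list u a + count_list v a + count_list w a = 0" using c[OF a] unfolding e by simp
    then have n: "a \<notin> set u" "a \<notin> set v" by (auto simp: count_list_0_iff)
    \<comment> \<open>Cutting at the first occurrence shows that the decomposition at the two ends
      of \<open>a\<close> is unique.\<close>
    have tw: "takeWhile (\<lambda>x. x \<noteq> a) (s @ [a] @ t) = s" if "a \<notin> set s" for s t
      using that by (subst takeWhile_append2) auto
    have "u = x" using tw[OF n(1), of "v @ [a] @ w"] tw[OF r(2), of "y @ [a] @ z"] e D by simp
    then have "v @ [a] @ w = y @ [a] @ z" using e D by simp
    moreover from this have "v = y" using tw[OF n(2), of w] tw[OF yz(2), of z] by simp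
    ultimately show "b \<in> set y \<and> b \<in> set (z @ x)" using b \<open>u = x\<close> by simp
  next
    assume "b \<in> set y \<and> b \<in> set (z @ x)"
    then show "linked D a b" unfolding linked_def using D by blast
  qed
  have "{b \<in> set D. a \<noteq> b \<and> linked D a b} = {b \<in> set y. odd (count_list y b)}"
  proof (intro Collect_cong iffI; elim conjE)
    fix b assume b: "b \<in> set D" "a \<noteq> b" "linked D a b"
    then have "b \<in> set y" "b \<in> set (z @ x)" using lk by auto
    then have "count_list y b \<noteq> 0" "count_list z b + count_list x b \<noteq> 0"
      by (auto simp: count_list_0_iff)
    moreover have "count_list x b + count_list y b + count_list z b = 2"
      using c[OF b(1)] b(2) unfolding D by simp
    ultimately have "count_list y b = 1" by linarith
    then show "b \<in> set y \<and> odd (count_list y b)" using \<open>b \<in> set y\<close> by simp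
  next
    fix b assume b: "b \<in> set y" "odd (count_list y b)"
    then have bD: "b \<in> set D" "a \<noteq> b" using D yz(2) by auto
    have "count_list x b + count_list y b + count_list z b = 2"
      using c[OF bD(1)] bD(2) unfolding D by simp
    moreover have "count_list y b \<noteq> 2" using b(2) by auto
    ultimately have "count_list x b + count_list z b \<noteq> 0 \<or> count_list y b > 2" by linarith
    then have "b \<in> set (z @ x)"
      using \<open>count_list x b + count_list y b + count_list z b = 2\<close> by (auto simp: count_list_0_iff)
    then show "b \<in> set D \<and> a \<noteq> b \<and> linked D a b" using bD lk b(1) by blast
  qed
  then have "even (card {b \<in> set D. a \<noteq> b \<and> linked D a b}) \<longleftrightarrow> even (length y)"
    using even_sum_card[of "set y" "count_list y"] sum_count_set[of y "set y"] by simp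
  moreover have "positions_sum D a = length x + (length x + 1 + length y)"
    unfolding D using positions_sum_notin[OF r(2)] positions_sum_notin[OF yz(2)] positions_sum_notin[OF az] az yz(2)
    by (simp add: positions_sum_append)
  ultimately show ?thesis by presburger
qed

lemma even_verts_iff:
  assumes "framed_graph G" "D \<in> chord_diagram G"
  shows "even_verts G = {a \<in> set D. odd (positions_sum D a)}"
proof -
  have "even (card {w \<in> set D. a \<noteq> w \<and> linked D a w}) \<longleftrightarrow> odd (positions_sum D a)" if "a \<in> set D"
    for a
    using even_linked_iff[OF chord_diagram_count[OF assms] that] .
  then show ?thesis
    unfolding even_verts_def verts_word[OF assms(2,1), symmetric] incident_iff[OF assms] by blast
qed

section \<open>Brackets of isomorphic graphs and deletion of chords\<close>

lemma bracket_isomorphic: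
  assumes G: "unicursal_graph G" and H: "unicursal_graph H" and iso: "isomorphic G H"
  shows "bracket G = bracket H"
proof -
  have FG: "framed_graph G" and FH: "framed_graph H" using G H
    by (simp_all add: unicursal_graph_def)
  note G' = framed_graphD[OF FG]
  obtain f where f: "bij_betw f (halfs G) (halfs H)"
      "\<forall>h\<in>halfs G. f (mate G h) = mate H (f h) \<and> f (opp G h) = opp H (f h)"
      "\<forall>h\<in>halfs G. \<forall>k\<in>halfs G. vert G h = vert G k \<longleftrightarrow> vert H (f h) = vert H (f k)"
    using iso by (auto simp: isomorphic_def)
  \<comment> \<open>The vertex map induced by \<open>f\<close>, read off at an arbitrary half-edge
    of the vertex.\<close>
  define g where "g w = vert H (f (SOME h. h \<in> halfs G \<and> vert G h = w))" for w
  have g: "vert H (f h) = g (vert G h)" if h: "h \<in> halfs G" for h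
  proof -
    have "(SOME k. k \<in> halfs G \<and> vert G k = vert G h) \<in> halfs G \<and>
        vert G (SOME k. k \<in> halfs G \<and> vert G k = vert G h) = vert G h"
      using h by (intro someI[of "\<lambda>k. k \<in> halfs G \<and> vert G k = vert G h" h]) simp
    then show ?thesis unfolding g_def using f(3) h by metis
  qed
  have inj: "inj_on g (verts G)" unfolding verts_def
    by (rule inj_onI) (use f(3) g in auto)
  obtain hs where hs: "traversal G hs" using unicursal_circuit[OF G] by blast
  let ?D = "map (vert G) hs"
  have D: "?D \<in> chord_diagram G" using hs by (auto simp: chord_diagram_def)
  have "traversal H (map f hs)"
    using hs unfolding traversal_circuit by (rule circuit_map[OF _ f(1) G'(2)]) (use f(2) in auto)
  moreover have "map (vert H) (map f hs) = map g ?D"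
    using hs g by (auto simp: traversal_def)
  ultimately have D': "map g ?D \<in> chord_diagram H" by (metis chord_diagramI)
  have vD: "set ?D = verts G" by (rule verts_word[OF D FG])
  note eG = even_verts_iff[OF FG D] and eH = even_verts_iff[OF FH D']
  have ev: "g w \<in> even_verts H \<longleftrightarrow> w \<in> even_verts G" if w: "w \<in> verts G" for w
  proof -
    have "g w \<in> set (map g ?D)" using w vD by (metis image_eqI list.set_map)
    moreover have "positions_sum (map g ?D) (g w) = positions_sum ?D w"
      using inj w vD by (intro positions_sum_map) simp_all
    ultimately show ?thesis unfolding eG eH using w vD by simp
  qed
  show ?thesis
    unfolding bracket_eq_Z[OF G] bracket_eq_Z[OF H]
  proof (rule state_sum_iso[OF framed_wf_state[OF FG] framed_wf_state[OF FH] _ _ f(1), where g = g])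
    show "\<forall>x\<in>halfs G. vert G x \<in> even_verts G \<longleftrightarrow> vert H (f x) \<in> even_verts H"
      using g ev by (auto simp: verts_def)
    show "inj_on g (vert G ` halfs G - {})" using inj by (simp add: verts_def)
  qed (use f(2) g in auto)
qed

lemma bracket_common_word:
  assumes "unicursal_graph G" "D \<in> chord_diagram G" "unicursal_graph H" "D \<in> chord_diagram H"
  shows "bracket G = bracket H"
  using bracket_isomorphic isomorphic_of_common_word assms by blast

text \<open>This puts the smaller graph of a move on the half-edges of the larger one. Suppressing
  the vertices of \<open>A\<close> in \<open>H\<close> yields a graph with the same word as
  \<open>G\<close>, hence with the same bracket and the same even vertices.\<close>

lemma bracket_delete:
  assumes H: "unicursal_graph H" "E \<in> chord_diagram H"
    and G: "unicursal_graph G" "filter (\<lambda>w. w \<notin> A) E \<in> chord_diagram G"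
  shows "bracket G = state_sum (halfs H) (mate H) (opp H) (vert H) A (even_verts G)"
proof -
  have FH: "framed_graph H" and FG: "framed_graph G" using H G
    by (simp_all add: unicursal_graph_def)
  note H' = framed_graphD[OF FH]
  let ?X = "halfs H" and ?m = "mate H" and ?p = "opp H" and ?v = "vert H"
  let ?X' = "{x \<in> ?X. ?v x \<notin> A}"
  obtain hs where t: "circuit ?X ?m ?p hs" and E: "E = map ?v hs"
    using H(2) by (auto simp: chord_diagram_def traversal_circuit)
  have wf: "wf_state ?X ?m ?p ?v A" by (rule wf_state_forget[OF framed_wf_state[OF FH]]) simp
  obtain m' where m': "pairing ?X' m'" "\<forall>x\<in>?X'. (x, m' x) \<in> glue ?X ?m ?p ?X'"
    and K': "let K = \<lparr>halfs = ?X', vert = ?v, mate = m', opp = ?p, free_loops = if ?X' =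
        {} then 1 else 0\<rparr>
      in unicursal_graph K \<and> word (label ?v A) hs \<in> chord_diagram K"
    using realize_glued[OF wf t] by blast
  let ?K = "\<lparr>halfs = ?X', vert = ?v, mate = m', opp = ?p, free_loops = if ?X' = {} then 1 else 0\<rparr>"
  have "word (label ?v A) xs = filter (\<lambda>w. w \<notin> A) (map ?v xs)" for xs
    by (induction xs) (auto simp: label_def)
  then have K: "unicursal_graph ?K" and KD: "filter (\<lambda>w. w \<notin> A) E \<in> chord_diagram ?K"
    using K' unfolding E Let_def by simp_all
  have FK: "framed_graph ?K" using K by (simp add: unicursal_graph_def)
  have ev: "even_verts ?K = even_verts G"
    unfolding even_verts_iff[OF FK KD] even_verts_iff[OF FG G(2)] ..
  have disj: "A \<inter> even_verts G = {}" unfolding even_verts_iff[OF FG G(2)] by auto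
  have "bracket G = bracket ?K" by (rule bracket_common_word[OF G K KD])
  also have "\<dots> = state_sum ?X' m' ?p ?v {} (even_verts G)" unfolding bracket_eq_Z[OF K] ev by simp
  also have "\<dots> = state_sum ?X ?m ?p ?v A (even_verts G)"
    by (rule state_sum_delete[symmetric, OF wf disj circuit_conn[OF t H'(2)] refl m'(1,2)])
  finally show ?thesis .
qed

section \<open>Invariance of the bracket\<close>

lemma vertex_set:
  assumes wf: "wf_state X m p v R" and x: "x \<in> X" "v x \<notin> R" and y: "y \<in> X" "v y = v x" "y \<noteq> x"
    "y \<noteq> p x"
  shows "{z \<in> X. v z = v x} = {x, p x, y, p y}" "distinct [x, p x, y, p y]"
proof -
  obtain z where z: "z \<in> X" "{h \<in> X. v h = v x} = {x, p x, z, p z}" "distinct [x, p x, z, p z]"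
    using vertex_halves[OF wf x] by blast
  have "p (p z) = z" using pairingD(3)[OF wf_stateD(3)[OF wf] z(1)] .
  moreover have "y = z \<or> y = p z" using y z(2) by blast
  ultimately show "{z \<in> X. v z = v x} = {x, p x, y, p y}" "distinct [x, p x, y, p y]"
    using z(2,3) by auto
qed

lemma circuit_consecutive:
  assumes "circuit X m p (us @ x # y # vs)" "pairing X m" "pairing X p"
  shows "y = p (m x)" "m x = p y"
proof -
  have t: "circuit X m p (x # y # vs @ us)" using circuit_append_commute[OF assms(1)] by simp
  then show y: "y = p (m x)" by (simp add: circuit_Cons)
  have "x \<in> X" using t unfolding circuit_def by auto
  then have "m x \<in> X" by (rule pairingD(1)[OF assms(2)])
  then show "m x = p y" unfolding y using pairingD(3)[OF assms(3)] by simp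
qed

lemma bracket_move1:
  assumes G: "unicursal_graph G" "D \<in> chord_diagram G" and H: "unicursal_graph H"
    "E \<in> chord_diagram H"
    and move: "move1 D E"
  shows "bracket G = bracket H"
proof -
  obtain a where E: "E = [a, a] @ D" using move by (auto elim: move1.cases)
  have FG: "framed_graph G" and FH: "framed_graph H" using G H
    by (simp_all add: unicursal_graph_def)
  note H' = framed_graphD[OF FH]
  let ?X = "halfs H" and ?m = "mate H" and ?p = "opp H" and ?v = "vert H"
  have aD: "a \<notin> set D" using chord_diagram_count[OF FH H(2), of a] E by (simp add: count_list_0_iff)
  \<comment> \<open>The new chord sits at the positions \<open>0\<close> and \<open>1\<close>, whose
    sum is odd, so it is even; every other chord end moves by two places, which preserves
    parities.\<close>
  have ev: "even_verts H = insert a (even_verts G)" "a \<notin> even_verts G"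
    unfolding even_verts_iff[OF FH H(2)] even_verts_iff[OF FG G(2)] E
    using aD by (auto simp: positions_sum_notin)
  obtain hs where hs: "circuit ?X ?m ?p hs" "E = map ?v hs"
    using H(2) by (auto simp: chord_diagram_def traversal_circuit)
  obtain h1 h2 rest where h: "hs = h1 # h2 # rest" "?v h1 = a" "?v h2 = a"
    using hs(2) unfolding E by (auto simp: Cons_eq_map_conv)
  note t = hs(1)[unfolded h(1)]
  \<comment> \<open>The loop at \<open>a\<close> is the edge from \<open>h1\<close> to its mate,
    which is the opposite of \<open>h2\<close>.\<close>
  have h12: "?m h1 = ?p h2" using circuit_consecutive(2)[of ?X ?m ?p "[]" h1 h2 rest] t H'(2,3)
    by simp
  have hX: "h1 \<in> ?X" "h2 \<in> ?X" using t unfolding circuit_def by auto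
  have k: "?m h1 \<in> ?X" "?v (?m h1) = a" using hX h(3) H'(4) pairingD(1)[OF H'(3)]
    by (auto simp: h12)
  have d: "h1 \<noteq> h2" using t unfolding circuit_def by simp
  have ne: "?m h1 \<noteq> h1" "?m h1 \<noteq> ?p h1"
    using pairingD(2)[OF H'(2) hX(1)] d pairing_inj[OF H'(3) hX(2,1)] by (auto simp: h12)
  note wf = framed_wf_state[OF FH]
  note vs = vertex_set[OF wf hX(1) _ k(1) _ ne]
  have "filter (\<lambda>w. w \<notin> {a}) E = D" using aD unfolding E by (auto simp: filter_id_conv)
  then have "bracket G = state_sum ?X ?m ?p ?v {a} (even_verts G)"
    using bracket_delete[OF H G(1), of "{a}"] G(2) by simp
  also have "\<dots> = state_sum ?X ?m ?p ?v {} (insert a (even_verts G))"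
    using state_sum_loop[OF wf _ h(2) _ ev(2) hX(1) refl] vs h(2) k(2) by simp
  also have "\<dots> = bracket H" unfolding bracket_eq_Z[OF H(1)] ev(1) ..
  finally show ?thesis .
qed

lemma bracket_move2:
  assumes G: "unicursal_graph G" "D \<in> chord_diagram G" and H: "unicursal_graph H"
    "E \<in> chord_diagram H"
    and move: "move2 D E"
  shows "bracket G = bracket H"
proof -
  obtain a b q1 q2 U V where D: "D = U @ V" and E: "E = [a, b] @ U @ [q1, q2] @ V"
      and ab: "a \<noteq> b" "{q1, q2} = {a, b}"
    using move
  proof cases
    case (1 a b p1 p2 q1 q2 u v)
    have "p1 \<noteq> p2" using 1(3,4) by (auto simp: doubleton_eq_iff)
    moreover have "{q1, q2} = {p1, p2}" using 1(4,5) by simp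
    ultimately show ?thesis using that[of u v p1 p2 q1 q2] 1(1,2) by simp
  qed
  have q: "q1 = a \<and> q2 = b \<or> q1 = b \<and> q2 = a" using ab(2) by (auto simp: doubleton_eq_iff)
  have FG: "framed_graph G" and FH: "framed_graph H" using G H
    by (simp_all add: unicursal_graph_def)
  note H' = framed_graphD[OF FH]
  let ?X = "halfs H" and ?m = "mate H" and ?p = "opp H" and ?v = "vert H"
  have "count_list E a = 2" "count_list E b = 2"
    by (rule chord_diagram_count[OF FH H(2)], simp add: E)+
  then have n: "a \<notin> set U" "a \<notin> set V" "b \<notin> set U" "b \<notin> set V"
    using q ab(1) unfolding E by (auto simp: count_list_0_iff)
  have nE: "positions_sum (xs @ ys) w = positions_sum xs w + positions_sum ys w +
      length xs * count_list ys w"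
    for xs ys and w :: nat by (rule positions_sum_append)
  \<comment> \<open>According to the order of \<open>q1\<close> and \<open>q2\<close>, the sums for
    \<open>a\<close> and \<open>b\<close> are \<open>length U + 2\<close> and
    \<open>length U + 4\<close>, or both \<open>length U + 3\<close>.\<close>
  have ps: "odd (positions_sum E a) \<longleftrightarrow> odd (positions_sum E b)"
    using q n ab(1) unfolding E by (elim disjE conjE) (simp_all add: nE positions_sum_notin)
  have po: "odd (positions_sum E w) \<longleftrightarrow> odd (positions_sum D w)" if "w \<noteq> a" "w \<noteq> b" for w
  proof -
    \<comment> \<open>Letters of \<open>U\<close> move by two places and letters of \<open>V\<close>
      by four.\<close>
    have "positions_sum E w = positions_sum D w + 2 * (count_list U w + 2 * count_list V w)"
      using q that unfolding D E by (elim disjE conjE) (simp_all add: nE algebra_simps)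
    then show ?thesis by simp
  qed
  have sE: "set E = insert a (insert b (set D))" using q unfolding D E by auto
  have abD: "a \<notin> set D" "b \<notin> set D" using n unfolding D by auto
  have po': "odd (positions_sum E w) \<longleftrightarrow> odd (positions_sum D w)" if "w \<in> set D" for w
    using that abD by (intro po) auto
  have ev: "a \<in> even_verts H \<longleftrightarrow> b \<in> even_verts H" "even_verts H - {a, b} = even_verts G"
    unfolding even_verts_iff[OF FH H(2)] even_verts_iff[OF FG G(2)] sE using ps po' abD by auto
  obtain hs where hs: "circuit ?X ?m ?p hs" "E = map ?v hs"
    using H(2) by (auto simp: chord_diagram_def traversal_circuit)
  obtain h1 h2 us h3 h4 vs where h: "hs = h1 # h2 # us @ h3 # h4 # vs"
      "?v h1 = a" "?v h2 = b" "?v h3 = q1" "?v h4 = q2"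
    using hs(2) unfolding E by (auto simp: Cons_eq_map_conv append_eq_map_conv)
  note t = hs(1)[unfolded h(1)]
  have h12: "?m h1 = ?p h2"
    using circuit_consecutive(2)[of ?X ?m ?p "[]" h1 h2 "us @ h3 # h4 # vs"] t H'(2,3) by simp
  have h34: "?m h3 = ?p h4"
    using circuit_consecutive(2)[of ?X ?m ?p "h1 # h2 # us" h3 h4 vs] t H'(2,3) by simp
  have hX: "h1 \<in> ?X" "h2 \<in> ?X" "h3 \<in> ?X" "h4 \<in> ?X" using t unfolding circuit_def by auto
  have pX: "?p h1 \<in> ?X" "?p h2 \<in> ?X" "?p h3 \<in> ?X" "?p h4 \<in> ?X"
    using hX pairingD(1)[OF H'(3)] by simp_all
  have pp: "?p (?p h1) = h1" "?p (?p h2) = h2" "?p (?p h3) = h3" "?p (?p h4) = h4"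
    using hX pairingD(3)[OF H'(3)] by simp_all
  have mp: "?m (?p h4) = h3" using pairingD(3)[OF H'(2) hX(3)] h34 by simp
  have vp: "?v (?p h1) = a" "?v (?p h2) = b" "?v (?p h3) = q1" "?v (?p h4) = q2"
    using hX H'(4) h by simp_all
  have d: "distinct [h1, h2, h3, h4]" using t unfolding circuit_def by simp
  have ex: "?p x \<noteq> y" if "x \<in> {h1, h2, h3, h4}" "y \<in> {h1, h2, h3, h4}" for x y
    using that circuit_excl(2)[OF t H'(2,3), of x] by auto
  have pd: "?p x \<noteq> ?p y" if "x \<in> {h1, h2, h3, h4}" "y \<in> {h1, h2, h3, h4}" "x \<noteq> y" for x y
    using that hX pairing_inj[OF H'(3), of x y] by blast
  note wf = framed_wf_state[OF FH]
  \<comment> \<open>The second edge of the bigon joins \<open>h3\<close> to the opposite of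
    \<open>h4\<close>; the order of \<open>q1\<close> and \<open>q2\<close> decides which of its
    ends lies at \<open>a\<close>.\<close>
  obtain fa fb where f: "fa \<in> ?X" "fb = ?m fa" "?v fa = a" "?v fb = b"
      "fa = h3 \<and> fb = ?p h4 \<or> fa = ?p h4 \<and> fb = h3"
    using q
  proof (elim disjE conjE)
    assume "q1 = a" "q2 = b"
    then show ?thesis using that[of h3 "?p h4"] hX h34 vp h by simp
  next
    assume "q1 = b" "q2 = a"
    then show ?thesis using that[of "?p h4" h3] pX mp vp h by simp
  qed
  have fX: "fb \<in> ?X" using f(1,2) pairingD(1)[OF H'(2)] by simp
  have na: "fa \<noteq> h1" "fa \<noteq> ?p h1"
    using f(5) d ex[of h4 h1] ex[of h1 h3] pd[of h4 h1] by auto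
  have nb: "fb \<noteq> ?p h2" "fb \<noteq> ?p (?p h2)"
    using f(5) d ex[of h2 h3] ex[of h4 h2] pd[of h4 h2] by (auto simp: pp)
  have Ha: "{z \<in> ?X. ?v z = a} = {h1, ?p h1, fa, ?p fa}" "distinct [h1, ?p h1, fa, ?p fa]"
    using vertex_set[OF wf hX(1) _ f(1) _ na] h(2) f(3) by simp_all
  have Hb: "{z \<in> ?X. ?v z = b} = {?p h2, ?p (?p h2), fb, ?p fb}"
    "distinct [?p h2, ?p (?p h2), fb, ?p fb]"
    using vertex_set[OF wf pX(2) _ fX _ nb] vp(2) f(4) by simp_all
  have "filter (\<lambda>w. w \<notin> {a, b}) U = U" "filter (\<lambda>w. w \<notin> {a, b}) V = V"
    using n by (auto simp: filter_id_conv)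
  moreover have "q1 \<in> {a, b}" "q2 \<in> {a, b}" using q by auto
  ultimately have "filter (\<lambda>w. w \<notin> {a, b}) E = D"
    unfolding E D filter_append by simp
  then have "bracket G = state_sum ?X ?m ?p ?v {a, b} (even_verts G)"
    using bracket_delete[OF H G(1), of "{a, b}"] G(2) by simp
  also have "\<dots> = state_sum ?X ?m ?p ?v {} (even_verts H)"
    using state_sum_bigon[OF wf _ ab(1) _ _ ev(1) hX(1) h12[symmetric] f(1,2) Ha Hb] ev(2) by simp
  also have "\<dots> = bracket H" unfolding bracket_eq_Z[OF H(1)] ..
  finally show ?thesis .
qed

text \<open>The three disjoint edges already determine the configuration of twelve half-edges, as
  each vertex has one passage at an end of each of two of them. Neutral names are used because any
  of the three vertices may have to play the role of \<open>\<alpha>\<close>.\<close>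

lemma state_sum_triangle_edges:
  fixes \<alpha> \<beta> \<gamma> e1 e2 e3 :: nat
  assumes wf: "wf_state X m p v {}" and wf2: "wf_state X m p v2 {}"
    and abc: "distinct [\<alpha>, \<beta>, \<gamma>]" and S: "\<alpha> \<in> S" "\<beta> \<in> S \<longleftrightarrow> \<gamma> \<in> S"
    and X: "e1 \<in> X" "e2 \<in> X" "e3 \<in> X"
    and v: "v e1 = \<alpha>" "v (m e1) = \<beta>" "v e2 = \<beta>" "v (m e2) = \<gamma>" "v e3 = \<alpha>" "v (m e3) = \<gamma>"
    and v2: "v2 e1 = \<beta>" "v2 (m e1) = \<alpha>" "v2 e2 = \<gamma>" "v2 (m e2) = \<beta>" "v2 e3 = \<gamma>" "v2 (m e3) = \<alpha>"
    and o: "\<forall>h\<in>X. v h \<notin> {\<alpha>, \<beta>, \<gamma>} \<longrightarrow> v2 h = v h"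
    and disj: "{e1, m e1, p e1, p (m e1)} \<inter> {e2, m e2, p e2, p (m e2)} = {}"
      "{e1, m e1, p e1, p (m e1)} \<inter> {e3, m e3, p e3, p (m e3)} = {}"
      "{e2, m e2, p e2, p (m e2)} \<inter> {e3, m e3, p e3, p (m e3)} = {}"
  shows "state_sum X m p v {} S = state_sum X m p v2 {} S"
proof -
  have mX: "m e1 \<in> X" "m e2 \<in> X" "m e3 \<in> X" using X pairingD(1)[OF wf_stateD(2)[OF wf]] by simp_all
  have vp: "v (p h) = v h" "v2 (p h) = v2 h" if "h \<in> X" for h
    using wf_stateD(5)[OF wf that] wf_stateD(5)[OF wf2 that] by simp_all
  have Ha: "{h \<in> X. v h = \<alpha>} = {e1, p e1, e3, p e3}" "distinct [e1, p e1, e3, p e3]"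
    using vertex_set[OF wf X(1) _ X(3)] v disj(2) by auto
  have Hb: "{h \<in> X. v h = \<beta>} = {m e1, p (m e1), e2, p e2}" "distinct [m e1, p (m e1), e2, p e2]"
    using vertex_set[OF wf mX(1) _ X(2)] v disj(1) by auto
  have Hc: "{h \<in> X. v h = \<gamma>} = {m e3, p (m e3), m e2, p (m e2)}"
    "distinct [m e3, p (m e3), m e2, p (m e2)]"
    using vertex_set[OF wf mX(3) _ mX(2)] v disj(3) by auto
  have D: "{e1, p e1, e3, p e3} \<inter> {m e1, p (m e1), e2, p e2} = {}"
    "{e1, p e1, e3, p e3} \<inter> {m e3, p (m e3), m e2, p (m e2)} = {}"
    "{m e1, p (m e1), e2, p e2} \<inter> {m e3, p (m e3), m e2, p (m e2)} = {}"
    unfolding Ha(1)[symmetric] Hb(1)[symmetric] Hc(1)[symmetric] using abc by auto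
  have d: "distinct [e1, m e1, e2, m e2, e3, m e3, p e1, p (m e1), p e2, p (m e2), p e3, p (m e3)]"
    using Ha(2) Hb(2) Hc(2) D by auto
  have SS: "S = insert \<alpha> (S - {\<alpha>})" using S(1) by auto
  have "state_sum X m p v {} (insert \<alpha> (S - {\<alpha>})) = state_sum X m p v2 {} (insert \<alpha> (S - {\<alpha>}))"
    by (rule state_sum_triangle[OF wf wf2 _ abc _ _ _ _ _ X refl refl refl refl refl refl refl refl refl Ha(1) Hb(1) Hc(1) d])
      (use abc S(2) v2 vp(2) X mX o in auto)
  then show ?thesis using SS by simp
qed

text \<open>The move is carried out on \<open>G\<close> by renaming: half-edges, mates, opposites
  and the circuit stay, and only the vertices of adjacent passages are interchanged. The same
  circuit then spells the word after the move.\<close>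

lemma bracket_relabel_triangle:
  assumes G: "unicursal_graph G" "D \<in> chord_diagram G"
    and D: "D = [p1, p2] @ U @ [q1, q2] @ V @ [r1, r2] @ W"
    and abc: "distinct [a, b, c]" "{p1, p2} = {a, b}" "{q1, q2} = {b, c}" "{r1, r2} = {a, c}"
  shows "\<exists>K. unicursal_graph K \<and> [p2, p1] @ U @ [q2, q1] @ V @ [r2, r1] @ W \<in> chord_diagram K \<and>
    bracket G = bracket K"
proof -
  let ?E = "[p2, p1] @ U @ [q2, q1] @ V @ [r2, r1] @ W"
  have FG: "framed_graph G" using G by (simp add: unicursal_graph_def)
  note G' = framed_graphD[OF FG]
  define X m p v where "X = halfs G" and "m = mate G" and "p = opp G" and "v = vert G"
  note xd = X_def[symmetric] m_def[symmetric] p_def[symmetric] v_def[symmetric]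
  note F = G'[unfolded xd] and M = pairingD[OF G'(2)[unfolded xd]]
    and P = pairingD[OF G'(3)[unfolded xd]]
  obtain hs where t0: "circuit X m p hs" and hsD: "D = map v hs"
    using G(2) by (auto simp: chord_diagram_def traversal_circuit xd)
  obtain h1 h2 us h3 h4 vs h5 h6 ws where h: "hs = [h1, h2] @ us @ [h3, h4] @ vs @ [h5, h6] @ ws"
      and vh: "v h1 = p1" "v h2 = p2" "v h3 = q1" "v h4 = q2" "v h5 = r1" "v h6 = r2"
      and UVW: "U = map v us" "V = map v vs" "W = map v ws"
    using hsD unfolding D by (auto simp: Cons_eq_map_conv append_eq_map_conv)
  note t = t0[unfolded h]
  let ?T = "{h1, h2, h3, h4, h5, h6}"
  have m12: "m h1 = p h2" "m h3 = p h4" "m h5 = p h6"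
    using circuit_consecutive(2)[of X m p "[]" h1 h2 "us @ [h3, h4] @ vs @ [h5, h6] @ ws"]
      circuit_consecutive(2)[of X m p "[h1, h2] @ us" h3 h4 "vs @ [h5, h6] @ ws"]
      circuit_consecutive(2)[of X m p "[h1, h2] @ us @ [h3, h4] @ vs" h5 h6 ws] t F(2,3) by simp_all
  have dh: "distinct hs" using t0 by (simp add: circuit_def)
  then have d6: "distinct [h1, h2, h3, h4, h5, h6]" unfolding h by auto
  have T: "?T \<subseteq> set hs" unfolding h by auto
  have hX: "set hs \<subseteq> X" using t0 unfolding circuit_def by blast
  have TX: "h1 \<in> X" "h2 \<in> X" "h3 \<in> X" "h4 \<in> X" "h5 \<in> X" "h6 \<in> X" using T hX by auto
  define n1 n2 n3 n4 n5 n6 where "n1 = p h1" and "n2 = p h2" and "n3 = p h3" and "n4 = p h4"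
    and "n5 = p h5" and "n6 = p h6"
  note nd = n1_def[symmetric] n2_def[symmetric] n3_def[symmetric] n4_def[symmetric] n5_def[symmetric] n6_def[symmetric]
  have nX: "n1 \<in> X" "n2 \<in> X" "n3 \<in> X" "n4 \<in> X" "n5 \<in> X" "n6 \<in> X"
    unfolding n1_def n2_def n3_def n4_def n5_def n6_def using TX P(1) by simp_all
  have pn: "p n1 = h1" "p n2 = h2" "p n3 = h3" "p n4 = h4" "p n5 = h5" "p n6 = h6"
    unfolding n1_def n2_def n3_def n4_def n5_def n6_def using TX P(3) by simp_all
  have ph: "p h1 = n1" "p h2 = n2" "p h3 = n3" "p h4 = n4" "p h5 = n5" "p h6 = n6"
    by (simp_all add: nd)
  have mh: "m h1 = n2" "m h3 = n4" "m h5 = n6" using m12 by (simp_all add: nd)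
  have mn: "m n2 = h1" "m n4 = h3" "m n6 = h5" using M(3) TX mh by metis+
  have vn: "v n1 = p1" "v n2 = p2" "v n3 = q1" "v n4 = q2" "v n5 = r1" "v n6 = r2"
    unfolding n1_def n2_def n3_def n4_def n5_def n6_def using F(4) TX vh by simp_all
  let ?N = "{n1, n2, n3, n4, n5, n6}"
  have nhs: "n \<notin> set hs" if "n \<in> ?N" for n
  proof -
    have "p x \<notin> set hs" if "x \<in> ?T" for x
      using circuit_excl(2)[OF t0 F(2,3)] T that by blast
    then show ?thesis using that unfolding n1_def n2_def n3_def n4_def n5_def n6_def by blast
  qed
  have TN: "?T \<inter> ?N = {}" using nhs T by blast
  have dn: "distinct [n1, n2, n3, n4, n5, n6]"
  proof -
    have "distinct (map p [h1, h2, h3, h4, h5, h6])"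
      unfolding distinct_map using d6 TX by (intro conjI inj_onI) (auto intro: pairing_inj[OF F(3)])
    then show ?thesis by (simp add: nd)
  qed
  have d12: "distinct [h1, h2, h3, h4, h5, h6, n1, n2, n3, n4, n5, n6]" using d6 dn TN by auto
  have d12r: "distinct [n6, n5, n4, n3, n2, n1, h6, h5, h4, h3, h2, h1]" using d12 by auto
  note ne = d12[simplified] d12r[simplified]

  \<comment> \<open>The \<open>n\<close>s are opposite to the \<open>h\<close>s, and
    \<open>\<tau>\<close> exchanges the two passages adjacent to each triangle edge. It serves to
    permute vertex names; the edges are not moved.\<close>
  define \<tau> :: "nat \<Rightarrow> nat" where "\<tau> = id(h1 := h2, h2 := h1, h3 := h4, h4 := h3, h5 := h6, h6 := h5,
    n1 := n2, n2 := n1, n3 := n4, n4 := n3, n5 := n6, n6 := n5)"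
  have \<tau>: "\<tau> h1 = h2" "\<tau> h2 = h1" "\<tau> h3 = h4" "\<tau> h4 = h3" "\<tau> h5 = h6" "\<tau> h6 = h5"
    "\<tau> n1 = n2" "\<tau> n2 = n1" "\<tau> n3 = n4" "\<tau> n4 = n3" "\<tau> n5 = n6" "\<tau> n6 = n5"
    unfolding \<tau>_def by (simp_all add: ne)
  have \<tau>o: "\<tau> x = x" if "x \<notin> ?T \<union> ?N" for x using that by (simp add: \<tau>_def)
  have \<tau>\<tau>: "\<tau> (\<tau> x) = x" for x
  proof (cases "x \<in> ?T \<union> ?N")
    case True
    then show ?thesis by (elim UnE insertE emptyE) (simp_all add: \<tau>)
  qed (simp add: \<tau>o)
  have \<tau>X: "\<tau> x \<in> X" if "x \<in> X" for x
  proof (cases "x \<in> ?T \<union> ?N")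
    case True
    then show ?thesis by (elim UnE insertE emptyE) (simp_all add: \<tau> TX nX)
  qed (simp add: \<tau>o that)
  have \<tau>p: "\<tau> (p x) = p (\<tau> x)" if x: "x \<in> X" for x
  proof (cases "x \<in> ?T \<union> ?N")
    case True
    then show ?thesis by (elim UnE insertE emptyE) (simp_all add: \<tau> ph pn)
  next
    case False
    have "p x \<notin> ?T \<union> ?N"
    proof
      assume "p x \<in> ?T \<union> ?N"
      then have "p (p x) \<in> ?T \<union> ?N" by (elim UnE insertE emptyE) (simp_all add: ph pn)
      then show False using False P(3)[OF x] by simp
    qed
    then show ?thesis using False \<tau>o by simp
  qed

  define v2 where "v2 = v \<circ> \<tau>"
  let ?K = "G\<lparr>vert := v2\<rparr>"
  have v2p: "v2 (p x) = v2 x" if "x \<in> X" for x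
    using that \<tau>p \<tau>X F(4) by (simp add: v2_def)
  have FK: "framed_graph ?K"
  proof (rule framed_graphI)
    show "card {k \<in> halfs ?K. vert ?K k = vert ?K x} = 4" if "x \<in> halfs ?K" for x
    proof -
      have x: "x \<in> X" using that by (simp add: xd)
      have "{k \<in> X. v2 k = v2 x} = \<tau> ` {k \<in> X. v k = v (\<tau> x)}"
      proof (intro equalityI subsetI)
        fix k assume "k \<in> {k \<in> X. v2 k = v2 x}"
        then have "\<tau> k \<in> {k \<in> X. v k = v (\<tau> x)}" using \<tau>X by (simp add: v2_def)
        then show "k \<in> \<tau> ` {k \<in> X. v k = v (\<tau> x)}" using \<tau>\<tau> by (metis image_eqI)
      qed (auto simp: v2_def \<tau>\<tau> \<tau>X)
      moreover have "inj \<tau>" by (metis \<tau>\<tau> injI)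
      ultimately have "card {k \<in> X. v2 k = v2 x} = card {k \<in> X. v k = v (\<tau> x)}"
        by (simp add: card_image inj_on_subset)
      then show ?thesis using F(5)[OF \<tau>X[OF x]] by (simp add: xd)
    qed
  qed (use G' v2p in \<open>simp_all add: xd\<close>)
  then have K: "unicursal_graph ?K" using G(1) by (simp add: unicursal_graph_iff)
  have "map v2 hs = ?E"
  proof -
    have r: "map v2 xs = map v xs" if "set xs \<subseteq> set hs" "set xs \<inter> ?T = {}" for xs
    proof (rule map_cong[OF refl])
      fix x assume "x \<in> set xs"
      then have "x \<notin> ?T \<union> ?N" using that nhs by blast
      then show "v2 x = v x" by (simp add: v2_def \<tau>o)
    qed
    have "set us \<inter> ?T = {}" "set vs \<inter> ?T = {}" "set ws \<inter> ?T = {}"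
      using dh unfolding h by auto
    then have "map v2 us = U" "map v2 vs = V" "map v2 ws = W"
      unfolding UVW by (intro r; simp add: h; blast)+
    then show ?thesis unfolding h by (simp add: v2_def \<tau> vh)
  qed
  moreover have "traversal ?K hs" using t0 by (simp add: traversal_circuit xd)
  ultimately have KE: "?E \<in> chord_diagram ?K" using chord_diagramI[of ?K hs] by simp

  define S where "S = even_verts G"
  have pqr: "p1 = a \<and> p2 = b \<or> p1 = b \<and> p2 = a" "q1 = b \<and> q2 = c \<or> q1 = c \<and> q2 = b"
    "r1 = a \<and> r2 = c \<or> r1 = c \<and> r2 = a"
    using abc(2-4) by (simp_all only: doubleton_eq_iff)
  have "{p1, p2} \<subseteq> set D" "{q1, q2} \<subseteq> set D" unfolding D by simp_all
  then have abcD: "a \<in> set D" "b \<in> set D" "c \<in> set D" unfolding abc(2,3) by simp_all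
  have count: "count_list D a = 2" "count_list D b = 2" "count_list D c = 2"
    using chord_diagram_count[OF FG G(2)] abcD by blast+
  have nabc: "a \<noteq> b" "b \<noteq> a" "a \<noteq> c" "c \<noteq> a" "b \<noteq> c" "c \<noteq> b" using abc(1) by auto
  have notin: "a \<notin> set U" "a \<notin> set V" "a \<notin> set W" "b \<notin> set U" "b \<notin> set V" "b \<notin> set W"
    "c \<notin> set U" "c \<notin> set V" "c \<notin> set W"
  proof -
    have two: "count_list [p1, p2, q1, q2, r1, r2] x = 2" if "x \<in> {a, b, c}" for x
      using pqr that by (elim disjE conjE insertE emptyE; simp add: nabc)
    have "count_list D x = count_list [p1, p2, q1, q2, r1, r2] x +
        (count_list U x + count_list V x + count_list W x)" for x
      unfolding D by simp
    then have "count_list U x + count_list V x + count_list W x = 0" if "x \<in> {a, b, c}" for x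
      using two[OF that] that count by (metis add_left_cancel add_0_right emptyE insertE)
    then have "x \<notin> set U \<and> x \<notin> set V \<and> x \<notin> set W" if "x \<in> {a, b, c}" for x
      using that by (simp add: count_list_0_iff)
    then show "a \<notin> set U" "a \<notin> set V" "a \<notin> set W" "b \<notin> set U" "b \<notin> set V" "b \<notin> set W"
      "c \<notin> set U" "c \<notin> set V" "c \<notin> set W" by simp_all
  qed
  \<comment> \<open>The six chord ends sit in three pairs of neighbouring positions, so their total
    is a sum of three odd numbers: an odd number of the three vertices is even. The positions of one
    vertex before and after the move fill two such pairs, an even total, so its parity is
    unchanged.\<close>
  have ps: "odd (positions_sum D a + positions_sum D b + positions_sum D c)"
    "odd (positions_sum ?E a) \<longleftrightarrow> odd (positions_sum D a)"
    "odd (positions_sum ?E b) \<longleftrightarrow> odd (positions_sum D b)"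
    "odd (positions_sum ?E c) \<longleftrightarrow> odd (positions_sum D c)"
  proof -
    have form: "positions_sum ([s1, s2] @ U @ [t1, t2] @ V @ [u1, u2] @ W) x =
        of_bool (s2 = x) + of_bool (t2 = x) + of_bool (u2 = x) +
        (2 + length U) * (of_bool (t1 = x) + of_bool (t2 = x)) +
        (4 + length U + length V) * (of_bool (u1 = x) + of_bool (u2 = x))"
      if "x \<notin> set U" "x \<notin> set V" "x \<notin> set W" for s1 s2 t1 t2 u1 u2 x
      using that by (simp add: positions_sum_append positions_sum_notin algebra_simps)
    note formD = form[of _ p1 p2 q1 q2 r1 r2, folded D] and formE = form[of _ p2 p1 q2 q1 r2 r1]
    have "positions_sum D a + positions_sum D b + positions_sum D c =
        2 * (7 + 2 * length U + length V) + 1"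
      unfolding formD[OF notin(1-3)] formD[OF notin(4-6)] formD[OF notin(7-9)]
      using pqr by (elim disjE conjE; simp add: nabc)
    then show "odd (positions_sum D a + positions_sum D b + positions_sum D c)" by simp
    have eq: "odd k \<longleftrightarrow> odd l" if "k + l = 2 * n" for k l n :: nat
      using that by presburger
    have "positions_sum ?E a + positions_sum D a = 2 * (5 + length U + length V)"
      unfolding formD[OF notin(1-3)] formE[OF notin(1-3)]
      using pqr by (elim disjE conjE; simp add: nabc)
    then show "odd (positions_sum ?E a) \<longleftrightarrow> odd (positions_sum D a)" by (rule eq)
    have "positions_sum ?E b + positions_sum D b = 2 * (3 + length U)"
      unfolding formD[OF notin(4-6)] formE[OF notin(4-6)]
      using pqr by (elim disjE conjE; simp add: nabc)
    then show "odd (positions_sum ?E b) \<longleftrightarrow> odd (positions_sum D b)" by (rule eq)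
    have "positions_sum ?E c + positions_sum D c = 2 * (7 + 2 * length U + length V)"
      unfolding formD[OF notin(7-9)] formE[OF notin(7-9)]
      using pqr by (elim disjE conjE; simp add: nabc)
    then show "odd (positions_sum ?E c) \<longleftrightarrow> odd (positions_sum D c)" by (rule eq)
  qed
  have pqr_abc: "p1 \<in> {a, b, c}" "p2 \<in> {a, b, c}" "q1 \<in> {a, b, c}" "q2 \<in> {a, b, c}"
    "r1 \<in> {a, b, c}" "r2 \<in> {a, b, c}"
    using pqr by (elim disjE conjE; simp)+
  have po: "positions_sum ?E w = positions_sum D w" if "w \<notin> {a, b, c}" for w
  proof -
    have "p1 \<noteq> w" "p2 \<noteq> w" "q1 \<noteq> w" "q2 \<noteq> w" "r1 \<noteq> w" "r2 \<noteq> w" using that pqr_abc by metis+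
    then show ?thesis unfolding D by (simp add: positions_sum_append)
  qed
  have "set ?E = set D" unfolding D by auto
  moreover have "odd (positions_sum ?E w) \<longleftrightarrow> odd (positions_sum D w)" for w
  proof (cases "w \<in> {a, b, c}")
    case True
    then show ?thesis using ps(2-4) by blast
  next
    case False
    show ?thesis by (simp only: po[OF False])
  qed
  ultimately have SK: "even_verts ?K = S"
    unfolding S_def even_verts_iff[OF FG G(2)] even_verts_iff[OF FK KE] by simp
  have Siff: "w \<in> S \<longleftrightarrow> odd (positions_sum D w)" if "w \<in> set D" for w
    using that unfolding S_def even_verts_iff[OF FG G(2)] by simp
  \<comment> \<open>One or all three of the vertices are even, so one is even and the other two
    agree.\<close>
  have parity: "a \<in> S \<and> (b \<in> S \<longleftrightarrow> c \<in> S) \<or> b \<in> S \<and> (a \<in> S \<longleftrightarrow> c \<in> S) \<or> c \<in> S \<and> (a \<in> S \<longleftrightarrow> b \<in> S)"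
    using ps(1) Siff abcD by auto

  have wf: "wf_state X m p v {}" using framed_wf_state[OF FG] by (simp add: xd)
  have wf2: "wf_state X m p v2 {}" using framed_wf_state[OF FK] by (simp add: xd)
  \<comment> \<open>A triangle edge directed from \<open>x\<close> to \<open>y\<close>, with the
    block \<open>B\<close> of its four half-edges. It may be reversed, which lets each of the three
    vertices become the smoothed corner.\<close>
  define edge where
    "edge e x y B \<longleftrightarrow> e \<in> X \<and> m (m e) = e \<and> v e = x \<and> v (m e) = y \<and> v2 e = y \<and> v2 (m e) = x \<and>
      {e, m e, p e, p (m e)} = B" for e x y B
  have edge_sym: "edge (m e) y x B" if "edge e x y B" for e x y B
    using that M(1) unfolding edge_def by (auto simp: insert_commute)
  have v2v: "v2 h1 = p2" "v2 n2 = p1" "v2 h3 = q2" "v2 n4 = q1" "v2 h5 = r2" "v2 n6 = r1"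
    by (simp_all add: v2_def \<tau> vh vn)
  have e0: "edge h1 p1 p2 {h1, n1, h2, n2}" "edge h3 q1 q2 {h3, n3, h4, n4}"
    "edge h5 r1 r2 {h5, n5, h6, n6}"
    unfolding edge_def by (auto simp: TX mh mn vh vn v2v ph pn)
  obtain e1 where e1: "edge e1 a b {h1, n1, h2, n2}" using pqr(1) e0(1) edge_sym by blast
  obtain e2 where e2: "edge e2 b c {h3, n3, h4, n4}" using pqr(2) e0(2) edge_sym by blast
  obtain e3 where e3: "edge e3 a c {h5, n5, h6, n6}" using pqr(3) e0(3) edge_sym by blast
  have key: "state_sum X m p v {} S = state_sum X m p v2 {} S"
    if xyz: "distinct [x, y, z]" "{x, y, z} = {a, b, c}" "x \<in> S" "y \<in> S \<longleftrightarrow> z \<in> S"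
      and f: "edge f1 x y B1" "edge f2 y z B2" "edge f3 x z B3"
      and B: "B1 \<inter> B2 = {}" "B1 \<inter> B3 = {}" "B2 \<inter> B3 = {}"
    for x y z f1 f2 f3 B1 B2 B3
  proof (rule state_sum_triangle_edges[OF wf wf2 xyz(1,3,4), of f1 f2 f3])
    show "\<forall>h\<in>X. v h \<notin> {x, y, z} \<longrightarrow> v2 h = v h"
    proof (intro ballI impI)
      fix h assume "h \<in> X" "v h \<notin> {x, y, z}"
      then have "v h \<notin> {a, b, c}" unfolding xyz(2) by blast
      then have "h \<notin> ?T \<union> ?N" using pqr_abc vh vn by (metis UnE insertE emptyE)
      then show "v2 h = v h" by (simp add: v2_def \<tau>o)
    qed
  qed (use f B in \<open>simp_all only: edge_def\<close>)
  have B: "{h1, n1, h2, n2} \<inter> {h3, n3, h4, n4} = {}" "{h1, n1, h2, n2} \<inter> {h5, n5, h6, n6} = {}"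
    "{h3, n3, h4, n4} \<inter> {h5, n5, h6, n6} = {}"
    by (simp_all add: ne)
  have B': "{h3, n3, h4, n4} \<inter> {h1, n1, h2, n2} = {}" "{h5, n5, h6, n6} \<inter> {h1, n1, h2, n2} = {}"
    "{h5, n5, h6, n6} \<inter> {h3, n3, h4, n4} = {}"
    by (simp_all add: ne)
  have "state_sum X m p v {} S = state_sum X m p v2 {} S"
    using parity
  proof (elim disjE conjE)
    assume "a \<in> S" "b \<in> S \<longleftrightarrow> c \<in> S"
    then show ?thesis using key[OF abc(1) refl _ _ e1 e2 e3] B by simp
  next
    assume s: "b \<in> S" "a \<in> S \<longleftrightarrow> c \<in> S"
    have "distinct [b, a, c]" "{b, a, c} = {a, b, c}" using nabc by auto
    from key[OF this s edge_sym[OF e1] e3 e2] show ?thesis using B B' by blast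
  next
    assume s: "c \<in> S" "a \<in> S \<longleftrightarrow> b \<in> S"
    have "distinct [c, a, b]" "{c, a, b} = {a, b, c}" using nabc by auto
    from key[OF this s edge_sym[OF e3] e1 edge_sym[OF e2]] show ?thesis using B B' by blast
  qed
  then have "bracket G = bracket ?K"
    unfolding bracket_eq_Z[OF G(1)] bracket_eq_Z[OF K] SK by (simp add: S_def[symmetric] xd)
  then show ?thesis using K KE by blast
qed

lemma bracket_move3:
  assumes G: "unicursal_graph G" "D \<in> chord_diagram G" and H: "unicursal_graph H"
    "E \<in> chord_diagram H"
    and move: "move3 D E"
  shows "bracket G = bracket H"
  using move
proof cases
  case (1 a b c p1 p2 q1 q2 r1 r2 u v w)
  then obtain K where "unicursal_graph K" "E \<in> chord_diagram K" "bracket G = bracket K"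
    using bracket_relabel_triangle[OF G 1(1) 1(3-6)] by blast
  then show ?thesis using bracket_common_word H by metis
qed

lemma bracket_knot_step:
  assumes "knot_step G H"
  shows "bracket G = bracket H"
proof -
  have G: "unicursal_graph G" and H: "unicursal_graph H"
    and s: "isomorphic G H \<or> related_by move1 G H \<or> related_by move2 G H \<or> related_by move3 G H"
    using assms by (simp_all add: knot_step_def)
  show ?thesis
    using s unfolding related_by_def
    by (elim disjE bexE)
      (blast intro: bracket_isomorphic[OF G H] bracket_move1[OF G _ H] bracket_move2[OF G _ H]
        bracket_move3[OF G _ H])+
qed

theorem theorem1:
  fixes G G' :: graph
  assumes "unicursal_graph G" and "unicursal_graph G'"
    and "free_knot_of G = free_knot_of G'"
  shows "bracket G = bracket G'"
proof -
  have "knot_equiv G G'"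
    using Quotient3_rel[OF Quotient3_free_knot, of G G'] assms by (auto simp: knot_equiv_def)
  then have "equivclp knot_step G G'" by (simp add: knot_equiv_def)
  then show ?thesis
    by (induction rule: equivclp_induct) (auto dest: bracket_knot_step)
qed

end
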